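(* Let $p$ be a prime and let $h(-p)$ denote the class number of the imaginary quadratic field $\mathbb{Q}(\sqrt{-p})$. In any Welch-Costas array of order $p-1$, with $\#(e,e)$ and $\#(o,e)$ its numbers of even/even and odd/even dots: (a) if $p\equiv 7\pmod 8$, then $\#(e,e)-\#(o,e)=\pm h(-p)$; (b) if $p\equiv 3\pmod 8$, then $\#(e,e)-\#(o,e)=\pm 3h(-p)$.
   Context: For an odd prime $p$, let $\Omega=\{1,2,\dots,p-1\}$. Given a generator $\alpha$ of $\mathbb{F}_p^*$ and any $c\in\mathbb{F}_p^*$, define the permutation $\sigma_{\alpha,c}$ of $\Omega$ by $\sigma_{\alpha,c}(i)=j$, where $j\in\Omega$ satisfies $c\alpha^i\equiv j\pmod p$. The Welch-Costas array of order $p-1$ associated with $(\alpha,c)$ is the $(p-1)\times(p-1)$ array with a dot in position $(i,\sigma_{\alpha,c}(i))$ (row $i$, column $\sigma_{\alpha,c}(i)$) for each $i\in\Omega$. A dot in row $i$, column $j$ is even/even if $i$ and $j$ are both even, and odd/even if $i$ is odd and $j$ is even. The class number of a number field is the order of the ideal class group of its ring of integers. The sign $\pm$ means that the difference equals either $+h(-p)$ or $-h(-p)$ (resp. $\pm 3h(-p)$), depending on the array.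
   Formalization: In part (b) the prime p = 3 is excluded, because the claim fails there: h(-3) = 1, but the two Welch-Costas arrays of order 2 have #(e,e) - #(o,e) = ±1, not ±3. *)

theory Defs
  imports
    Complex_Main
    "HOL-Computational_Algebra.Polynomial"
    "HOL-Number_Theory.Residue_Primitive_Roots"
    "HOL-Algebra.Coset"
begin

text \<open>Number fields are represented as subfields \<open>K\<close> of the complex numbers.\<close>

definition imag_quadratic_field :: "nat \<Rightarrow> complex set" where
  "imag_quadratic_field d = {a + b * csqrt (- of_nat d) | a b. a \<in> \<rat> \<and> b \<in> \<rat>}"

definition ring_of_integers :: "complex set \<Rightarrow> complex set" where
  "ring_of_integers K = {x \<in> K. algebraic_int x}"

text \<open>Nonzero fractional ideals. Closure under negation follows from \<open>-1\<close> being an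
  algebraic integer.\<close>

definition fractional_ideals :: "complex set \<Rightarrow> complex set set" where
  "fractional_ideals K = {I. I \<subseteq> K \<and> 0 \<in> I \<and> I \<noteq> {0} \<and>
     (\<forall>x\<in>I. \<forall>y\<in>I. x + y \<in> I) \<and>
     (\<forall>r\<in>ring_of_integers K. \<forall>x\<in>I. r * x \<in> I) \<and>
     (\<exists>d\<in>ring_of_integers K. d \<noteq> 0 \<and> (\<forall>x\<in>I. d * x \<in> ring_of_integers K))}"

definition fractional_ideal_mult :: "complex set \<Rightarrow> complex set \<Rightarrow> complex set" where
  "fractional_ideal_mult I J =
     {(\<Sum>k<n. f k * g k) | (n :: nat) f g. (\<forall>k<n. f k \<in> I \<and> g k \<in> J)}"

definition fractional_ideal_group :: "complex set \<Rightarrow> complex set monoid" where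
  "fractional_ideal_group K =
     \<lparr>carrier = fractional_ideals K, mult = fractional_ideal_mult, one = ring_of_integers K\<rparr>"

definition principal_fractional_ideals :: "complex set \<Rightarrow> complex set set" where
  "principal_fractional_ideals K = {(\<lambda>y. x * y) ` ring_of_integers K | x. x \<in> K \<and> x \<noteq> 0}"

definition ideal_class_group :: "complex set \<Rightarrow> complex set set monoid" where
  "ideal_class_group K = fractional_ideal_group K Mod principal_fractional_ideals K"

definition class_number :: "complex set \<Rightarrow> nat" where
  "class_number K = Coset.order (ideal_class_group K)"

text \<open>Elements of the multiplicative group modulo \<open>p\<close> are given by arbitrary natural number
  representatives, so a generator is a primitive root modulo \<open>p\<close>.\<close>

definition welch_perm :: "nat \<Rightarrow> nat \<Rightarrow> nat \<Rightarrow> nat \<Rightarrow> nat" where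
  "welch_perm p \<alpha> c i = (THE j. j \<in> {1..p-1} \<and> [c * \<alpha> ^ i = j] (mod p))"

text \<open>An array is identified with the set of (row, column) positions of its dots.\<close>

definition welch_costas_array :: "nat \<Rightarrow> nat \<Rightarrow> nat \<Rightarrow> (nat \<times> nat) set" where
  "welch_costas_array p \<alpha> c = {(i, welch_perm p \<alpha> c i) | i. i \<in> {1..p-1}}"

definition is_welch_costas_array :: "nat \<Rightarrow> (nat \<times> nat) set \<Rightarrow> bool" where
  "is_welch_costas_array p A \<longleftrightarrow>
     (\<exists>\<alpha> c. residue_primroot p \<alpha> \<and> \<not> p dvd c \<and> A = welch_costas_array p \<alpha> c)"

definition num_even_even :: "(nat \<times> nat) set \<Rightarrow> nat" where
  "num_even_even A = card {(i, j). (i, j) \<in> A \<and> even i \<and> even j}"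

definition num_odd_even :: "(nat \<times> nat) set \<Rightarrow> nat" where
  "num_odd_even A = card {(i, j). (i, j) \<in> A \<and> odd i \<and> even j}"

end

theory Submission
  imports
    Defs
    "HOL-Analysis.Analysis"
    "HOL-Number_Theory.Number_Theory"
    "HOL-Computational_Algebra.Nth_Powers"
    "HOL-Library.Discrete_Functions"
begin

text \<open>
  Let \<open>\<chi>\<close> be the Legendre symbol modulo \<open>p\<close>, where \<open>p \<equiv> 3 (mod 4)\<close> and \<open>p > 3\<close>. Since \<open>\<chi>(\<alpha>) = -1\<close>,
  the dot in row \<open>i\<close> lies in a column \<open>j\<close> with \<open>\<chi>(j) = \<chi>(c) (-1)^i\<close>, so the difference to be computed is,
  up to sign, the sum of \<open>\<chi>\<close> over the even residues. By elementary rearrangement this sum is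
  \<open>(1 - 2\<chi>(2)) S / p\<close> with \<open>S = \<Sum>k<p. k \<chi>(k)\<close>, and it remains to see that the class number is \<open>\<bar>S\<bar> / p\<close>.

  For this, count the ideals of norm at most \<open>N\<close> in two ways. The number of ideals of norm \<open>n\<close> is
  \<open>\<Sum>d dvd n. \<chi>(d)\<close>, so the total is asymptotic to \<open>L(1,\<chi>) N\<close>. On the other hand the ideals in a fixed class
  correspond, up to sign, to the lattice points in an ellipse of area \<open>2\<pi>N / \<surd>p\<close>, so each class contributes
  \<open>\<pi>N / \<surd>p\<close>. Finally \<open>L(1,\<chi>)\<close> is a combination of digamma values at \<open>k/p\<close>; the reflection formula and
  Gauss sums turn it into \<open>\<plusminus>\<pi>S / (p\<surd>p)\<close>. The sign of the Gauss sum is irrelevant because the class number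
  is nonnegative.
\<close>

text \<open>The bound p > 3 enters through the units: each ideal accounts for exactly two lattice
  points because 1 and -1 are the only units of Z[omega], where omega = (1 + sqrt(-p))/2. For p = 3
  there are six units, the class number is 1, and the difference of the dot counts is 1 or -1
  instead of 3 or -3. The class number is the cardinality of a set of cosets, and an infinite set
  has cardinality 0. Finiteness of the class group therefore has to come out of the count itself; it
  does, since every finite set of classes accounts for no more ideals than there are in total. The
  arithmetic of ideals is replaced by explicit lattices Z a + Z (b + omega): a class is an orbit
  under scaling, and the norm of an ideal is read off from the covolume of the lattice. The divisor
  sum of \<chi> arises because, for a prime q, the ideals of norm q correspond to the roots of b^2 +
  b + (p + 1)/4 modulo q. Completing the square asks whether -p is a square modulo q, and quadratic
  reciprocity turns this into \<chi>(q).\<close>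

locale imag_quadratic =
  fixes p :: nat
  assumes prime_p: "prime p" and p_mod_4: "p mod 4 = 3" and p_gt_3: "p > 3"
begin

definition chi :: "nat \<Rightarrow> int" where
  "chi n = Legendre (int n) (int p)"

end

section \<open>The quadratic character\<close>

lemma Legendre_values: "Legendre a p \<in> {-1, 0, 1}"
  by (auto simp: Legendre_def)

lemma Legendre_cong:
  assumes "[a = b] (mod p)"
  shows "Legendre a p = Legendre b p"
proof -
  have "[a = 0] (mod p) \<longleftrightarrow> [b = 0] (mod p)" "QuadRes p a \<longleftrightarrow> QuadRes p b"
    using assms unfolding QuadRes_def by (meson cong_sym cong_trans)+
  thus ?thesis by (simp add: Legendre_def)
qed

text \<open>Values in {-1, 0, 1} differ by at most 2 < p. This turns Euler's criterion, which is
  only a congruence, into equations between Legendre symbols.\<close>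

lemma small_cong_imp_eq:
  fixes x y :: int
  assumes "[x = y] (mod int p)" "x \<in> {-1, 0, 1}" "y \<in> {-1, 0, 1}" "p > 2"
  shows "x = y"
proof (rule ccontr)
  assume "x \<noteq> y"
  from assms(1) have "int p dvd x - y" by (simp add: cong_iff_dvd_diff)
  hence "\<bar>int p\<bar> \<le> \<bar>x - y\<bar>" using \<open>x \<noteq> y\<close> by (intro dvd_imp_le_int) auto
  moreover have "\<bar>x - y\<bar> \<le> 2" using assms(2,3) by auto
  ultimately show False using assms(4) by linarith
qed

lemma Legendre_mult:
  assumes "prime p" "p > 2"
  shows "Legendre (a * b) (int p) = Legendre a (int p) * Legendre b (int p)"
proof (rule small_cong_imp_eq)
  show "[Legendre (a * b) (int p) = Legendre a (int p) * Legendre b (int p)] (mod int p)"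
  proof -
    have "[Legendre (a * b) (int p) = (a * b) ^ ((p - 1) div 2)] (mod int p)"
      by (rule euler_criterion[OF assms])
    also have "(a * b) ^ ((p - 1) div 2) = a ^ ((p - 1) div 2) * b ^ ((p - 1) div 2)"
      by (rule power_mult_distrib)
    also have "[\<dots> = Legendre a (int p) * Legendre b (int p)] (mod int p)"
      by (intro cong_mult cong_sym[OF euler_criterion[OF assms]])
    finally show ?thesis .
  qed
  show "Legendre a (int p) * Legendre b (int p) \<in> {-1, 0, 1}"
    using Legendre_values[of a "int p"] Legendre_values[of b "int p"] by auto
qed (use assms Legendre_values in auto)

lemma Legendre_minus_1:
  assumes "prime p" "p > 2"
  shows "Legendre (-1) (int p) = (-1) ^ ((p - 1) div 2)"
  by (rule small_cong_imp_eq[OF euler_criterion[OF assms]])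
     (use assms Legendre_values in \<open>auto simp: minus_one_power_iff\<close>)

lemma Legendre_2:
  assumes "prime p" "p mod 4 = 3"
  shows "Legendre 2 (int p) = (if p mod 8 = 7 then 1 else -1)"
proof -
  have p3: "p \<ge> 3" using assms(2) by (metis mod_less_eq_dividend)
  have "\<not> int p dvd 2"
    using p3 zdvd_imp_le[of "int p" 2] by auto
  hence "[2 \<noteq> 0] (mod int p)" by (simp add: cong_0_iff)
  interpret GAUSS p 2
    using assms(1) p3 \<open>[2 \<noteq> 0] (mod int p)\<close> by unfold_locales auto
  define k where "k = int p div 4"
  have pk: "int p = 4 * k + 3"
    using assms(2) by (simp add: k_def) presburger
  have k0: "k \<ge> 0" by (simp add: k_def)
  have half: "(int p - 1) div 2 = 2 * k + 1" using pk by simp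
  \<comment> \<open>With p = 4k + 3 the doubles of the half system 1..2k+1 stay below p, so no
    reduction takes place.\<close>
  have Ceq: "C = (\<lambda>x. x * 2) ` {0<..2*k+1}"
  proof -
    have "C = (\<lambda>x. x * 2 mod int p) ` {0<..2*k+1}"
      by (simp add: C_def B_def A_def image_image half)
    also have "\<dots> = (\<lambda>x. x * 2) ` {0<..2*k+1}"
      by (intro image_cong) (auto simp: pk)
    finally show ?thesis .
  qed
  \<comment> \<open>Gauss's lemma counts the doubles beyond (p - 1)/2 = 2k + 1. They come from x >
    k, so there are k + 1 of them.\<close>
  have "E = (\<lambda>x. x * 2) ` {k<..2*k+1}"
    unfolding E_def Ceq half using k0 by auto
  hence "card E = card {k<..2*k+1}"
    by (simp add: card_image inj_on_def)
  hence cE: "card E = nat (k + 1)" by simp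
  have "Legendre 2 (int p) = (-1) ^ nat (k + 1)"
    using gauss_lemma cE by simp
  moreover have "even (nat (k + 1)) \<longleftrightarrow> p mod 8 = 7"
  proof -
    have "even (nat (k + 1)) \<longleftrightarrow> even (k + 1)" using k0 by (simp add: even_nat_iff)
    also have "\<dots> \<longleftrightarrow> int p mod 8 = 7" using pk by presburger
    also have "\<dots> \<longleftrightarrow> p mod 8 = 7" by presburger
    finally show ?thesis .
  qed
  ultimately show ?thesis by (simp add: minus_one_power_iff)
qed

context imag_quadratic
begin

lemma p_gt_2: "p > 2" using p_gt_3 by simp

lemma odd_p: "odd p" using p_mod_4 by presburger

lemma chi_values: "chi n \<in> {-1, 0, 1}"
  unfolding chi_def by (rule Legendre_values)

lemma chi_mult: "chi (m * n) = chi m * chi n"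
  unfolding chi_def by (simp add: Legendre_mult[OF prime_p p_gt_2])

lemma chi_1 [simp]: "chi (Suc 0) = 1" "chi 1 = 1"
proof -
  have "\<not> int p dvd 1" using p_gt_2 by simp
  moreover have "QuadRes (int p) 1" by (auto simp: QuadRes_def intro!: exI[of _ 1])
  ultimately show "chi 1 = 1" by (simp add: chi_def Legendre_def cong_0_iff)
  thus "chi (Suc 0) = 1" by simp
qed

lemma chi_power: "chi (n ^ k) = chi n ^ k"
  by (induction k) (auto simp: chi_mult)

lemma chi_eq_0_iff: "chi n = 0 \<longleftrightarrow> p dvd n"
  by (simp add: chi_def Legendre_def cong_0_iff)

lemma chi_cong: "[m = n] (mod p) \<Longrightarrow> chi m = chi n"
  unfolding chi_def by (intro Legendre_cong) (simp add: cong_int_iff)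

lemma chi_2: "chi 2 = (if p mod 8 = 7 then 1 else -1)"
  using Legendre_2[OF prime_p p_mod_4] by (simp add: chi_def)

text \<open>-1 is a non-residue because (p - 1)/2 is odd. That \<open>chi\<close> is odd is what
  makes the later pairings of k with p - k work.\<close>

lemma chi_neg:
  assumes "k \<le> p"
  shows "chi (p - k) = - chi k"
proof -
  have "[int (p - k) = (-1) * int k] (mod int p)"
    using assms by (simp add: cong_iff_dvd_diff of_nat_diff)
  hence "chi (p - k) = Legendre ((-1) * int k) (int p)"
    unfolding chi_def by (rule Legendre_cong)
  also have "\<dots> = Legendre (-1) (int p) * chi k"
    unfolding chi_def by (rule Legendre_mult[OF prime_p p_gt_2])
  also have "Legendre (-1) (int p) = -1"
  proof -
    have "odd ((p - 1) div 2)" using p_mod_4 by presburger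
    thus ?thesis by (simp add: Legendre_minus_1[OF prime_p p_gt_2])
  qed
  finally show ?thesis by simp
qed

end

section \<open>Counting ideals by norm\<close>

text \<open>A divisor of the product is d e with d dividing m and e dividing n, and the gcds with m
  and n recover this pair. Hence the Dirichlet convolution of two multiplicative functions is
  multiplicative.\<close>

lemma divisor_sum_coprime_mult:
  fixes F G :: "nat \<Rightarrow> int"
  assumes F: "\<And>m n. coprime m n \<Longrightarrow> F (m * n) = F m * F n"
    and G: "\<And>m n. coprime m n \<Longrightarrow> G (m * n) = G m * G n"
    and mn: "coprime m n" "m > 0" "n > 0"
  shows "(\<Sum>d | d dvd m * n. F d * G (m * n div d)) =
         (\<Sum>d | d dvd m. F d * G (m div d)) * (\<Sum>d | d dvd n. F d * G (n div d))"
proof -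
  have gcd_eq: "gcd (d * e) m = d" "gcd (d * e) n = e" if de: "d dvd m" "e dvd n" for d e
  proof -
    have "coprime d n" "coprime e m"
      using de mn(1) by (meson coprime_divisors coprime_commute dvd_refl)+
    thus "gcd (d * e) m = d" "gcd (d * e) n = e"
      using de by (simp_all add: gcd_mult_left_left_cancel gcd_mult_left_right_cancel coprime_commute gcd_nat.absorb1)
  qed
  have "(\<Sum>d | d dvd m. F d * G (m div d)) * (\<Sum>d | d dvd n. F d * G (n div d))
      = (\<Sum>(d,e) \<in> {d. d dvd m} \<times> {e. e dvd n}. (F d * G (m div d)) * (F e * G (n div e)))"
    by (simp add: sum_product sum.cartesian_product)
  also have "\<dots> = (\<Sum>d | d dvd m * n. F d * G (m * n div d))"
  proof (rule sum.reindex_bij_witness[where i = "\<lambda>d. (gcd d m, gcd d n)" and j = "\<lambda>(d,e). d * e"])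
    fix x assume x: "x \<in> {d. d dvd m} \<times> {e. e dvd n}"
    obtain d e where de: "x = (d, e)" "d dvd m" "e dvd n" using x by auto
    have cop: "coprime d e" "coprime (m div d) (n div e)"
      using de mn by (auto elim!: dvdE simp: coprime_commute)
    show "(case case x of (d, e) \<Rightarrow> d * e of d \<Rightarrow> (gcd d m, gcd d n)) = x"
      using gcd_eq[OF de(2,3)] by (simp add: de)
    show "(case x of (d, e) \<Rightarrow> d * e) \<in> {d. d dvd m * n}"
      using de by (auto intro: mult_dvd_mono)
    have "m * n div (d * e) = (m div d) * (n div e)"
      using de mn by (simp add: div_mult_div_if_dvd)
    thus "F (case x of (d, e) \<Rightarrow> d * e) * G (m * n div (case x of (d, e) \<Rightarrow> d * e)) =
        (case x of (d, e) \<Rightarrow> F d * G (m div d) * (F e * G (n div e)))"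
      using F[OF cop(1)] G[OF cop(2)] by (simp add: de)
  next
    fix d assume d: "d \<in> {d. d dvd m * n}"
    then obtain a b where ab: "d = a * b" "a dvd m" "b dvd n"
      using division_decomp[of d m n] by auto
    thus "(case (gcd d m, gcd d n) of (d, e) \<Rightarrow> d * e) = d" using gcd_eq[of a b] by simp
    show "(gcd d m, gcd d n) \<in> {d. d dvd m} \<times> {e. e dvd n}" by auto
  qed
  finally show ?thesis by simp
qed

section \<open>Roots of the norm polynomial modulo prime powers\<close>

context imag_quadratic
begin

text \<open>The norm of omega; the division is exact since \<open>p mod 4 = 3\<close>.\<close>

definition norm_const :: int where
  "norm_const = int ((p + 1) div 4)"

lemma norm_const: "4 * norm_const = int p + 1"
  unfolding norm_const_def using p_mod_4 by presburger

text \<open>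
  \<open>norm_poly b\<close> is the norm of \<open>b + \<omega>\<close> for \<open>\<omega> = (1 + \<surd>-p)/2\<close>; its roots modulo \<open>a\<close> correspond to the ideals
  \<open>\<int>a + \<int>(b + \<omega>)\<close> of norm \<open>a\<close>.
\<close>

definition norm_poly :: "int \<Rightarrow> int" where
  "norm_poly b = b\<^sup>2 + b + norm_const"

lemma norm_poly_complete_square: "4 * norm_poly b = (2 * b + 1)\<^sup>2 + int p"
  using norm_const by (simp add: norm_poly_def algebra_simps power2_eq_square)

text \<open>For congruent x and y the second factor is the derivative 2x + 1, which gives uniqueness
  of Hensel lifts; its vanishing exhibits -1 - y as the other root.\<close>

lemma norm_poly_diff: "norm_poly x - norm_poly y = (x - y) * (x + y + 1)"
  by (simp add: norm_poly_def algebra_simps power2_eq_square)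

lemma norm_poly_cong:
  assumes "[x = y] (mod n)"
  shows "n dvd norm_poly x \<longleftrightarrow> n dvd norm_poly y"
proof -
  have "n dvd norm_poly x - norm_poly y"
    using assms unfolding norm_poly_diff cong_iff_dvd_diff by (rule dvd_mult2)
  thus ?thesis using dvd_diff_commute[of n "norm_poly x"] dvd_add_right_iff[of n
    "norm_poly x - norm_poly y" "norm_poly y"] by simp
qed

definition roots_mod :: "nat \<Rightarrow> int set" where
  "roots_mod a = {b \<in> {0..<int a}. int a dvd norm_poly b}"

definition rho :: "nat \<Rightarrow> nat" where
  "rho a = card (roots_mod a)"

lemma finite_roots_mod [simp, intro]: "finite (roots_mod a)"
  unfolding roots_mod_def by (rule finite_subset[of _ "{0..<int a}"]) auto

lemma rho_1: "rho (Suc 0) = 1"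
proof -
  have "roots_mod (Suc 0) = {0}" by (auto simp: roots_mod_def)
  thus ?thesis by (simp add: rho_def)
qed

lemma rho_mult:
  assumes "coprime a b"
  shows "rho (a * b) = rho a * rho b"
proof (cases "a = 0 \<or> b = 0")
  case True
  moreover have "rho 0 = 0" by (simp add: rho_def roots_mod_def)
  ultimately show ?thesis by auto
next
  case False
  hence pos: "a > 0" "b > 0" by auto
  have cop: "coprime (int a) (int b)" using assms by simp
  have "bij_betw (\<lambda>x. (x mod int a, x mod int b)) (roots_mod (a * b)) (roots_mod a \<times> roots_mod b)"
    unfolding bij_betw_def
  proof
    show "inj_on (\<lambda>x. (x mod int a, x mod int b)) (roots_mod (a * b))"
    proof (rule inj_onI)
      fix x y assume xy: "x \<in> roots_mod (a * b)" "y \<in> roots_mod (a * b)"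
        "(x mod int a, x mod int b) = (y mod int a, y mod int b)"
      hence "[x = y] (mod int a)" "[x = y] (mod int b)"
        by (auto simp: unique_euclidean_semiring_class.cong_def)
      hence "[x = y] (mod (int a * int b))" using cop by (rule coprime_cong_mult)
      with xy show "x = y" by (auto simp: roots_mod_def unique_euclidean_semiring_class.cong_def)
    qed
    show "(\<lambda>x. (x mod int a, x mod int b)) ` roots_mod (a * b) = roots_mod a \<times> roots_mod b"
    proof (intro equalityI subsetI)
      fix z assume "z \<in> (\<lambda>x. (x mod int a, x mod int b)) ` roots_mod (a * b)"
      then obtain x where x: "z = (x mod int a, x mod int b)" "int a * int b dvd norm_poly x"
        by (auto simp: roots_mod_def)
      hence "int a dvd norm_poly x" "int b dvd norm_poly x"
        by (auto dest: dvd_mult_left dvd_mult_right)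
      moreover have "int a dvd norm_poly (x mod int a) \<longleftrightarrow> int a dvd norm_poly x"
        "int b dvd norm_poly (x mod int b) \<longleftrightarrow> int b dvd norm_poly x"
        by (auto intro!: norm_poly_cong)
      ultimately show "z \<in> roots_mod a \<times> roots_mod b"
        using x pos by (auto simp: roots_mod_def)
    next
      fix z assume "z \<in> roots_mod a \<times> roots_mod b"
      then obtain u v where uv: "z = (u, v)" "u \<in> roots_mod a" "v \<in> roots_mod b" by auto
      obtain x where x: "[x = u] (mod int a)" "[x = v] (mod int b)"
        using binary_chinese_remainder_int[OF cop, of u v] by auto
      define y where "y = x mod (int a * int b)"
      have y: "[y = u] (mod int a)" "[y = v] (mod int b)"
        using x by (auto simp: y_def unique_euclidean_semiring_class.cong_def mod_mod_cancel)
      have "int a dvd norm_poly y" "int b dvd norm_poly y"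
        using norm_poly_cong[OF y(1)] norm_poly_cong[OF y(2)] uv by (auto simp: roots_mod_def)
      hence "int a * int b dvd norm_poly y" using cop by (rule divides_mult)
      hence "y \<in> roots_mod (a * b)" using pos by (simp add: roots_mod_def y_def)
      moreover have "z = (y mod int a, y mod int b)"
        using y uv by (auto simp: roots_mod_def unique_euclidean_semiring_class.cong_def)
      ultimately show "z \<in> (\<lambda>x. (x mod int a, x mod int b)) ` roots_mod (a * b)" by blast
    qed
  qed
  hence "card (roots_mod (a * b)) = card (roots_mod a \<times> roots_mod b)"
    by (rule bij_betw_same_card)
  thus ?thesis by (simp add: rho_def card_cartesian_product)
qed

text \<open>A prime dividing both the polynomial and its derivative 2x + 1 divides 4
  \<open>norm_poly x\<close> - (2x + 1)^2 = p. So only p can have a multiple root.\<close>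

lemma derivative_nonzero_at_root:
  assumes "prime q" "q \<noteq> p" "int q dvd norm_poly x"
  shows "coprime (2 * x + 1) (int q)"
proof -
  have "\<not> int q dvd 2 * x + 1"
  proof
    assume "int q dvd 2 * x + 1"
    hence "int q dvd (2 * x + 1)\<^sup>2" by (simp add: power2_eq_square)
    moreover have "int q dvd (2 * x + 1)\<^sup>2 + int p"
      using assms(3) by (metis norm_poly_complete_square dvd_mult)
    ultimately have "int q dvd int p" by (simp add: dvd_add_right_iff)
    thus False using assms prime_p by (simp add: primes_dvd_imp_eq)
  qed
  thus ?thesis using assms(1) by (metis coprime_commute prime_imp_coprime prime_int_nat_transfer nat_int prime_nat_int_transfer)
qed

text \<open>Hensel's lemma: the roots modulo q are simple, so reduction modulo \<open>q ^ k\<close>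
  is a bijection from the roots modulo \<open>q ^ Suc k\<close> to those modulo
  \<open>q ^ k\<close>.\<close>

lemma rho_prime_power_Suc:
  assumes q: "prime q" "q \<noteq> p" and k: "k > 0"
  shows "rho (q ^ Suc k) = rho (q ^ k)"
proof -
  have q0: "q > 0" using q(1) by (simp add: prime_gt_0_nat)
  define Q where "Q = int q"
  have Q: "Q > 0" "int (q ^ n) = Q ^ n" for n using q0 by (auto simp: Q_def)
  have Qdvd: "Q dvd Q ^ k" "Q ^ k dvd Q ^ Suc k" using k by (auto intro: dvd_power)
  have "bij_betw (\<lambda>x. x mod Q ^ k) (roots_mod (q ^ Suc k)) (roots_mod (q ^ k))"
    unfolding bij_betw_def
  proof
    show "inj_on (\<lambda>x. x mod Q ^ k) (roots_mod (q ^ Suc k))"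
    proof (rule inj_onI)
      fix x y assume xy: "x \<in> roots_mod (q ^ Suc k)" "y \<in> roots_mod (q ^ Suc k)"
        "x mod Q ^ k = y mod Q ^ k"
      have x: "Q ^ Suc k dvd norm_poly x" and y: "Q ^ Suc k dvd norm_poly y"
        using xy(1,2) unfolding roots_mod_def Q by blast+
      have "Q dvd norm_poly x" using x Qdvd by (meson dvd_trans)
      hence cop: "coprime (2 * x + 1) Q"
        using derivative_nonzero_at_root[OF q] by (simp add: Q_def)
      have "Q dvd x - y" using xy(3) Qdvd by (meson dvd_trans mod_eq_dvd_iff)
      hence "coprime (x + y + 1) Q"
      proof -
        have "[2 * x + 1 = x + y + 1] (mod Q)" using \<open>Q dvd x - y\<close> by (simp add: cong_iff_dvd_diff)
        thus ?thesis using cop by (metis cong_imp_coprime)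
      qed
      hence "coprime (x + y + 1) (Q ^ Suc k)" by simp
      moreover have "Q ^ Suc k dvd (x - y) * (x + y + 1)"
        using x y norm_poly_diff by (metis dvd_diff)
      ultimately have "Q ^ Suc k dvd x - y"
        by (metis coprime_commute coprime_dvd_mult_left_iff)
      hence "x mod Q ^ Suc k = y mod Q ^ Suc k" by (simp add: mod_eq_dvd_iff)
      moreover have "x \<in> {0..<Q ^ Suc k}" "y \<in> {0..<Q ^ Suc k}"
        using xy(1,2) unfolding roots_mod_def Q by blast+
      ultimately show "x = y" by (simp del: power_Suc)
    qed
    show "(\<lambda>x. x mod Q ^ k) ` roots_mod (q ^ Suc k) = roots_mod (q ^ k)"
    proof (intro equalityI subsetI)
      fix z assume "z \<in> (\<lambda>x. x mod Q ^ k) ` roots_mod (q ^ Suc k)"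
      then obtain x where x: "z = x mod Q ^ k" "Q ^ Suc k dvd norm_poly x"
        unfolding roots_mod_def Q by blast
      have "Q ^ k dvd norm_poly x" using x(2) Qdvd(2) by (rule dvd_trans[rotated])
      moreover have "Q ^ k dvd norm_poly z \<longleftrightarrow> Q ^ k dvd norm_poly x"
        unfolding x by (intro norm_poly_cong) simp
      ultimately show "z \<in> roots_mod (q ^ k)"
        unfolding roots_mod_def Q using Q(1) by (simp add: x(1))
    next
      fix x assume x: "x \<in> roots_mod (q ^ k)"
      hence x': "Q ^ k dvd norm_poly x" "x \<in> {0..<Q^k}" unfolding roots_mod_def Q by blast+
      then obtain s where s: "norm_poly x = Q ^ k * s" by auto
      have "Q dvd norm_poly x" using x' Qdvd by (meson dvd_trans)
      hence "coprime (2 * x + 1) Q"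
        using derivative_nonzero_at_root[OF q] by (simp add: Q_def)
      then obtain t0 where t0: "[(2 * x + 1) * t0 = 1] (mod Q)"
        using cong_solve_coprime_int by blast
      \<comment> \<open>Newton correction: modulo \<open>Q ^ Suc k\<close>, the value at
        \<open>x + Q ^ k * t\<close> is \<open>Q ^ k\<close> times
        \<open>s + t * (2 * x + 1)\<close>, and \<open>t0\<close> inverts the derivative modulo
        \<open>Q\<close>.\<close>
      define t where "t = - s * t0"
      have t: "Q dvd s + t * (2 * x + 1)"
      proof -
        have "[- s * ((2 * x + 1) * t0) = - s * 1] (mod Q)" by (rule cong_scalar_left[OF t0])
        hence "Q dvd - s * ((2 * x + 1) * t0) - (- s * 1)" by (simp only: cong_iff_dvd_diff)
        moreover have "- s * ((2 * x + 1) * t0) - (- s * 1) = s + t * (2 * x + 1)"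
          by (simp add: t_def algebra_simps)
        ultimately show ?thesis by metis
      qed
      define y where "y = x + Q ^ k * t"
      have "norm_poly y = Q ^ k * (s + t * (2 * x + 1) + Q ^ k * t\<^sup>2)"
      proof -
        have "norm_poly y = norm_poly x + (y - x) * (y + x + 1)"
          using norm_poly_diff[of y x] by simp
        thus ?thesis by (simp add: s y_def algebra_simps power2_eq_square)
      qed
      moreover have "Q dvd s + t * (2 * x + 1) + Q ^ k * t\<^sup>2"
        using t Qdvd(1) by simp
      ultimately have "Q ^ Suc k dvd norm_poly y"
        by (metis mult_dvd_mono dvd_refl power_Suc2)
      moreover have "Q ^ Suc k dvd norm_poly (y mod Q ^ Suc k) \<longleftrightarrow> Q ^ Suc k dvd norm_poly y"
        by (intro norm_poly_cong) simp
      ultimately have "y mod Q ^ Suc k \<in> roots_mod (q ^ Suc k)"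
        unfolding roots_mod_def Q using Q(1) by (simp del: power_Suc)
      moreover have "y mod Q ^ Suc k mod Q ^ k = x"
        using x' Qdvd(2) by (simp add: mod_mod_cancel y_def del: power_Suc)
      ultimately show "x \<in> (\<lambda>x. x mod Q ^ k) ` roots_mod (q ^ Suc k)" by force
    qed
  qed
  thus ?thesis unfolding rho_def by (rule bij_betw_same_card)
qed

text \<open>The roots come in pairs b, -1 - b, and the two members are distinct modulo q because 2b
  + 1 is a unit there.\<close>

lemma rho_prime_cases:
  assumes q: "prime q" "q \<noteq> p"
  shows "rho q = (if \<exists>b. int q dvd norm_poly b then 2 else 0)"
proof (cases "\<exists>b. int q dvd norm_poly b")
  case False
  thus ?thesis by (simp add: rho_def roots_mod_def)
next
  case True
  then obtain b' where b': "int q dvd norm_poly b'" by blast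
  define b where "b = b' mod int q"
  have q0: "int q > 0" using q(1) by (simp add: prime_gt_0_nat)
  have "int q dvd norm_poly b \<longleftrightarrow> int q dvd norm_poly b'"
    unfolding b_def by (intro norm_poly_cong) simp
  hence b: "int q dvd norm_poly b" "b \<in> {0..<int q}" using b' q0 by (auto simp: b_def)
  define c where "c = (-1 - b) mod int q"
  have c: "c \<in> {0..<int q}" using q0 by (simp add: c_def)
  have qint: "prime (int q)" using q by simp
  have ccong: "[c = -1 - b] (mod int q)" by (simp add: c_def)
  have "roots_mod q = {b, c}"
  proof (intro equalityI subsetI)
    fix x assume x: "x \<in> roots_mod q"
    hence "int q dvd (x - b) * (x + b + 1)"
      using b by (auto simp: roots_mod_def simp flip: norm_poly_diff)
    hence "int q dvd x - b \<or> int q dvd x + b + 1" using qint by (simp add: prime_dvd_mult_iff)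
    hence "[x = b] (mod int q) \<or> [x = -1 - b] (mod int q)"
      by (simp add: cong_iff_dvd_diff algebra_simps)
    hence "[x = b] (mod int q) \<or> [x = c] (mod int q)" using ccong by (meson cong_sym cong_trans)
    thus "x \<in> {b, c}" using x b(2) c by (auto simp: roots_mod_def intro: cong_less_imp_eq_int)
  next
    fix x assume "x \<in> {b, c}"
    moreover have "int q dvd norm_poly c"
    proof -
      have "norm_poly (-1 - b) = norm_poly b"
        by (simp add: norm_poly_def power2_eq_square algebra_simps)
      thus ?thesis using b norm_poly_cong[OF ccong] by simp
    qed
    ultimately show "x \<in> roots_mod q" using b c by (auto simp: roots_mod_def)
  qed
  moreover have "b \<noteq> c"
  proof
    assume "b = c"
    hence "[b = -1 - b] (mod int q)" using ccong by simp
    hence "int q dvd 2 * b + 1" by (simp add: cong_iff_dvd_diff algebra_simps)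
    moreover have "coprime (2 * b + 1) (int q)" by (rule derivative_nonzero_at_root[OF q b(1)])
    ultimately have "is_unit (int q)" by (metis coprime_common_divisor dvd_refl)
    thus False using qint by (simp add: not_prime_unit) 
  qed
  ultimately show ?thesis using True by (simp add: rho_def)
qed

text \<open>For odd q, quadratic reciprocity gives that \<open>chi q\<close> is the Legendre symbol
  of -p modulo q, and a monic quadratic of discriminant -p has a root exactly if -p is a square. For
  q = 2, b^2 + b is always even, so a root exists iff (p + 1)/4 is even, that is
  \<open>p mod 8 = 7\<close>.\<close>

lemma chi_prime_eq_1_iff:
  assumes q: "prime q" "q \<noteq> p"
  shows "chi q = 1 \<longleftrightarrow> (\<exists>b. int q dvd norm_poly b)"
proof (cases "q = 2")
  case True
  have "2 dvd norm_poly b \<longleftrightarrow> even norm_const" for b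
    by (simp add: norm_poly_def)
  moreover have "even norm_const \<longleftrightarrow> p mod 8 = 7"
    unfolding norm_const_def using p_mod_4 by presburger
  ultimately show ?thesis using True by (simp add: chi_2)
next
  case False
  hence q2: "q > 2" using q(1) prime_ge_2_nat[of q] by simp
  have oddq: "odd q" using q(1) q2 by (simp add: prime_odd_nat)
  have "Legendre (int p) (int q) * chi q = (-1) ^ ((p - 1) div 2 * ((q - 1) div 2))"
    unfolding chi_def using Quadratic_Reciprocity[OF prime_p p_gt_2 q(1) q2] q(2) by simp
  also have "\<dots> = (-1) ^ ((q - 1) div 2)"
  proof -
    have "odd ((p - 1) div 2)" using p_mod_4 by presburger
    thus ?thesis by (simp add: power_mult)
  qed
  also have "\<dots> = Legendre (-1) (int q)" by (rule Legendre_minus_1[OF q(1) q2, symmetric])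
  finally have 1: "Legendre (int p) (int q) * chi q = Legendre (-1) (int q)" .
  have "Legendre (- int p) (int q) = Legendre (-1) (int q) * Legendre (int p) (int q)"
    using Legendre_mult[OF q(1) q2, of "-1" "int p"] by simp
  also have "\<dots> = chi q * (Legendre (int p) (int q))\<^sup>2" by (simp flip: 1 add: power2_eq_square)
  also have "(Legendre (int p) (int q))\<^sup>2 = 1"
  proof -
    have "\<not> int q dvd int p" using q prime_p
      by (simp add: primes_dvd_imp_eq) (metis primes_dvd_imp_eq)
    thus ?thesis by (simp add: Legendre_def cong_0_iff)
  qed
  finally have 2: "chi q = Legendre (- int p) (int q)" by simp
  have ndvd: "\<not> int q dvd - int p"
    using q prime_p by (metis dvd_minus_iff int_dvd_int_iff primes_dvd_imp_eq)
  have "chi q = 1 \<longleftrightarrow> QuadRes (int q) (- int p)"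
    unfolding 2 using ndvd by (simp add: Legendre_def cong_0_iff)
  also have "\<dots> \<longleftrightarrow> (\<exists>b. int q dvd norm_poly b)"
  proof
    assume "QuadRes (int q) (- int p)"
    then obtain y where y: "int q dvd y\<^sup>2 + int p"
      by (auto simp: QuadRes_def cong_iff_dvd_diff)
    \<comment> \<open>\<open>h\<close> is the inverse of 2 modulo q, so that b = (y - 1) h satisfies
      2b + 1 = y modulo q.\<close>
    define h where "h = (int q + 1) div 2"
    have h: "int q = 2 * h - 1" using oddq unfolding h_def by presburger
    define b where "b = (y - 1) * h"
    have "2 * b + 1 = y + int q * (y - 1)" by (simp add: b_def h algebra_simps)
    hence "(2 * b + 1)\<^sup>2 + int p = (y + int q * (y - 1))\<^sup>2 + int p" by simp
    also have "\<dots> = y\<^sup>2 + int p + int q * ((y - 1) * (2 * y + int q * (y - 1)))"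
      by (simp add: power2_eq_square algebra_simps)
    finally have "4 * norm_poly b = y\<^sup>2 + int p + int q * ((y - 1) * (2 * y + int q * (y - 1)))"
      unfolding norm_poly_complete_square .
    hence "int q dvd 4 * norm_poly b" using y by (metis dvd_add dvd_triv_left)
    moreover have "coprime (int q) 4"
    proof -
      have "coprime q (2 ^ 2)" using oddq
        by (simp add: coprime_power_right_iff coprime_right_2_iff_odd del: power_numeral)
      hence "coprime (int q) (int (2 ^ 2))" by (simp only: coprime_int_iff)
      thus ?thesis by simp
    qed
    ultimately show "\<exists>b. int q dvd norm_poly b" by (metis coprime_dvd_mult_right_iff)
  next
    assume "\<exists>b. int q dvd norm_poly b"
    then obtain b where "int q dvd norm_poly b" by blast
    hence "int q dvd (2 * b + 1)\<^sup>2 + int p" by (metis norm_poly_complete_square dvd_mult)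
    thus "QuadRes (int q) (- int p)"
      by (auto simp: QuadRes_def cong_iff_dvd_diff)
  qed
  finally show ?thesis .
qed

lemma rho_prime_power:
  assumes q: "prime q" "q \<noteq> p" and k: "k > 0"
  shows "int (rho (q ^ k)) = 1 + chi q"
  using k
proof (induction k rule: nat_induct_non_zero)
  case 1
  have "chi q \<noteq> 0" using q prime_p by (metis chi_eq_0_iff primes_dvd_imp_eq)
  hence "chi q = 1 \<or> chi q = -1" using chi_values[of q] by auto
  thus ?case using rho_prime_cases[OF q] chi_prime_eq_1_iff[OF q] by auto
next
  case (Suc n)
  thus ?case using rho_prime_power_Suc[OF q Suc.hyps] by simp
qed

lemma prime_dvd_norm_poly_iff: "int p dvd norm_poly b \<longleftrightarrow> int p dvd 2 * b + 1"
proof -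
  have "coprime (int p) 4"
  proof -
    have "coprime p (2 ^ 2)" using odd_p
      by (simp add: coprime_power_right_iff coprime_right_2_iff_odd del: power_numeral)
    hence "coprime (int p) (int (2 ^ 2))" by (simp only: coprime_int_iff)
    thus ?thesis by simp
  qed
  hence "int p dvd norm_poly b \<longleftrightarrow> int p dvd 4 * norm_poly b"
    by (simp add: coprime_dvd_mult_right_iff)
  also have "\<dots> \<longleftrightarrow> int p dvd (2 * b + 1)\<^sup>2" unfolding norm_poly_complete_square by simp
  also have "\<dots> \<longleftrightarrow> int p dvd 2 * b + 1" using prime_p by (simp add: prime_dvd_power_iff)
  finally show ?thesis .
qed

lemma rho_p: "rho p = 1"
proof -
  define h where "h = int p div 2"
  have h: "int p = 2 * h + 1" using odd_p unfolding h_def by presburger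
  have "roots_mod p = {h}"
  proof (intro equalityI subsetI)
    fix x assume "x \<in> roots_mod p"
    hence x: "0 \<le> x" "x < int p" "int p dvd 2 * x + 1"
      by (auto simp: roots_mod_def prime_dvd_norm_poly_iff)
    then obtain c where c: "2 * x + 1 = int p * c" by auto
    have "int p * c > 0" using c x by linarith
    hence "c > 0" using zero_less_mult_pos[of "int p" c] p_gt_2 by simp
    moreover have "c < 2"
    proof (rule ccontr)
      assume "\<not> c < 2"
      hence "int p * c \<ge> int p * 2" by (intro mult_left_mono) auto
      thus False using c x by linarith
    qed
    ultimately have "c = 1" by simp
    thus "x \<in> {h}" using c h by simp
  next
    fix x assume "x \<in> {h}"
    hence "int p dvd norm_poly x" unfolding prime_dvd_norm_poly_iff using h by simp
    thus "x \<in> roots_mod p" using h p_gt_2 \<open>x \<in> {h}\<close> by (auto simp: roots_mod_def)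
  qed
  thus ?thesis by (simp add: rho_def)
qed

text \<open>The double root modulo the ramified prime p does not lift: if p^2 divided
  \<open>norm_poly b\<close>, then p would divide 2b + 1, and p^2 would divide 4
  \<open>norm_poly b\<close> - (2b + 1)^2 = p.\<close>

lemma rho_p_power:
  assumes "k \<ge> 2"
  shows "rho (p ^ k) = 0"
proof -
  have False if "int (p ^ k) dvd norm_poly b" for b
  proof -
    have "p ^ 2 dvd p ^ k" using assms by (rule le_imp_power_dvd)
    hence "int (p ^ 2) dvd norm_poly b" using that by (metis dvd_trans int_dvd_int_iff)
    hence d2: "int p ^ 2 dvd norm_poly b" by simp
    hence "int p dvd norm_poly b" by (metis dvd_trans dvd_power zero_less_numeral)
    hence "int p dvd 2 * b + 1" by (simp add: prime_dvd_norm_poly_iff)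
    hence "int p ^ 2 dvd (2 * b + 1)\<^sup>2" by (simp add: dvd_power_same)
    moreover have "int p ^ 2 dvd (2 * b + 1)\<^sup>2 + int p"
      using d2 by (metis norm_poly_complete_square dvd_mult)
    ultimately have "int p ^ 2 dvd int p" by (metis dvd_add_right_iff)
    hence "p ^ 2 dvd p" by (metis int_dvd_int_iff of_nat_power)
    hence "p ^ 2 \<le> p" using p_gt_2 by (intro dvd_imp_le) auto
    thus False using p_gt_2 by (simp add: power2_eq_square)
  qed
  hence "roots_mod (p ^ k) = {}" unfolding roots_mod_def by blast
  thus ?thesis by (simp add: rho_def)
qed

text \<open>
  Every ideal is uniquely \<open>c (\<int>a + \<int>(b + \<omega>))\<close>, of norm \<open>c\<^sup>2 a\<close>; the summation index is \<open>d = c\<^sup>2\<close>.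
\<close>

definition ideal_count :: "nat \<Rightarrow> int" where
  "ideal_count n = (\<Sum>d | d dvd n. of_bool (is_square d) * int (rho (n div d)))"

text \<open>Removing a factor q from c lowers the exponent of the norm by 2. Thus passing from
  exponent k to k + 2 adds only the primitive ideals, the term i = 0, which \<open>rho\<close>
  counts.\<close>

lemma ideal_count_prime_power:
  assumes q: "prime q"
  shows "ideal_count (q ^ k) = (\<Sum>i\<le>k. chi q ^ i)"
proof -
  have q1: "q > 1" using q by (rule prime_gt_1_nat)
  have divs: "{d. d dvd q ^ k} = (\<lambda>i. q ^ i) ` {..k}" for k
    using q by (auto simp: divides_primepow_nat)
  have inj: "inj_on (\<lambda>i. q ^ i) {..k}" for k using q1 by (auto simp: inj_on_def)
  have sq: "is_square (q ^ i) \<longleftrightarrow> even i" for i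
    using is_nth_power_prime_power_nat_iff[OF q, of 2 i] by simp
  define A where "A k = (\<Sum>i\<le>k. of_bool (even i) * int (rho (q ^ (k - i))))" for k
  have A: "ideal_count (q ^ k) = A k" for k
    unfolding ideal_count_def divs A_def using q1
    by (subst sum.reindex[OF inj]) (auto intro!: sum.cong simp: sq simp flip: power_diff)
  have A_step: "A (Suc (Suc k)) = int (rho (q ^ Suc (Suc k))) + A k" for k
    unfolding A_def by (subst sum.atMost_Suc_shift, subst sum.atMost_Suc_shift) simp
  have chi_q: "chi q \<in> {-1, 0, 1}" by (rule chi_values)
  have "A k = (\<Sum>i\<le>k. chi q ^ i)" for k
  proof (induction k rule: induct_nat_012)
    case 0
    show ?case by (simp add: A_def rho_1)
  next
    case 1
    have "A 1 = int (rho q)" by (simp add: A_def)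
    also have "\<dots> = 1 + chi q"
    proof (cases "q = p")
      case True
      thus ?thesis by (simp add: rho_p chi_eq_0_iff)
    next
      case False
      thus ?thesis using rho_prime_power[OF q False, of 1] by simp
    qed
    finally show ?case by simp
  next
    case (ge2 n)
    \<comment> \<open>The two new powers add up to 2, 0 or 0 according as \<open>chi q\<close> is 1,
      -1 or 0, and these are the root counts.\<close>
    have "int (rho (q ^ Suc (Suc n))) = chi q ^ Suc n + chi q ^ Suc (Suc n)"
    proof (cases "q = p")
      case True
      thus ?thesis using rho_p_power[of "Suc (Suc n)"] chi_eq_0_iff[of p] by simp
    next
      case False
      hence "chi q \<noteq> 0" using q prime_p by (metis chi_eq_0_iff primes_dvd_imp_eq)
      hence "chi q = 1 \<or> chi q = -1" using chi_q by auto
      thus ?thesis using rho_prime_power[OF q False, of "Suc (Suc n)"] by auto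
    qed
    thus ?case using ge2.IH A_step by simp
  qed
  thus ?thesis using A by simp
qed

text \<open>Both sides are multiplicative, so prime powers suffice. This is the comparison of
  coefficients in the factorisation of the Dedekind zeta function as \<zeta>(s) L(s,
  \<chi>).\<close>

theorem ideal_count_eq_divisor_sum:
  assumes "n > 0"
  shows "ideal_count n = (\<Sum>d | d dvd n. chi d)"
  using assms
proof (induction n rule: less_induct)
  case (less n)
  show ?case
  proof (cases "n = 1")
    case True
    thus ?thesis by (simp add: ideal_count_def rho_1)
  next
    case False
    then obtain q where q: "prime q" "q dvd n" using prime_factor_nat by blast
    define k where "k = multiplicity q n"
    obtain m where m: "n = q ^ k * m" "\<not> q dvd m"
      using multiplicity_decompose'[of n q] less.prems q unfolding k_def
      by (metis not_prime_unit less_numeral_extra(3))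
    have k0: "k > 0" using q less.prems by (simp add: k_def prime_multiplicity_gt_zero_iff)
    have m0: "m > 0" using m less.prems by (cases m) auto
    have q1: "q > 1" using q(1) by (rule prime_gt_1_nat)
    have "m < n" using m k0 q1 m0 by (metis mult_less_cancel2 nat_mult_1 one_less_power)
    have cop: "coprime (q ^ k) m" using q(1) m(2) by (simp add: prime_imp_coprime)
    have qk0: "q ^ k > 0" using q1 by simp
    have "ideal_count n = ideal_count (q ^ k) * ideal_count m"
      unfolding m(1) ideal_count_def
      by (rule divisor_sum_coprime_mult[where F = "\<lambda>d. of_bool (is_square d)" and G =
        "\<lambda>d. int (rho d)"])
         (use cop qk0 m0 in \<open>auto simp: rho_mult is_nth_power_mult_coprime_nat_iff\<close>)
    also have "ideal_count (q ^ k) = (\<Sum>d | d dvd q ^ k. chi d)"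
    proof -
      have "{d. d dvd q ^ k} = (\<lambda>i. q ^ i) ` {..k}"
        using q by (auto simp: divides_primepow_nat)
      moreover have "inj_on (\<lambda>i. q ^ i) {..k}" using q1 by (auto simp: inj_on_def)
      ultimately show ?thesis using ideal_count_prime_power[OF q(1), of k]
        by (simp add: sum.reindex chi_power)
    qed
    also have "ideal_count m = (\<Sum>d | d dvd m. chi d)" by (rule less.IH) fact+
    also have "(\<Sum>d | d dvd q ^ k. chi d) * (\<Sum>d | d dvd m. chi d) = (\<Sum>d | d dvd n. chi d)"
      using divisor_sum_coprime_mult[where F = chi and G = "\<lambda>_. 1", OF _ _ cop qk0 m0] chi_mult
      by (simp add: m(1))
    finally show ?thesis .
  qed
qed

end

section \<open>Gauss sums and the value of the L-function at 1\<close>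

text \<open>The logarithmic derivative of \<Gamma>(x) \<Gamma>(1 - x) = \<pi> / sin(\<pi> x): the
  function \<open>F\<close> below is constant on (0, 1).\<close>

lemma Digamma_reflection_real:
  fixes x :: real
  assumes x: "0 < x" "x < 1"
  shows "Digamma (1 - x) - Digamma x = pi * cot (pi * x)"
proof -
  have sin_pos: "sin (pi * y) > 0" if "0 < y" "y < 1" for y
    using that by (intro sin_gt_zero) auto
  have refl: "Gamma y * Gamma (1 - y) = pi / sin (pi * y)" for y :: real
  proof -
    have "complex_of_real (Gamma y * Gamma (1 - y)) = complex_of_real (pi / sin (pi * y))"
    proof -
      have "1 - complex_of_real y = complex_of_real (1 - y)" by simp
      moreover have "sin (complex_of_real pi * complex_of_real y) = complex_of_real (sin (pi * y))"
        by (simp only: of_real_mult[symmetric] sin_of_real)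
      ultimately show ?thesis
        using Gamma_reflection_complex[of "complex_of_real y"]
        by (simp only: Gamma_complex_of_real of_real_mult of_real_divide)
    qed
    thus ?thesis by (simp only: of_real_eq_iff)
  qed
  define F where "F y = ln_Gamma y + ln_Gamma (1 - y) + ln (sin (pi * y))" for y :: real
  have const: "F y = ln pi" if y: "y \<in> {0<..<1}" for y
  proof -
    have "F y = ln (Gamma y * Gamma (1 - y)) + ln (sin (pi * y))"
      using y by (simp add: F_def ln_Gamma_real_pos ln_mult_pos)
    also have "\<dots> = ln pi" unfolding refl using y sin_pos[of y] by (simp add: ln_div)
    finally show ?thesis .
  qed
  have "(F has_real_derivative (Digamma x - Digamma (1 - x) +
      pi * cos (pi * x) / sin (pi * x))) (at x)"
    unfolding F_def using x sin_pos[OF x]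
    by (auto intro!: derivative_eq_intros simp: field_simps)
  moreover have "(F has_real_derivative 0) (at x)"
    by (rule has_field_derivative_transform_within_open[OF DERIV_const[of "ln pi"], where S =
      "{0<..<1}"])
       (use x const in auto)
  ultimately have "Digamma x - Digamma (1 - x) + pi * cos (pi * x) / sin (pi * x) = 0"
    by (rule DERIV_unique)
  thus ?thesis by (simp add: cot_def)
qed

text \<open>The differences of consecutive terms a z^a telescope. Read backwards, the identity
  expands 1/(z - 1) in powers of z, which is how Gauss sums enter the cotangent sum.\<close>

lemma sum_weighted_root_of_unity:
  fixes z :: "'a :: field"
  assumes "z ^ n = 1" "z \<noteq> 1"
  shows "(\<Sum>a<n. of_nat a * z ^ a) = of_nat n / (z - 1)"
proof -
  have gp: "(\<Sum>a<n. z ^ a) = 0" using assms by (simp add: geometric_sum)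
  have "(\<Sum>a<n. of_nat (Suc a) * z ^ Suc a - of_nat a * z ^ a) = of_nat n * z ^ n"
    by (subst sum_lessThan_telescope) simp
  moreover have "(\<Sum>a<n. of_nat (Suc a) * z ^ Suc a - of_nat a * z ^ a)
      = (z - 1) * (\<Sum>a<n. of_nat a * z ^ a) + z * (\<Sum>a<n. z ^ a)"
    by (simp add: sum_distrib_left sum_subtractf sum.distrib algebra_simps)
  ultimately have "(z - 1) * (\<Sum>a<n. of_nat a * z ^ a) = of_nat n" using gp assms by simp
  thus ?thesis using assms by (simp add: field_simps)
qed

text \<open>The cotangent is a fractional linear function of e^(2 i \<theta>). The summand 1/2 will
  drop out because \<open>chi\<close> sums to 0.\<close>

lemma cot_eq_root_of_unity:
  assumes "sin \<theta> \<noteq> 0"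
  shows "complex_of_real (cot \<theta>) = 2 * \<i> * (1 / (cis (2 * \<theta>) - 1) + 1 / 2)"
proof -
  have *: "cis (2 * \<theta>) - 1 = cis \<theta> * (2 * \<i> * of_real (sin \<theta>))"
    by (simp add: complex_eq_iff cos_double_sin sin_double power2_eq_square)
  have "1 / (cis (2 * \<theta>) - 1) = cis (-\<theta>) / (2 * \<i> * of_real (sin \<theta>))"
    unfolding * by (simp add: field_simps cis_inverse[symmetric] del: cis_inverse)
  hence "2 * \<i> * (1 / (cis (2 * \<theta>) - 1) + 1 / 2) =
      2 * \<i> * (cis (-\<theta>) / (2 * \<i> * of_real (sin \<theta>)) + 1 / 2)" by (rule arg_cong)
  also have "\<dots> = cis (-\<theta>) / of_real (sin \<theta>) + \<i>"
    using assms by (simp add: field_simps)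
  also have "\<dots> = of_real (cot \<theta>)"
    using assms by (simp add: complex_eq_iff cot_def)
  finally show ?thesis by simp
qed

section \<open>Gauss sums of the quadratic character and L(1, \<chi>)\<close>

context imag_quadratic
begin

lemma p_pos: "p > 0" using p_gt_2 by simp

lemma chi_0 [simp]: "chi 0 = 0" by (simp add: chi_eq_0_iff)

lemma sum_residues_split: "(\<Sum>k<p. f k) = f 0 + (\<Sum>k=1..<p. f k)" for f ::
  "nat \<Rightarrow> 'a :: comm_monoid_add"
proof -
  have "{..<p} = insert 0 {1..<p}" using p_pos by auto
  thus ?thesis by simp
qed

lemma sum_residues_reflect: "(\<Sum>k=1..<p. f (p - k)) = (\<Sum>k=1..<p. f k)" for f ::
  "nat \<Rightarrow> 'a :: comm_monoid_add"
  by (rule sum.reindex_bij_witness[where i = "\<lambda>k. p - k" and j = "\<lambda>k. p - k"]) auto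

lemma sum_chi: "(\<Sum>k=1..<p. chi k) = 0"
proof -
  have "(\<Sum>k=1..<p. chi k) = (\<Sum>k=1..<p. chi (p - k))" by (rule sum_residues_reflect[symmetric])
  also have "\<dots> = - (\<Sum>k=1..<p. chi k)" by (simp add: chi_neg sum_negf)
  finally show ?thesis by simp
qed

lemma chi_square: "\<not> p dvd k \<Longrightarrow> chi k * chi k = 1"
  using chi_values[of k] chi_eq_0_iff[of k] by auto

definition zeta :: "nat \<Rightarrow> complex" where
  "zeta k = cis (2 * pi * real k / real p)"

lemma zeta_power: "zeta (a * k) = zeta k ^ a"
  unfolding zeta_def Complex.DeMoivre by (rule arg_cong[of _ _ cis]) simp

lemma zeta_mod: "zeta (k mod p) = zeta k"
proof -
  have "real k = real p * real (k div p) + real (k mod p)"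
    by (metis mult_div_mod_eq of_nat_add of_nat_mult)
  hence "2 * pi * real k / real p = 2 * pi * real (k div p) + 2 * pi * real (k mod p) / real p"
    using p_pos by (simp add: field_simps)
  hence "zeta k = cis (2 * pi * real (k div p)) * zeta (k mod p)"
    by (simp only: zeta_def cis_mult)
  also have "cis (2 * pi * real (k div p)) = 1"
    by (metis cis_multiple_2pi Ints_of_nat)
  finally show ?thesis by simp
qed

lemma zeta_power_p: "zeta k ^ p = 1"
  using zeta_power[of p k] zeta_mod[of "p * k"] by (simp add: zeta_def)

lemma zeta_inj: "inj_on zeta {..<p}"
  using Complex.bij_betw_roots_unity[OF p_pos] unfolding zeta_def bij_betw_def by auto

lemma zeta_neq_1: "k \<in> {1..<p} \<Longrightarrow> zeta k \<noteq> 1"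
  using inj_onD[OF zeta_inj, of k 0] p_pos by (auto simp: zeta_def)

definition gauss_sum :: "nat \<Rightarrow> complex" where
  "gauss_sum a = (\<Sum>k=1..<p. of_int (chi k) * zeta (a * k))"

lemma bij_betw_mult_mod:
  assumes "\<not> p dvd a"
  shows "bij_betw (\<lambda>k. a * k mod p) {1..<p} {1..<p}"
proof -
  have cop: "coprime a p" using prime_imp_coprime[OF prime_p assms] by (simp add: coprime_commute)
  have inj: "inj_on (\<lambda>k. a * k mod p) {1..<p}"
  proof (rule inj_onI)
    fix x y assume xy: "x \<in> {1..<p}" "y \<in> {1..<p}" "a * x mod p = a * y mod p"
    hence "[a * x = a * y] (mod p)" by (simp add: unique_euclidean_semiring_class.cong_def)
    hence "[x = y] (mod p)" using cop by (simp add: cong_mult_lcancel_nat)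
    thus "x = y" using xy by (auto intro: cong_less_modulus_unique_nat)
  qed
  have "(\<lambda>k. a * k mod p) ` {1..<p} \<subseteq> {1..<p}"
  proof safe
    fix k assume "k \<in> {1..<p}"
    hence "\<not> p dvd k" by (auto dest: dvd_imp_le)
    hence "\<not> p dvd a * k" using assms prime_p by (simp add: prime_dvd_mult_iff)
    hence "a * k mod p \<noteq> 0" by (simp add: dvd_eq_mod_eq_0)
    thus "a * k mod p \<in> {1..<p}" using p_pos by simp
  qed
  hence "(\<lambda>k. a * k mod p) ` {1..<p} = {1..<p}"
    using inj by (intro endo_inj_surj) auto
  thus ?thesis using inj by (simp add: bij_betw_def)
qed

text \<open>For a prime to p, substitute a k for k. If p divides a, all roots of unity are 1 and the
  sum degenerates to that of \<open>chi\<close>, which is 0.\<close>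

lemma gauss_sum_eq: "gauss_sum a = of_int (chi a) * gauss_sum 1"
proof (cases "p dvd a")
  case True
  have "zeta (a * k) = 1" for k
    using zeta_mod[of "a * k"] True by (auto simp: zeta_def elim!: dvdE)
  hence "gauss_sum a = of_int (\<Sum>k=1..<p. chi k)" by (simp add: gauss_sum_def)
  hence "gauss_sum a = 0" unfolding sum_chi by simp
  moreover have "chi a = 0" using True by (simp add: chi_eq_0_iff)
  ultimately show ?thesis by simp
next
  case False
  have "gauss_sum 1 = (\<Sum>k=1..<p. of_int (chi (a * k mod p)) * zeta (a * k mod p))"
    unfolding gauss_sum_def
    using sum.reindex_bij_betw[OF bij_betw_mult_mod[OF False], of "\<lambda>k. of_int (chi k) * zeta k"]
      by simp
  also have "\<dots> = of_int (chi a) * gauss_sum a"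
    unfolding gauss_sum_def sum_distrib_left
  proof (intro sum.cong refl)
    fix k
    have "chi (a * k mod p) = chi (a * k)" by (rule chi_cong) simp
    thus "of_int (chi (a * k mod p)) * zeta (a * k mod p) =
        of_int (chi a) * (of_int (chi k) * zeta (a * k))"
      by (simp add: zeta_mod chi_mult)
  qed
  finally have "of_int (chi a) * gauss_sum 1 = of_int (chi a * chi a) * gauss_sum a" by simp
  thus ?thesis using chi_square[OF False] by simp
qed

lemma sum_powers_zeta_quotient:
  assumes "k \<in> {1..<p}" "l \<in> {1..<p}"
  shows "(\<Sum>a<p. (zeta k * cnj (zeta l)) ^ a) = (if k = l then of_nat p else 0)"
proof (cases "k = l")
  case True
  thus ?thesis by (simp add: zeta_def cis_cnj cis_mult)
next
  case False
  have "zeta k * cnj (zeta l) \<noteq> 1"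
  proof
    assume "zeta k * cnj (zeta l) = 1"
    hence "zeta k * (cnj (zeta l) * zeta l) = zeta l" by (metis mult.assoc mult_1)
    moreover have "cnj (zeta l) * zeta l = 1" by (simp add: zeta_def cis_cnj cis_mult)
    ultimately have "zeta k = zeta l" by simp
    thus False using inj_onD[OF zeta_inj, of k l] assms False by auto
  qed
  moreover have "(zeta k * cnj (zeta l)) ^ p = 1"
    by (simp add: power_mult_distrib zeta_power_p flip: complex_cnj_power)
  ultimately show ?thesis using False by (simp add: geometric_sum)
qed

text \<open>The sum of |G(a)|^2 over all a modulo p is evaluated in two ways:
  \<open>gauss_sum_eq\<close> gives (p - 1) |G(1)|^2, orthogonality of the roots of unity gives p (p
  - 1).\<close>

lemma norm_gauss_sum: "norm (gauss_sum 1) = sqrt (real p)"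
proof -
  define g where "g = gauss_sum 1"
  have chi2: "(\<Sum>k=1..<p. chi k * chi k) = int (p - 1)"
  proof -
    have "chi k * chi k = 1" if "k \<in> {1..<p}" for k
      using that by (intro chi_square) (auto dest: dvd_imp_le)
    thus ?thesis by simp
  qed
  have "(\<Sum>a<p. gauss_sum a * cnj (gauss_sum a)) = (\<Sum>a<p. of_int (chi a * chi a) * (g * cnj g))"
    by (intro sum.cong refl) (subst (1 2) gauss_sum_eq, simp add: g_def algebra_simps)
  also have "\<dots> = of_int (\<Sum>a<p. chi a * chi a) * (g * cnj g)" by (simp add: sum_distrib_right)
  also have "(\<Sum>a<p. chi a * chi a) = int (p - 1)" using chi2 by (simp add: sum_residues_split)
  finally have 1: "(\<Sum>a<p. gauss_sum a * cnj (gauss_sum a)) = of_nat (p - 1) * (g * cnj g)" by simp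
  have "(\<Sum>a<p. gauss_sum a * cnj (gauss_sum a)) =
      (\<Sum>a<p. \<Sum>k=1..<p. \<Sum>l=1..<p. of_int (chi k * chi l) * (zeta k * cnj (zeta l)) ^ a)"
    by (simp add: gauss_sum_def sum_product zeta_power power_mult_distrib algebra_simps)
  also have "\<dots> = (\<Sum>k=1..<p. \<Sum>l=1..<p. \<Sum>a<p. of_int (chi k * chi l) * (zeta k * cnj (zeta l)) ^ a)"
    by (subst sum.swap, rule sum.cong[OF refl], rule sum.swap)
  also have "\<dots> = (\<Sum>k=1..<p. \<Sum>l=1..<p. if k = l then of_int (chi k * chi l) * of_nat p else 0)"
    by (intro sum.cong refl) (simp only: sum_distrib_left[symmetric] sum_powers_zeta_quotient, simp)
  also have "\<dots> = of_int (\<Sum>k=1..<p. chi k * chi k) * of_nat p" by (simp add: sum_distrib_right)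
  finally have "of_nat (p - 1) * (g * cnj g) = of_nat (p - 1) * of_nat p"
    unfolding 1 chi2 by simp
  moreover have "of_nat (p - 1) \<noteq> (0 :: complex)" using p_gt_2 by simp
  ultimately have "g * cnj g = of_nat p" by (metis mult_left_cancel)
  hence "complex_of_real ((norm g)\<^sup>2) = complex_of_real (real p)"
    using complex_norm_square[of g] by simp
  hence "(norm g)\<^sup>2 = real p" by (simp only: of_real_eq_iff)
  thus ?thesis by (simp add: g_def real_sqrt_unique)
qed

text \<open>The sum S of the overview; it is p times the generalised Bernoulli number
  B_{1,\<chi>}.\<close>

definition chi_moment :: int where
  "chi_moment = (\<Sum>k=1..<p. int k * chi k)"

text \<open>Expanding each cotangent in powers of \<open>zeta k\<close> and summing over k inside
  produces the Gauss sums G(a) = \<open>chi a\<close> G(1), hence a multiple of S G(1) / p. Only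
  |G(1)| is available, hence the absolute values.\<close>

lemma sum_chi_cot: "\<bar>\<Sum>k=1..<p. of_int (chi k) * cot (pi * (real k / real p))\<bar> =
    2 * \<bar>of_int chi_moment\<bar> / sqrt (real p)"
proof -
  have "complex_of_real (\<Sum>k=1..<p. of_int (chi k) * cot (pi * (real k / real p))) =
      (\<Sum>k=1..<p. of_int (chi k) * (2 * \<i> * (1 / (zeta k - 1) + 1 / 2)))"
    unfolding of_real_sum
  proof (intro sum.cong refl)
    fix k assume k: "k \<in> {1..<p}"
    have "sin (pi * (real k / real p)) > 0" using k by (intro sin_gt_zero) (auto simp: field_simps)
    hence "complex_of_real (cot (pi * (real k / real p))) =
        2 * \<i> * (1 / (cis (2 * (pi * (real k / real p))) - 1) + 1 / 2)"
      by (intro cot_eq_root_of_unity) simp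
    also have "cis (2 * (pi * (real k / real p))) = zeta k" by (simp add: zeta_def mult_ac)
    finally show "complex_of_real (of_int (chi k) * cot (pi * (real k / real p))) =
        of_int (chi k) * (2 * \<i> * (1 / (zeta k - 1) + 1 / 2))" by simp
  qed
  also have "\<dots> = 2 * \<i> * (\<Sum>k=1..<p. of_int (chi k) / (zeta k - 1)) + \<i> * of_int (\<Sum>k=1..<p. chi k)"
    by (simp add: sum_distrib_left sum.distrib algebra_simps)
  also have "(\<Sum>k=1..<p. of_int (chi k) / (zeta k - 1)) =
      (\<Sum>k=1..<p. \<Sum>a<p. of_int (chi k) * (of_nat a * zeta k ^ a) / of_nat p)"
  proof (intro sum.cong refl)
    fix k assume k: "k \<in> {1..<p}"
    have "of_nat p / (zeta k - 1) = (\<Sum>a<p. of_nat a * zeta k ^ a)"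
      using sum_weighted_root_of_unity[OF zeta_power_p zeta_neq_1[OF k]] by simp
    hence "1 / (zeta k - 1) = (\<Sum>a<p. of_nat a * zeta k ^ a) / of_nat p"
      using p_pos by (simp add: divide_eq_eq eq_divide_eq flip: \<open>of_nat p / (zeta k - 1) = _\<close>)
    hence "of_int (chi k) / (zeta k - 1) =
        of_int (chi k) * ((\<Sum>a<p. of_nat a * zeta k ^ a) / of_nat p)"
      by (metis divide_inverse inverse_eq_divide)
    thus "of_int (chi k) / (zeta k - 1) =
        (\<Sum>a<p. of_int (chi k) * (of_nat a * zeta k ^ a) / of_nat p)"
      by (simp add: sum_distrib_left sum_divide_distrib)
  qed
  also have "\<dots> = (\<Sum>a<p. of_nat a * gauss_sum a) / of_nat p"
    by (subst sum.swap)
       (simp add: gauss_sum_def zeta_power sum_distrib_left sum_divide_distrib mult_ac)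
  also have "(\<Sum>a<p. of_nat a * gauss_sum a) = of_int chi_moment * gauss_sum 1"
  proof -
    have "(\<Sum>a<p. of_nat a * gauss_sum a) = (\<Sum>a<p. of_nat a * (of_int (chi a) * gauss_sum 1))"
      by (intro sum.cong refl) (subst gauss_sum_eq, rule refl)
    also have "\<dots> = of_int (\<Sum>a<p. int a * chi a) * gauss_sum 1"
      unfolding of_int_sum sum_distrib_right by (intro sum.cong refl) simp
    also have "(\<Sum>a<p. int a * chi a) = chi_moment" by (simp add: chi_moment_def sum_residues_split)
    finally show ?thesis .
  qed
  finally have "complex_of_real (\<Sum>k=1..<p. of_int (chi k) * cot (pi * (real k / real p))) =
      2 * \<i> * (of_int chi_moment * gauss_sum 1 / of_nat p)" unfolding sum_chi by simp
  hence "norm (complex_of_real (\<Sum>k=1..<p. of_int (chi k) * cot (pi * (real k / real p)))) =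
     norm (2 * \<i> * (of_int chi_moment * gauss_sum 1 / of_nat p))" by (rule arg_cong)
  hence "\<bar>\<Sum>k=1..<p. of_int (chi k) * cot (pi * (real k / real p))\<bar> =
      2 * (\<bar>of_int chi_moment\<bar> * sqrt (real p) / real p)"
    unfolding norm_of_real by (simp add: norm_mult norm_divide norm_gauss_sum del: One_nat_def)
  also have "\<dots> = 2 * \<bar>of_int chi_moment\<bar> * (sqrt (real p) / real p)" by simp
  also have "sqrt (real p) / real p = 1 / sqrt (real p)" using p_pos by (simp add: field_simps)
  finally show ?thesis by simp
qed

text \<open>L(1, \<chi>) in closed form; \<open>sum_chi_over_n\<close> identifies it with the
  series.\<close>

definition L_value :: real where
  "L_value = - (\<Sum>k=1..<p. of_int (chi k) * Digamma (real k / real p)) / real p"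

text \<open>Pairing k with p - k, where \<open>chi\<close> changes sign, turns the Digamma values
  into the differences that the reflection formula evaluates.\<close>

lemma abs_L_value: "\<bar>L_value\<bar> = pi * \<bar>of_int chi_moment\<bar> / (real p * sqrt (real p))"
proof -
  define \<psi> where "\<psi> k = Digamma (real k / real p)" for k
  have "(\<Sum>k=1..<p. of_int (chi k) * \<psi> k) = (\<Sum>k=1..<p. of_int (chi (p - k)) * \<psi> (p - k))"
    by (rule sum_residues_reflect[symmetric])
  also have "\<dots> = - (\<Sum>k=1..<p. of_int (chi k) * \<psi> (p - k))" by (simp add: chi_neg sum_negf)
  finally have "2 * (\<Sum>k=1..<p. of_int (chi k) * \<psi> k) =
      - (\<Sum>k=1..<p. of_int (chi k) * (\<psi> (p - k) - \<psi> k))"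
    by (simp add: algebra_simps sum_subtractf)
  also have "(\<Sum>k=1..<p. of_int (chi k) * (\<psi> (p - k) - \<psi> k)) =
      pi * (\<Sum>k=1..<p. of_int (chi k) * cot (pi * (real k / real p)))"
    unfolding sum_distrib_left
  proof (intro sum.cong refl)
    fix k assume k: "k \<in> {1..<p}"
    have "real (p - k) / real p = 1 - real k / real p"
      using k by (simp add: of_nat_diff field_simps)
    hence "\<psi> (p - k) - \<psi> k = pi * cot (pi * (real k / real p))"
      unfolding \<psi>_def using k by (simp add: Digamma_reflection_real)
    thus "of_int (chi k) * (\<psi> (p - k) - \<psi> k) = pi * (of_int (chi k) * cot (pi * (real k / real p)))"
      by simp
  qed
  finally have "L_value = pi * (\<Sum>k=1..<p. of_int (chi k) * cot (pi * (real k / real p))) / (2 * real p)"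
    unfolding L_value_def \<psi>_def[symmetric] using p_pos by (simp add: field_simps)
  hence "\<bar>L_value\<bar> = pi * \<bar>\<Sum>k=1..<p. of_int (chi k) * cot (pi * (real k / real p))\<bar> / (2 * real p)"
    by (simp add: abs_mult)
  thus ?thesis unfolding sum_chi_cot by (simp add: mult_ac)
qed

text \<open>Over M full periods, the terms n = m p + k with fixed k form a harmonic-type sum whose
  deviation from ln M tends to a Digamma value. The incomplete last period has fewer than p terms,
  each at most 1/(M p) in absolute value.\<close>

lemma sum_chi_over_n: "(\<lambda>N. \<Sum>n<N. of_int (chi n) / real n) \<longlonglongrightarrow> L_value"
proof -
  define P where "P N = (\<Sum>n<N. of_int (chi n) / real n)" for N
  have chi_add: "chi (m * p + k) = chi k" for m k
    by (rule chi_cong) (simp add: unique_euclidean_semiring_class.cong_def)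
  have blocks: "P (M * p) =
      - (\<Sum>k=1..<p. of_int (chi k) * (ln (real M) - (\<Sum>m<M. inverse (real k / real p + real m)))) / real p" for M
  proof -
    have "P (M * p) = (\<Sum>m<M. \<Sum>n=m*p..<m*p+p. of_int (chi n) / real n)"
      unfolding P_def by (rule sum.nat_group[symmetric])
    also have "\<dots> = (\<Sum>m<M. \<Sum>k<p. of_int (chi (m * p + k)) / real (m * p + k))"
    proof (rule sum.cong[OF refl])
      fix m
      show "(\<Sum>n=m*p..<m*p+p. of_int (chi n) / real n) = (\<Sum>k<p. of_int (chi (m * p +
          k)) / real (m * p + k))"
        by (rule sum.reindex_bij_witness[where i = "\<lambda>k. m * p + k" and j = "\<lambda>n. n - m * p"]) auto
    qed
    also have "\<dots> = (\<Sum>m<M. \<Sum>k=1..<p. of_int (chi k) / real (m * p + k))"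
      by (simp add: chi_add sum_residues_split)
    also have "\<dots> = (\<Sum>k=1..<p. \<Sum>m<M. of_int (chi k) / real (m * p + k))" by (rule sum.swap)
    also have "\<dots> = (\<Sum>k=1..<p. of_int (chi k) * (\<Sum>m<M. inverse (real k / real p + real m))) / real p"
      unfolding sum_distrib_left sum_divide_distrib using p_pos
      by (intro sum.cong refl) (simp add: inverse_eq_divide add_divide_eq_iff divide_add_eq_iff mult_ac)
    \<comment> \<open>The divergent ln M may be inserted for every residue class because its
      coefficients \<open>chi k\<close> sum to 0.\<close>
    also have "(\<Sum>k=1..<p. of_int (chi k) * (\<Sum>m<M. inverse (real k / real p + real m))) =
      - (\<Sum>k=1..<p. of_int (chi k) * (ln (real M) - (\<Sum>m<M. inverse (real k / real p + real m))))
      + of_int (\<Sum>k=1..<p. chi k) * ln (real M)"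
      by (simp add: sum_distrib_right right_diff_distrib sum_subtractf)
    finally show ?thesis unfolding sum_chi by simp
  qed
  have lim: "(\<lambda>M. P (M * p)) \<longlonglongrightarrow> L_value"
    unfolding blocks L_value_def
  proof (intro tendsto_intros)
    fix k assume k: "k \<in> {1..<p}"
    hence "real k / real p \<noteq> 0" by simp
    from Digamma_LIMSEQ[OF this] k
    show "(\<lambda>M. ln (real M) - (\<Sum>m<M. inverse (real k / real p + real m))) \<longlonglongrightarrow>
        Digamma (real k / real p)"
      by simp
  qed (use p_pos in auto)
  have div_lim: "filterlim (\<lambda>N. N div p) at_top at_top"
  proof -
    have "\<forall>\<^sub>F N in at_top. Z \<le> N div p" for Z
      using eventually_ge_at_top[of "Z * p"]
    proof eventually_elim
      case (elim N)
      thus ?case using p_pos by (simp add: less_eq_div_iff_mult_less_eq)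
    qed
    thus ?thesis by (simp add: filterlim_at_top)
  qed
  have "(\<lambda>N. P N - P (N div p * p)) \<longlonglongrightarrow> 0"
  proof (rule Lim_null_comparison)
    show "\<forall>\<^sub>F N in sequentially. norm (P N - P (N div p * p)) \<le> 1 / real (N div p)"
      using eventually_ge_at_top[of p]
    proof eventually_elim
      case (elim N)
      define M where "M = N div p"
      have M: "M > 0" using elim p_pos by (simp add: M_def div_greater_zero_iff)
      have "N = M * p + N mod p" "N mod p < p" using p_pos by (simp_all add: M_def)
      hence MN: "M * p \<le> N" "N < M * p + p" by linarith+
      have "P N - P (M * p) = (\<Sum>n=M*p..<N. of_int (chi n) / real n)"
        unfolding P_def using MN(1)
          sum.atLeastLessThan_concat[of 0 "M * p" N "\<lambda>n. of_int (chi n) / real n"]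
        by (simp add: atLeast0LessThan)
      also have "norm \<dots> \<le> (\<Sum>n=M*p..<N. 1 / real (M * p))"
      proof (rule sum_norm_le)
        fix n assume n: "n \<in> {M*p..<N}"
        have "\<bar>real_of_int (chi n)\<bar> \<le> 1" using chi_values[of n] by auto
        thus "norm (of_int (chi n) / real n) \<le> 1 / real (M * p)"
          using n M p_pos by (auto simp: abs_divide intro!: frac_le simp del: of_nat_mult)
      qed
      also have "\<dots> = real (N - M * p) / real (M * p)" by simp
      also have "\<dots> \<le> real p / real (M * p)"
      proof -
        have "N - M * p \<le> p" using MN by simp
        hence "real (N - M * p) \<le> real p" by (rule of_nat_mono)
        thus ?thesis by (rule divide_right_mono) simp
      qed
      also have "\<dots> = 1 / real M" using p_pos by simp
      finally show ?case by (simp add: M_def)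
    qed
    show "(\<lambda>N. 1 / real (N div p)) \<longlonglongrightarrow> 0"
      by (rule real_tendsto_divide_at_top[OF tendsto_const
            filterlim_compose[OF filterlim_real_sequentially div_lim]])
  qed
  from tendsto_add[OF this filterlim_compose[OF lim div_lim]]
  have "P \<longlonglongrightarrow> L_value" by simp
  thus ?thesis unfolding P_def .
qed

end

section \<open>The mean value of the ideal counting function\<close>

text \<open>Summation by parts: the partial sums are bounded by B, and the decrements of the weights
  are nonnegative and telescope.\<close>

lemma Abel_inequality:
  fixes x w :: "nat \<Rightarrow> real"
  assumes B: "\<And>m. \<bar>\<Sum>i<m. x i\<bar> \<le> B"
    and w: "\<And>i. w (Suc i) \<le> w i" "\<And>i. w i \<ge> 0"
  shows "\<bar>\<Sum>i<n. x i * w i\<bar> \<le> B * w 0"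
proof -
  define X where "X m = (\<Sum>i<m. x i)" for m
  have "(\<Sum>i<n. x i * w i) = X n * w n + (\<Sum>i<n. X (Suc i) * (w i - w (Suc i)))"
    by (induction n) (simp_all add: X_def algebra_simps)
  also have "\<bar>\<dots>\<bar> \<le> \<bar>X n * w n\<bar> + (\<Sum>i<n. \<bar>X (Suc i) * (w i - w (Suc i))\<bar>)"
    using sum_abs[of "\<lambda>i. X (Suc i) * (w i - w (Suc i))" "{..<n}"] by linarith
  also have "\<dots> \<le> B * w n + (\<Sum>i<n. B * (w i - w (Suc i)))"
  proof (intro add_mono sum_mono)
    have XB: "\<bar>X m\<bar> \<le> B" for m using B by (simp add: X_def)
    show "\<bar>X n * w n\<bar> \<le> B * w n"
      using XB[of n] w(2)[of n] by (simp add: abs_mult mult_right_mono)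
    show "\<bar>X (Suc i) * (w i - w (Suc i))\<bar> \<le> B * (w i - w (Suc i))" for i
      using XB[of "Suc i"] w(1)[of i] by (simp add: abs_mult mult_right_mono)
  qed
  also have "(\<Sum>i<n. B * (w i - w (Suc i))) = B * (w 0 - w n)"
    by (simp add: sum_lessThan_telescope' flip: sum_distrib_left)
  finally show ?thesis by (simp add: algebra_simps)
qed

context imag_quadratic
begin

text \<open>Full periods sum to 0, so every initial sum is bounded by p; the factor 2 comes from
  starting at an arbitrary D.\<close>

lemma chi_partial_sums_bounded: "\<bar>\<Sum>i<m. chi (D + i)\<bar> \<le> 2 * int p"
proof -
  have bound: "\<bar>\<Sum>i<m. chi i\<bar> \<le> int p" for m
  proof -
    define M where "M = m div p"
    have m: "m = M * p + m mod p" "m mod p < p" using p_pos by (simp_all add: M_def)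
    have per: "chi (j * p + k) = chi k" for j k
      by (rule chi_cong) (simp add: unique_euclidean_semiring_class.cong_def)
    have per': "chi (a - j * p) = chi a" if "j * p \<le> a" for a j
      using per[of j "a - j * p"] that by simp
    have block: "(\<Sum>i=j*p..<j*p+k. chi i) = (\<Sum>i<k. chi i)" for j k
      by (rule sum.reindex_bij_witness[where i = "\<lambda>i. j * p + i" and j = "\<lambda>i. i - j * p"])
         (auto simp: per')
    have "(\<Sum>i<p. chi i) = 0" using sum_chi by (simp add: sum_residues_split)
    hence "(\<Sum>i<M * p. chi i) = 0" by (simp add: block flip: sum.nat_group)
    moreover have "(\<Sum>i<m. chi i) = (\<Sum>i<M * p. chi i) + (\<Sum>i=M*p..<m. chi i)"
      using m(1) sum.atLeastLessThan_concat[of 0 "M * p" m chi] by (simp add: atLeast0LessThan)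
    moreover have "(\<Sum>i=M*p..<m. chi i) = (\<Sum>i<m mod p. chi i)"
      using block[of M "m mod p"] m(1) by simp
    ultimately have "\<bar>\<Sum>i<m. chi i\<bar> \<le> (\<Sum>i<m mod p. \<bar>chi i\<bar>)" by (simp add: sum_abs)
    also have "\<dots> \<le> (\<Sum>i<m mod p. 1)"
    proof (rule sum_mono)
      fix i show "\<bar>chi i\<bar> \<le> 1" using chi_values[of i] by auto
    qed
    also have "\<dots> \<le> int p" using m(2) by simp
    finally show ?thesis .
  qed
  have "(\<Sum>i<m. chi (D + i)) = (\<Sum>i<D + m. chi i) - (\<Sum>i<D. chi i)"
    by (induction m) auto
  thus ?thesis using bound[of D] bound[of "D + m"] by linarith
qed

lemma sum_divisor_sums:
  fixes f :: "nat \<Rightarrow> int"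
  shows "(\<Sum>n=1..N. \<Sum>d | d dvd n. f d) = (\<Sum>d=1..N. f d * int (N div d))"
proof -
  have "(\<Sum>n=1..N. \<Sum>d | d dvd n. f d) = (\<Sum>n=1..N. \<Sum>d=1..N. if d dvd n then f d else 0)"
  proof (rule sum.cong[OF refl])
    fix n assume n: "n \<in> {1..N}"
    have "{d. d dvd n} = {d \<in> {1..N}. d dvd n}"
    proof (intro equalityI subsetI)
      fix d assume "d \<in> {d. d dvd n}"
      thus "d \<in> {d \<in> {1..N}. d dvd n}" using n dvd_imp_le[of d n] dvd_pos_nat[of n d] by auto
    qed auto
    thus "(\<Sum>d | d dvd n. f d) = (\<Sum>d=1..N. if d dvd n then f d else 0)"
      using sum.inter_filter[of "{1..N}" f "\<lambda>d. d dvd n"] by simp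
  qed
  also have "\<dots> = (\<Sum>d=1..N. \<Sum>n=1..N. if d dvd n then f d else 0)" by (rule sum.swap)
  also have "\<dots> = (\<Sum>d=1..N. f d * int (N div d))"
  proof (rule sum.cong[OF refl])
    fix d assume d: "d \<in> {1..N}"
    have "{n \<in> {1..N}. d dvd n} = (\<lambda>k. d * k) ` {1..N div d}"
    proof (intro equalityI subsetI)
      fix n assume "n \<in> {n \<in> {1..N}. d dvd n}"
      then obtain k where k: "n = d * k" "1 \<le> n" "n \<le> N" by auto
      have "k \<le> N div d" using d k by (simp add: less_eq_div_iff_mult_less_eq mult.commute)
      moreover have "k \<ge> 1" using k by (cases k) auto
      ultimately show "n \<in> (\<lambda>k. d * k) ` {1..N div d}" using k by auto
    next
      fix n assume "n \<in> (\<lambda>k. d * k) ` {1..N div d}"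
      then obtain k where k: "n = d * k" "1 \<le> k" "k \<le> N div d" by force
      have "d * k \<le> N" using d k by (simp add: less_eq_div_iff_mult_less_eq mult.commute)
      thus "n \<in> {n \<in> {1..N}. d dvd n}" using k d by auto
    qed
    moreover have "inj_on (\<lambda>k. d * k) {1..N div d}" using d by (auto simp: inj_on_def)
    ultimately have "card {n \<in> {1..N}. d dvd n} = N div d" by (simp add: card_image)
    thus "(\<Sum>n=1..N. if d dvd n then f d else 0) = f d * int (N div d)"
      by (simp flip: sum.inter_filter)
  qed
  finally show ?thesis .
qed

text \<open>Up to D, replacing \<open>N div d\<close> by N/d costs at most 1 per term. Beyond D the
  weights \<open>N div d\<close> decrease from at most N/D, and Abel's inequality applies with the
  bound 2p on sums of \<open>chi\<close>.\<close>

lemma divisor_sum_approx: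
  assumes D: "D \<le> N" "D > 0"
  shows "\<bar>of_int (\<Sum>d=1..N. chi d * int (N div d)) - real N * (\<Sum>d<Suc D. of_int (chi d) / real d)\<bar>
      \<le> real D + 2 * real p * (real N / real D)"
proof -
  define w where "w d = real (N div d)" for d
  have split: "(\<Sum>d=1..N. of_int (chi d) * w d) =
      (\<Sum>d=1..D. of_int (chi d) * w d) + (\<Sum>i<N - D. of_int (chi (Suc D + i)) * w (Suc D + i))"
  proof -
    have "{1..N} = {1..D} \<union> {Suc D..N}" using D by auto
    hence "(\<Sum>d=1..N. of_int (chi d) * w d) = (\<Sum>d=1..D. of_int (chi d) * w d) +
        (\<Sum>d=Suc D..N. of_int (chi d) * w d)"
      by (simp add: sum.union_disjoint)
    also have "(\<Sum>d=Suc D..N. of_int (chi d) * w d) = (\<Sum>i<N - D. of_int (chi (Suc D +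
        i)) * w (Suc D + i))"
      by (rule sum.reindex_bij_witness[where i = "\<lambda>i. Suc D + i" and j = "\<lambda>d. d - Suc D"]) auto
    finally show ?thesis .
  qed
  have tail: "\<bar>\<Sum>i<N - D. of_int (chi (Suc D + i)) * w (Suc D + i)\<bar> \<le> (2 * real p) * w (Suc D + 0)"
  proof (rule Abel_inequality)
    fix m
    have "real_of_int \<bar>\<Sum>i<m. chi (Suc D + i)\<bar> \<le> real_of_int (2 * int p)"
      by (subst of_int_le_iff) (rule chi_partial_sums_bounded)
    thus "\<bar>\<Sum>i<m. real_of_int (chi (Suc D + i))\<bar> \<le> 2 * real p" by simp
  next
    fix i show "w (Suc D + Suc i) \<le> w (Suc D + i)"
      unfolding w_def by (intro of_nat_mono div_le_mono2) auto
  qed (auto simp: w_def)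
  have w_bounds: "w d \<le> real N / real d" "real N / real d - w d \<le> 1" for d
    using floor_divide_of_nat_eq[of N d, where 'a = real] floor_correct[of "real N / real d"]
    by (simp_all add: w_def)
  have "w (Suc D) \<le> real N / real D"
  proof -
    have "w (Suc D) \<le> real N / real (Suc D)" by (rule w_bounds)
    also have "\<dots> \<le> real N / real D" using D by (intro divide_left_mono) auto
    finally show ?thesis .
  qed
  hence tail': "\<bar>\<Sum>i<N - D. of_int (chi (Suc D + i)) * w (Suc D + i)\<bar> \<le>
      2 * real p * (real N / real D)"
    using tail mult_left_mono[of "w (Suc D)" "real N / real D" "2 * real p"] by simp
  have eq: "real N * (\<Sum>d<Suc D. of_int (chi d) / real d) =
      (\<Sum>d=1..D. of_int (chi d) * (real N / real d))"
  proof -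
    have "{..<Suc D} = insert 0 {1..D}" by auto
    hence "(\<Sum>d<Suc D. of_int (chi d) / real d) = (\<Sum>d=1..D. of_int (chi d) / real d)" by simp
    thus ?thesis by (simp add: sum_distrib_left mult_ac)
  qed
  have "\<bar>(\<Sum>d=1..D. of_int (chi d) * w d) - (\<Sum>d=1..D. of_int (chi d) * (real N / real d))\<bar>
      = \<bar>\<Sum>d=1..D. of_int (chi d) * (w d - real N / real d)\<bar>"
    by (simp add: sum_subtractf algebra_simps)
  also have "\<dots> \<le> (\<Sum>d=1..D. \<bar>of_int (chi d) * (w d - real N / real d)\<bar>)" by (rule sum_abs)
  also have "\<dots> \<le> (\<Sum>d=1..D. 1)"
  proof (rule sum_mono)
    fix d assume d: "d \<in> {1..D}"
    have "w d \<le> real N / real d" by (rule w_bounds)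
    moreover have "real N / real d - w d \<le> 1" by (rule w_bounds)
    moreover have "\<bar>real_of_int (chi d)\<bar> \<le> 1" using chi_values[of d] by auto
    ultimately show "\<bar>of_int (chi d) * (w d - real N / real d)\<bar> \<le> 1"
      unfolding abs_mult by (intro mult_le_one) auto
  qed
  also have "\<dots> = real D" by simp
  finally have "\<bar>(\<Sum>d=1..D. of_int (chi d) * w d) - (\<Sum>d=1..D. of_int (chi d) * (real N / real d))\<bar> \<le>
      real D" .
  moreover have "of_int (\<Sum>d=1..N. chi d * int (N div d)) = (\<Sum>d=1..N. of_int (chi d) * w d)"
    by (simp add: w_def)
  ultimately show ?thesis using tail' unfolding eq split by linarith
qed

text \<open>The cut at D = floor(sqrt N) balances the errors D and 2p N/D: after division by N both
  are O(1/D).\<close>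

theorem divisor_sum_mean:
  "(\<lambda>N. of_int (\<Sum>n=1..N. \<Sum>d | d dvd n. chi d) / real N) \<longlonglongrightarrow> L_value"
proof -
  define S where "S N = real_of_int (\<Sum>n=1..N. \<Sum>d | d dvd n. chi d)" for N
  define P where "P N = (\<Sum>n<N. of_int (chi n) / real n)" for N
  have sqrt_lim: "filterlim floor_sqrt at_top at_top"
  proof -
    have "\<forall>\<^sub>F N in at_top. Z \<le> floor_sqrt N" for Z
      using eventually_ge_at_top[of "Z\<^sup>2"]
    proof eventually_elim
      case (elim N)
      thus ?case using mono_floor_sqrt'[of "Z\<^sup>2" N] by simp
    qed
    thus ?thesis by (simp add: filterlim_at_top)
  qed
  have P_lim: "(\<lambda>N. P (Suc (floor_sqrt N))) \<longlonglongrightarrow> L_value"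
    using filterlim_compose[OF LIMSEQ_Suc[OF sum_chi_over_n] sqrt_lim] unfolding P_def .
  have "(\<lambda>N. S N / real N - P (Suc (floor_sqrt N))) \<longlonglongrightarrow> 0"
  proof (rule Lim_null_comparison)
    show "\<forall>\<^sub>F N in sequentially. norm (S N / real N - P (Suc (floor_sqrt N))) \<le> (1 +
        2 * real p) / real (floor_sqrt N)"
      using eventually_gt_at_top[of 0]
    proof eventually_elim
      case (elim N)
      define D where "D = floor_sqrt N"
      have D: "D \<le> N" "D > 0" using elim by (auto simp: D_def floor_sqrt_le)
      have "real D * real D \<le> real N"
        using floor_sqrt_power2_le[of N] unfolding D_def power2_eq_square
        by (metis of_nat_le_iff of_nat_mult)
      hence DN: "real D \<le> real N / real D" using D by (simp add: field_simps)
      have "\<bar>S N - real N * P (Suc D)\<bar> \<le> real D + 2 * real p * (real N / real D)"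
        unfolding S_def P_def sum_divisor_sums by (rule divisor_sum_approx[OF D])
      also have "\<dots> \<le> (1 + 2 * real p) * (real N / real D)" using DN by (simp add: algebra_simps)
      finally have "\<bar>S N - real N * P (Suc D)\<bar> / real N \<le> (1 + 2 * real p) / real D"
        using elim by (simp add: field_simps)
      moreover have "\<bar>S N - real N * P (Suc D)\<bar> / real N = \<bar>S N / real N - P (Suc D)\<bar>"
      proof -
        have "S N / real N - P (Suc D) = (S N - real N * P (Suc D)) / real N"
          using elim by (simp add: field_simps)
        thus ?thesis by simp
      qed
      ultimately show ?case by (simp add: D_def)
    qed
    show "(\<lambda>N. (1 + 2 * real p) / real (floor_sqrt N)) \<longlonglongrightarrow> 0"
      by (rule real_tendsto_divide_at_top[OF tendsto_const
            filterlim_compose[OF filterlim_real_sequentially sqrt_lim]])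
  qed
  from tendsto_add[OF this P_lim] show ?thesis by (simp add: S_def)
qed

end

section \<open>Lattice points in ellipses\<close>

text \<open>Completing the square writes the form as ((2Ax + By)^2 + D y^2) / (4A) with D = 4AC -
  B^2. The linear map to these coordinates has determinant sqrt(D)/2, by which the area of the disc
  is divided.\<close>

lemma ellipse_as_preimage_of_disc:
  fixes A B C :: real
  assumes A: "A > 0" and D: "4 * A * C - B\<^sup>2 > 0"
  obtains T :: "real ^ 2 \<Rightarrow> real ^ 2" where "linear T"
    "\<And>x. (norm (T x))\<^sup>2 = A * (x $ 1)\<^sup>2 + B * x $ 1 * x $ 2 + C * (x $ 2)\<^sup>2"
    "\<And>R. {x. norm (T x) \<le> R} \<in> lmeasurable"
    "\<And>R. R \<ge> 0 \<Longrightarrow>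
       measure lebesgue {x. norm (T x) \<le> R} = 2 * pi * R\<^sup>2 / sqrt (4 * A * C - B\<^sup>2)"
proof -
  define D where "D = 4 * A * C - B\<^sup>2"
  define T where "T = (\<lambda>x :: real ^ 2.
    vector [(2 * A * x $ 1 + B * x $ 2) / (2 * sqrt A), sqrt D * x $ 2 / (2 * sqrt A)] :: real ^ 2)"
  have D0: "D > 0" using D by (simp add: D_def)
  have lin: "linear T"
    unfolding T_def linear_iff
    by (auto simp: vec_eq_iff forall_2 algebra_simps add_divide_distrib)
  have normT: "(norm (T x))\<^sup>2 = A * (x $ 1)\<^sup>2 + B * x $ 1 * x $ 2 + C * (x $ 2)\<^sup>2" for x
  proof -
    have "(norm (T x))\<^sup>2 = ((2 * A * x $ 1 + B * x $ 2) / (2 * sqrt A))\<^sup>2 +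
        (sqrt D * x $ 2 / (2 * sqrt A))\<^sup>2"
      unfolding power2_norm_eq_inner inner_vec_def sum_2 T_def by (simp add: power2_eq_square)
    also have "\<dots> = ((2 * A * x $ 1 + B * x $ 2)\<^sup>2 + D * (x $ 2)\<^sup>2) / (4 * A)"
      using A D0 by (simp add: power_divide power_mult_distrib add_divide_distrib[symmetric])
    also have "\<dots> = A * (x $ 1)\<^sup>2 + B * x $ 1 * x $ 2 + C * (x $ 2)\<^sup>2"
      using A by (simp add: D_def field_simps power2_eq_square)
    finally show ?thesis .
  qed
  have det: "det (matrix T) = sqrt D / 2"
  proof -
    have "det (matrix T) = (2 * A / (2 * sqrt A)) * (sqrt D / (2 * sqrt A))"
      by (simp add: det_2 matrix_def T_def axis_def)
    also have "\<dots> = sqrt D / 2 * (A / (sqrt A * sqrt A))" by (simp add: field_simps)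
    also have "A / (sqrt A * sqrt A) = 1" using A by simp
    finally show ?thesis by simp
  qed
  have "det (matrix T) \<noteq> 0" unfolding det using D0 by simp
  hence "inj T" using lin by (simp add: det_nz_iff_inj)
  then obtain S where S: "linear S" "\<And>x. S (T x) = x" "\<And>x. T (S x) = x"
    using linear_injective_isomorphism[OF lin] by auto
  have eq: "{x. norm (T x) \<le> R} = S ` cball 0 R" for R
  proof (intro equalityI subsetI)
    fix x assume "x \<in> {x. norm (T x) \<le> R}"
    thus "x \<in> S ` cball 0 R" using S(2)[of x] by (intro image_eqI[of _ _ "T x"]) auto
  qed (auto simp: S)
  have img: "T ` {x. norm (T x) \<le> R} = cball 0 R" for R
    unfolding eq image_image S(3) by simp
  have meas: "{x. norm (T x) \<le> R} \<in> lmeasurable" for R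
    unfolding eq using S(1) by (intro measurable_linear_image) auto
  have area: "measure lebesgue {x. norm (T x) \<le> R} = 2 * pi * R\<^sup>2 / sqrt D" if R: "R \<ge> 0" for R
  proof -
    have "measure lebesgue (T ` {x. norm (T x) \<le> R}) =
        \<bar>det (matrix T)\<bar> * measure lebesgue {x. norm (T x) \<le> R}"
      by (rule measure_linear_image[OF lin meas])
    moreover have "measure lebesgue (T ` {x. norm (T x) \<le> R}) = pi * R\<^sup>2"
      unfolding img using R by (simp add: content_cball unit_ball_vol_2)
    ultimately show ?thesis using det D0 by (simp add: field_simps)
  qed
  show ?thesis by (rule that[OF lin normT meas area[unfolded D_def]])
qed

text \<open>Half-open squares, so that distinct ones are disjoint and every point lies in exactly
  one.\<close>

definition unit_square :: "int \<times> int \<Rightarrow> (real ^ 2) set" where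
  "unit_square z = {x. \<lfloor>x $ 1\<rfloor> = fst z \<and> \<lfloor>x $ 2\<rfloor> = snd z}"

lemma measure_unit_square:
  "unit_square z \<in> lmeasurable" "measure lebesgue (unit_square z) = 1"
proof -
  define a :: "real ^ 2" where "a = vector [of_int (fst z), of_int (snd z)]"
  define b :: "real ^ 2" where "b = vector [of_int (fst z) + 1, of_int (snd z) + 1]"
  have sub: "box a b \<subseteq> unit_square z" "unit_square z \<subseteq> cbox a b"
    by (auto simp: unit_square_def a_def b_def box_vec_eq_empty mem_box_cart forall_2 floor_eq_iff)
  have "a \<in> cbox a b" by (simp add: mem_box_cart forall_2 a_def b_def)
  hence "cbox a b \<noteq> {}" by blast
  hence cb: "measure lebesgue (cbox a b) = 1"
    by (simp add: content_cbox_cart UNIV_2 a_def b_def)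
  have neg: "negligible (cbox a b - box a b)" by (simp add: negligible_frontier_interval)
  have n: "negligible (cbox a b - unit_square z \<union> (unit_square z - cbox a b))"
    by (rule negligible_subset[OF neg]) (use sub in auto)
  show "unit_square z \<in> lmeasurable"
    using n lmeasurable_negligible_symdiff[of "cbox a b" "unit_square z"] by auto
  have "measure lebesgue (unit_square z) = measure lebesgue (cbox a b)"
    using n by (intro measure_negligible_symdiff) auto
  thus "measure lebesgue (unit_square z) = 1" using cb by simp
qed

lemma measure_unit_squares:
  assumes "finite F"
  shows "(\<Union>z\<in>F. unit_square z) \<in> lmeasurable"
    and "measure lebesgue (\<Union>z\<in>F. unit_square z) = card F"
proof -
  show "(\<Union>z\<in>F. unit_square z) \<in> lmeasurable"
    using assms measure_unit_square by (intro fmeasurable.finite_UN) auto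
  have "measure lebesgue (\<Union>z\<in>F. unit_square z) = (\<Sum>z\<in>F. measure lebesgue (unit_square z))"
    using assms measure_unit_square
    by (intro measure_UNION') (auto simp: pairwise_def unit_square_def disjnt_def)
  thus "measure lebesgue (\<Union>z\<in>F. unit_square z) = card F"
    using measure_unit_square by simp
qed

definition ellipse_points :: "real \<Rightarrow> real \<Rightarrow> real \<Rightarrow> real \<Rightarrow> (int \<times> int) set" where
  "ellipse_points A B C X =
     {(t, v). A * (of_int t)\<^sup>2 + B * of_int t * of_int v + C * (of_int v)\<^sup>2 \<le> X}"

text \<open>Gauss's argument: the unit squares attached to the lattice points of the ellipse of
  radius R lie within the ellipse of radius R + e and cover that of radius R - e.\<close>

lemma
  assumes A: "A > 0" and D: "4 * A * C - B\<^sup>2 > 0"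
  shows finite_ellipse_points: "finite (ellipse_points A B C X)"
    and ellipse_points_asymp: "(\<lambda>n. card (ellipse_points A B C (real n)) / real n) \<longlonglongrightarrow>
           2 * pi / sqrt (4 * A * C - B\<^sup>2)"
proof -
  define D where "D = 4 * A * C - B\<^sup>2"
  obtain T :: "real ^ 2 \<Rightarrow> real ^ 2" where ellipse: "linear T"
    "\<And>x. (norm (T x))\<^sup>2 = A * (x $ 1)\<^sup>2 + B * x $ 1 * x $ 2 + C * (x $ 2)\<^sup>2"
    "\<And>R. {x. norm (T x) \<le> R} \<in> lmeasurable"
    "\<And>R. R \<ge> 0 \<Longrightarrow> measure lebesgue {x. norm (T x) \<le> R} = 2 * pi * R\<^sup>2 / sqrt D"
    by (rule ellipse_as_preimage_of_disc[OF A D, folded D_def], rule that)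
  have D0: "D > 0" using D by (simp add: D_def)
  define pt :: "int \<times> int \<Rightarrow> real ^ 2" where "pt z = vector [of_int (fst z), of_int (snd z)]" for z
  have mem: "z \<in> ellipse_points A B C X \<longleftrightarrow> X \<ge> 0 \<and> norm (T (pt z)) \<le> sqrt X" for z X
  proof -
    have "z \<in> ellipse_points A B C X \<longleftrightarrow> (norm (T (pt z)))\<^sup>2 \<le> X"
      unfolding ellipse(2) by (cases z) (simp add: ellipse_points_def pt_def)
    also have "\<dots> \<longleftrightarrow> X \<ge> 0 \<and> norm (T (pt z)) \<le> sqrt X"
    proof
      assume *: "(norm (T (pt z)))\<^sup>2 \<le> X"
      have "0 \<le> (norm (T (pt z)))\<^sup>2" by simp
      hence "X \<ge> 0" using * by linarith
      thus "X \<ge> 0 \<and> norm (T (pt z)) \<le> sqrt X" using * by (simp add: real_le_rsqrt)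
    next
      assume *: "X \<ge> 0 \<and> norm (T (pt z)) \<le> sqrt X"
      hence "(norm (T (pt z)))\<^sup>2 \<le> (sqrt X)\<^sup>2" by (intro power_mono) auto
      thus "(norm (T (pt z)))\<^sup>2 \<le> X" using * by simp
    qed
    finally show ?thesis .
  qed
  obtain \<delta> where \<delta>: "\<delta> > 0" "\<And>x. norm (T x) \<le> \<delta> * norm x"
    using linear_bounded_pos[OF ellipse(1)] by (metis mult.commute)
  \<comment> \<open>A point of a unit square has distance at most 2 from the corner, by the sum of
    the coordinate distances, and \<open>T\<close> stretches lengths by at most \<delta>.\<close>
  define e where "e = 2 * \<delta>"
  have e: "e > 0" using \<delta> by (simp add: e_def)
  have close: "\<bar>norm (T x) - norm (T (pt z))\<bar> \<le> e" if "x \<in> unit_square z" for x z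
  proof -
    have "norm (x - pt z) \<le> \<bar>(x - pt z) $ 1\<bar> + \<bar>(x - pt z) $ 2\<bar>"
      using norm_le_l1_cart[of "x - pt z"] by (simp add: sum_2)
    also have "\<bar>(x - pt z) $ 1\<bar> \<le> 1"
      using that floor_correct[of "x $ 1"] by (auto simp: unit_square_def pt_def)
    also have "\<bar>(x - pt z) $ 2\<bar> \<le> 1"
      using that floor_correct[of "x $ 2"] by (auto simp: unit_square_def pt_def)
    finally have "\<delta> * norm (x - pt z) \<le> \<delta> * 2" using \<delta>(1) by simp
    hence "norm (T (x - pt z)) \<le> \<delta> * 2"
      using \<delta>(2)[of "x - pt z"] by linarith
    thus ?thesis using norm_triangle_ineq3[of "T x" "T (pt z)"]
      by (simp add: e_def linear_diff[OF ellipse(1)])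
  qed
  define V where "V R = measure lebesgue {x. norm (T x) \<le> R}" for R
  have V: "V R = 2 * pi * R\<^sup>2 / sqrt D" if "R \<ge> 0" for R
    unfolding V_def by (rule ellipse(4)[OF that])
  \<comment> \<open>Stated for finite subsets, so that it also yields finiteness: an infinite set
    would contain finite subsets of any size.\<close>
  have fin_card: "finite F \<and> card F \<le> V (sqrt X + e)" if F: "F \<subseteq> ellipse_points A B C X" "finite F"
    for F X
  proof -
    have "(\<Union>z\<in>F. unit_square z) \<subseteq> {x. norm (T x) \<le> sqrt X + e}"
    proof safe
      fix x z assume "z \<in> F" "x \<in> unit_square z"
      thus "norm (T x) \<le> sqrt X + e" using close[of x z] F mem[of z X] by auto
    qed
    hence "measure lebesgue (\<Union>z\<in>F. unit_square z) \<le> V (sqrt X + e)"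
      unfolding V_def using measure_unit_squares[OF F(2)] ellipse(3)
      by (intro measure_mono_fmeasurable) auto
    thus ?thesis using measure_unit_squares[OF F(2)] F(2) by simp
  qed
  show fin: "finite (ellipse_points A B C X)" for X
  proof (rule ccontr)
    assume inf: "infinite (ellipse_points A B C X)"
    obtain N :: nat where N: "real N > V (sqrt X + e)" using reals_Archimedean2 by blast
    obtain F where "F \<subseteq> ellipse_points A B C X" "finite F" "card F = N"
      using infinite_arbitrarily_large[OF inf, of N] by auto
    thus False using fin_card[of F X] N by auto
  qed
  have upper: "card (ellipse_points A B C X) \<le> V (sqrt X + e)" for X
    using fin_card[OF subset_refl fin] by simp
  have lower: "V (sqrt X - e) \<le> card (ellipse_points A B C X)" if X: "X \<ge> 0" for X
  proof -
    have "{x. norm (T x) \<le> sqrt X - e} \<subseteq> (\<Union>z\<in>ellipse_points A B C X. unit_square z)"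
    proof safe
      fix x assume x: "norm (T x) \<le> sqrt X - e"
      define z where "z = (\<lfloor>x $ 1\<rfloor>, \<lfloor>x $ 2\<rfloor>)"
      have xz: "x \<in> unit_square z" by (simp add: unit_square_def z_def)
      hence "norm (T (pt z)) \<le> sqrt X" using close[OF xz] x by linarith
      hence "z \<in> ellipse_points A B C X" using mem X by simp
      thus "x \<in> (\<Union>z\<in>ellipse_points A B C X. unit_square z)" using xz by blast
    qed
    hence "V (sqrt X - e) \<le> measure lebesgue (\<Union>z\<in>ellipse_points A B C X. unit_square z)"
      unfolding V_def using measure_unit_squares[OF fin] ellipse(3)
      by (intro measure_mono_fmeasurable) auto
    thus ?thesis using measure_unit_squares[OF fin] by simp
  qed
  show "(\<lambda>n. card (ellipse_points A B C (real n)) / real n) \<longlonglongrightarrow> 2 * pi / sqrt (4 * A * C - B\<^sup>2)"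
    unfolding D_def[symmetric]
  proof (rule tendsto_sandwich)
    define c where "c = 2 * pi / sqrt D"
    have c: "V R = c * R\<^sup>2" if "R \<ge> 0" for R using V[OF that] by (simp add: c_def)
    have lim0: "(\<lambda>n. e / sqrt (real n)) \<longlonglongrightarrow> 0"
      by (rule real_tendsto_divide_at_top[OF tendsto_const
            filterlim_compose[OF sqrt_at_top filterlim_real_sequentially]])
    show "\<forall>\<^sub>F n in sequentially. c * (1 - e / sqrt (real n))\<^sup>2 \<le>
        card (ellipse_points A B C (real n)) / real n"
    proof -
      have "\<forall>\<^sub>F n in sequentially. sqrt (real n) \<ge> e"
        using filterlim_compose[OF sqrt_at_top filterlim_real_sequentially]
          by (simp add: filterlim_at_top)
      thus ?thesis using eventually_gt_at_top[of 0]
      proof eventually_elim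
        case (elim n)
        have "c * (1 - e / sqrt (real n))\<^sup>2 * real n =
            c * ((1 - e / sqrt (real n)) * sqrt (real n))\<^sup>2"
          by (simp add: power_mult_distrib)
        also have "(1 - e / sqrt (real n)) * sqrt (real n) = sqrt (real n) - e"
          using elim by (simp add: field_simps)
        also have "c * (sqrt (real n) - e)\<^sup>2 = V (sqrt (real n) - e)"
          using elim by (intro c[symmetric]) simp
        also have "\<dots> \<le> card (ellipse_points A B C (real n))" by (rule lower) simp
        finally show ?case using elim by (simp add: field_simps)
      qed
    qed
    show "\<forall>\<^sub>F n in sequentially. card (ellipse_points A B C (real n)) / real n \<le> c * (1 +
        e / sqrt (real n))\<^sup>2"
      using eventually_gt_at_top[of 0]
    proof eventually_elim
      case (elim n)
      have "card (ellipse_points A B C (real n)) \<le> V (sqrt (real n) + e)" by (rule upper)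
      also have "\<dots> = c * (sqrt (real n) + e)\<^sup>2" using e by (intro c) simp
      also have "sqrt (real n) + e = (1 + e / sqrt (real n)) * sqrt (real n)"
        using elim by (simp add: field_simps)
      also have "c * \<dots>\<^sup>2 = c * (1 + e / sqrt (real n))\<^sup>2 * real n" by (simp add: power_mult_distrib)
      finally show ?case using elim by (simp add: field_simps)
    qed
    have "(\<lambda>n. c * (1 - e / sqrt (real n))\<^sup>2) \<longlonglongrightarrow> c * (1 - 0)\<^sup>2"
      by (intro tendsto_intros lim0)
    thus "(\<lambda>n. c * (1 - e / sqrt (real n))\<^sup>2) \<longlonglongrightarrow> 2 * pi / sqrt D" by (simp add: c_def)
    have "(\<lambda>n. c * (1 + e / sqrt (real n))\<^sup>2) \<longlonglongrightarrow> c * (1 + 0)\<^sup>2"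
      by (intro tendsto_intros lim0)
    thus "(\<lambda>n. c * (1 + e / sqrt (real n))\<^sup>2) \<longlonglongrightarrow> 2 * pi / sqrt D" by (simp add: c_def)
  qed
qed

section \<open>The ring of integers\<close>

lemma int_subgroup_principal:
  fixes S :: "int set"
  assumes add: "\<And>x y. x \<in> S \<Longrightarrow> y \<in> S \<Longrightarrow> x + y \<in> S"
    and uminus: "\<And>x. x \<in> S \<Longrightarrow> - x \<in> S"
    and nz: "s \<in> S" "s \<noteq> 0"
  obtains g where "g > 0" "g \<in> S" "\<And>x. x \<in> S \<Longrightarrow> g dvd x"
proof -
  have zero: "0 \<in> S" using add[OF nz(1) uminus[OF nz(1)]] by simp
  define P where "P n \<longleftrightarrow> n > 0 \<and> int n \<in> S" for n
  have "P (nat \<bar>s\<bar>)" using nz uminus by (auto simp: P_def abs_if)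
  define g where "g = (LEAST n. P n)"
  have g: "P g" unfolding g_def by (rule LeastI) fact
  have mult: "k * int g \<in> S" for k :: int
  proof -
    have nat_mult: "int n * int g \<in> S" for n
      by (induction n) (use zero add g in \<open>auto simp: P_def algebra_simps\<close>)
    show ?thesis using nat_mult[of "nat k"] uminus[OF nat_mult[of "nat (- k)"]]
      by (cases "k \<ge> 0") auto
  qed
  have "int g dvd x" if x: "x \<in> S" for x
  proof (rule ccontr)
    assume "\<not> int g dvd x"
    hence "x mod int g \<noteq> 0" by (simp add: dvd_eq_mod_eq_0)
    moreover have "x mod int g \<ge> 0" "x mod int g < int g" using g by (auto simp: P_def)
    moreover have "x mod int g \<in> S"
    proof -
      have "x mod int g = x + (- (x div int g)) * int g"
        by (simp add: minus_div_mult_eq_mod[symmetric])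
      thus ?thesis using add[OF x mult[of "- (x div int g)"]] by simp
    qed
    ultimately have "P (nat (x mod int g))" "nat (x mod int g) < g" by (auto simp: P_def)
    thus False using not_less_Least unfolding g_def by blast
  qed
  thus ?thesis using that[of "int g"] g by (auto simp: P_def)
qed

text \<open>If q = a/b in lowest terms, then b^k divides e for every k, which is impossible for b
  \<ge> 2 because 2^e > e.\<close>

lemma rational_bounded_denominator:
  fixes q :: real and e :: int
  assumes q: "q \<in> \<rat>" and e: "e > 0" and int: "\<And>k. of_int e * q ^ k \<in> \<int>"
  shows "q \<in> \<int>"
proof -
  obtain a b :: int where ab: "b > 0" "coprime a b" "q = of_int a / of_int b"
    using q by (auto elim: Rats_cases')
  have dvd: "b ^ k dvd e" for k
  proof -
    obtain z where z: "of_int e * q ^ k = of_int z" using int[of k] by (elim Ints_cases)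
    hence "real_of_int (e * a ^ k) = of_int (z * b ^ k)"
      using ab by (simp add: power_divide field_simps)
    hence "e * a ^ k = z * b ^ k" by (simp only: of_int_eq_iff)
    hence "b ^ k dvd e * a ^ k" by simp
    moreover have "coprime (b ^ k) (a ^ k)" using ab(2) by (simp add: coprime_commute)
    ultimately show ?thesis by (simp add: coprime_dvd_mult_left_iff)
  qed
  have "b = 1"
  proof (rule ccontr)
    assume "b \<noteq> 1"
    hence "b \<ge> 2" using ab by simp
    have "e < 2 ^ nat e" using e by (metis nat_0_le less_exp of_nat_less_iff of_nat_numeral of_nat_power order_less_imp_le)
    also have "\<dots> \<le> b ^ nat e" using \<open>b \<ge> 2\<close> by (intro power_mono) auto
    also have "\<dots> \<le> e" using dvd e by (intro zdvd_imp_le) auto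
    finally show False by simp
  qed
  thus ?thesis using ab by simp
qed

definition int_span :: "complex \<Rightarrow> complex \<Rightarrow> complex set" where
  "int_span e f = {of_int m * e + of_int n * f | m n. True}"

lemma int_span_memI: "of_int m * e + of_int n * f \<in> int_span e f"
  by (auto simp: int_span_def)

lemma int_span_generators: "e \<in> int_span e f" "f \<in> int_span e f"
  using int_span_memI[of 1 e 0 f] int_span_memI[of 0 e 1 f] by simp_all

lemma int_span_scale: "(*) x ` int_span e f = int_span (x * e) (x * f)"
proof -
  have dist: "of_int m * (x * e) + of_int n * (x * f) = x * (of_int m * e + of_int n * f)" for m n
    by (simp add: algebra_simps)
  show ?thesis unfolding int_span_def dist by blast
qed

text \<open>\<open>Im (cnj e1 * e2)\<close> is the signed area of the fundamental parallelogram. A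
  change of basis multiplies it by an integral determinant, and the determinants for the two
  directions are inverse to each other.\<close>

lemma covolume_int_span:
  assumes eq: "int_span e1 e2 = int_span f1 f2" and nz: "Im (cnj e1 * e2) \<noteq> 0"
  shows "\<bar>Im (cnj e1 * e2)\<bar> = \<bar>Im (cnj f1 * f2)\<bar>"
proof -
  have det: "\<exists>k. Im (cnj f1 * f2) = of_int k * Im (cnj e1 * e2)"
    if sub: "int_span f1 f2 \<subseteq> int_span e1 e2" for e1 e2 f1 f2
  proof -
    obtain \<alpha> \<beta> where f1: "f1 = of_int \<alpha> * e1 + of_int \<beta> * e2"
      using subsetD[OF sub int_span_generators(1)] unfolding int_span_def by blast
    obtain \<gamma> \<delta> where f2: "f2 = of_int \<gamma> * e1 + of_int \<delta> * e2"
      using subsetD[OF sub int_span_generators(2)] unfolding int_span_def by blast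
    have "Im (cnj f1 * f2) = of_int (\<alpha> * \<delta> - \<beta> * \<gamma>) * Im (cnj e1 * e2)"
      unfolding f1 f2 by (simp add: algebra_simps)
    thus ?thesis by blast
  qed
  obtain k where k: "Im (cnj f1 * f2) = of_int k * Im (cnj e1 * e2)"
    using det[of f1 f2 e1 e2] eq by auto
  obtain l where l: "Im (cnj e1 * e2) = of_int l * Im (cnj f1 * f2)"
    using det[of e1 e2 f1 f2] eq by auto
  have "of_int (l * k) * Im (cnj e1 * e2) = Im (cnj e1 * e2)" using k l by simp
  hence "real_of_int (l * k) = 1" using nz by (metis mult_cancel_right1)
  hence "l * k = 1" by linarith
  hence "\<bar>k\<bar> = 1" by (metis abs_zmult_eq_1 mult.commute abs_one)
  thus ?thesis unfolding k by (simp add: abs_mult flip: of_int_abs)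
qed

section \<open>The order Z[omega] and the field K\<close>

context imag_quadratic
begin

definition omega :: complex where
  "omega = Complex (1 / 2) (sqrt (real p) / 2)"

lemma norm_const_real: "real_of_int norm_const = (real p + 1) / 4"
  using arg_cong[OF norm_const, of real_of_int] by simp

lemma omega_square: "omega * omega = omega - of_int norm_const"
  by (simp add: omega_def complex_eq_iff norm_const_real field_simps)

lemma cnj_omega: "cnj omega = 1 - omega"
  by (simp add: omega_def complex_eq_iff)

lemma Im_omega: "Im omega = sqrt (real p) / 2" "Im omega > 0"
  using p_gt_3 by (simp_all add: omega_def)

definition zw :: "int \<Rightarrow> int \<Rightarrow> complex" where
  "zw u v = of_int u + of_int v * omega"

text \<open>The order Z[omega]; \<open>ring_of_integers_eq_Zw\<close> identifies it with the ring of
  integers.\<close>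

definition Zw :: "complex set" where
  "Zw = range (\<lambda>(u, v). zw u v)"

lemma zw_in_Zw [simp, intro]: "zw u v \<in> Zw"
  by (auto simp: Zw_def)

lemma ZwE: assumes "x \<in> Zw" obtains u v where "x = zw u v"
  using assms by (auto simp: Zw_def)

lemma zw_eq_iff: "zw u v = zw u' v' \<longleftrightarrow> u = u' \<and> v = v'"
proof
  assume *: "zw u v = zw u' v'"
  have "of_int v * Im omega = of_int v' * Im omega"
    using arg_cong[OF *, of Im] by (simp add: zw_def)
  hence "v = v'" using Im_omega(2) by simp
  moreover from this have "u = u'" using * by (simp add: zw_def)
  ultimately show "u = u' \<and> v = v'" by simp
qed auto

lemma zw_add: "zw u v + zw u' v' = zw (u + u') (v + v')"
  by (simp add: zw_def algebra_simps)

lemma zw_uminus: "- zw u v = zw (- u) (- v)"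
  by (simp add: zw_def)

lemma zw_mult: "zw u v * zw u' v' = zw (u * u' - norm_const * (v * v')) (u * v' + v * u' + v * v')"
proof -
  have "zw u v * zw u' v' = of_int (u * u') + of_int (u * v' + v * u') * omega +
      of_int (v * v') * (omega * omega)"
    by (simp add: zw_def algebra_simps)
  thus ?thesis by (simp add: omega_square zw_def algebra_simps)
qed

lemma of_int_zw: "of_int k = zw k 0" by (simp add: zw_def)

lemma Zw_of_int [simp, intro]: "of_int k \<in> Zw" by (simp add: of_int_zw)

lemma Zw_add: "x \<in> Zw \<Longrightarrow> y \<in> Zw \<Longrightarrow> x + y \<in> Zw"
  by (auto elim!: ZwE simp: zw_add)

lemma Zw_mult: "x \<in> Zw \<Longrightarrow> y \<in> Zw \<Longrightarrow> x * y \<in> Zw"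
  by (auto elim!: ZwE simp: zw_mult)

lemma Zw_uminus: "x \<in> Zw \<Longrightarrow> - x \<in> Zw"
  by (auto elim!: ZwE simp: zw_uminus)

lemma Zw_sum: "(\<And>i. i \<in> A \<Longrightarrow> f i \<in> Zw) \<Longrightarrow> sum f A \<in> Zw"
  using Zw_of_int[of 0] by (induction A rule: infinite_finite_induct) (auto intro: Zw_add)

lemma Zw_power: "x \<in> Zw \<Longrightarrow> x ^ n \<in> Zw"
  using Zw_of_int[of 1] by (induction n) (auto intro: Zw_mult)

lemma norm_zw: "(norm (zw u v))\<^sup>2 = of_int (u\<^sup>2 + u * v + norm_const * v\<^sup>2)"
proof -
  have "complex_of_real ((norm (zw u v))\<^sup>2) = zw u v * cnj (zw u v)" by (rule complex_norm_square)
  also have "cnj (zw u v) = zw (u + v) (- v)" by (simp add: zw_def cnj_omega algebra_simps)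
  also have "zw u v * zw (u + v) (- v) = zw (u\<^sup>2 + u * v + norm_const * v\<^sup>2) 0"
    unfolding zw_mult zw_eq_iff by (simp add: algebra_simps power2_eq_square)
  also have "\<dots> = complex_of_real (of_int (u\<^sup>2 + u * v + norm_const * v\<^sup>2))" by (simp add: zw_def)
  finally show ?thesis by (simp only: of_real_eq_iff)
qed

abbreviation K :: "complex set" where
  "K \<equiv> imag_quadratic_field p"

lemma K_iff: "x \<in> K \<longleftrightarrow> (\<exists>r s :: real. r \<in> \<rat> \<and> s \<in> \<rat> \<and> x = of_real r + of_real s * omega)"
proof -
  have sq: "csqrt (- of_nat p) = 2 * omega - 1"
    by (simp add: omega_def complex_eq_iff csqrt_of_real_nonpos[of "- real p", simplified])
  show ?thesis
  proof
    assume "x \<in> K"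
    then obtain a b where ab: "a \<in> \<rat>" "b \<in> \<rat>" "x = a + b * (2 * omega - 1)"
      by (auto simp: imag_quadratic_field_def sq)
    have real: "\<exists>y' :: real. y' \<in> \<rat> \<and> y = of_real y'" if "y \<in> \<rat>" for y :: complex
    proof -
      from that obtain i j :: int where "y = of_int i / of_int j" by (rule Rats_cases')
      thus ?thesis by (intro exI[of _ "of_int i / of_int j"]) auto
    qed
    obtain a' b' :: real where "a' \<in> \<rat>" "b' \<in> \<rat>" "a = of_real a'" "b = of_real b'"
      using real[OF ab(1)] real[OF ab(2)] by blast
    thus "\<exists>r s :: real. r \<in> \<rat> \<and> s \<in> \<rat> \<and> x = of_real r + of_real s * omega"
      using ab by (intro exI[of _ "a' - b'"] exI[of _ "2 * b'"]) (auto simp: algebra_simps)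
  next
    assume "\<exists>r s :: real. r \<in> \<rat> \<and> s \<in> \<rat> \<and> x = of_real r + of_real s * omega"
    then obtain r s :: real where rs: "r \<in> \<rat>" "s \<in> \<rat>" "x = of_real r + of_real s * omega" by blast
    have rat: "complex_of_real y \<in> \<rat>" if "y \<in> \<rat>" for y
    proof -
      from that obtain i j :: int where "y = of_int i / of_int j" by (rule Rats_cases')
      thus ?thesis by auto
    qed
    have "complex_of_real (r + s / 2) \<in> \<rat>" "complex_of_real (s / 2) \<in> \<rat>"
      using rs by (auto intro!: rat simp del: of_real_add of_real_divide)
    moreover have "x = complex_of_real (r + s / 2) + complex_of_real (s / 2) * (2 * omega - 1)"
      using rs by (simp add: algebra_simps)
    ultimately show "x \<in> K" unfolding imag_quadratic_field_def sq by blast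
  qed
qed

lemma zw_in_K: "zw u v \<in> K"
  unfolding K_iff by (intro exI[of _ "of_int u"] exI[of _ "of_int v"]) (simp add: zw_def)

lemma K_mult: assumes "x \<in> K" "y \<in> K" shows "x * y \<in> K"
proof -
  obtain r s :: real where x: "r \<in> \<rat>" "s \<in> \<rat>" "x = of_real r + of_real s * omega"
    using assms K_iff by blast
  obtain r' s' :: real where y: "r' \<in> \<rat>" "s' \<in> \<rat>" "y = of_real r' + of_real s' * omega"
    using assms K_iff by blast
  have "x * y = of_real (r * r') + of_real (r * s' + s * r') * omega +
      of_real (s * s') * (omega * omega)"
    unfolding x y by (simp add: algebra_simps)
  also have "\<dots> = of_real (r * r' - s * s' * of_int norm_const) + of_real (r * s' + s * r' +
      s * s') * omega"
    by (simp add: omega_square algebra_simps)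
  finally have "x * y = of_real (r * r' - s * s' * of_int norm_const) + of_real (r * s' + s * r' +
      s * s') * omega" .
  moreover have "r * r' - s * s' * of_int norm_const \<in> \<rat>" "r * s' + s * r' + s * s' \<in> \<rat>"
    using x y by auto
  ultimately show ?thesis unfolding K_iff by blast
qed

lemma K_norm: assumes "x \<in> K" shows "(norm x)\<^sup>2 \<in> \<rat>"
proof -
  obtain r s :: real where x: "r \<in> \<rat>" "s \<in> \<rat>" "x = of_real r + of_real s * omega"
    using assms K_iff by blast
  have "(norm x)\<^sup>2 = (r + s / 2)\<^sup>2 + s\<^sup>2 * real p / 4"
    unfolding x cmod_power2 by (simp add: omega_def power_divide power_mult_distrib)
  moreover have "(r + s / 2)\<^sup>2 + s\<^sup>2 * real p / 4 \<in> \<rat>" using x by auto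
  ultimately show ?thesis by simp
qed

lemma K_inverse: assumes "x \<in> K" shows "inverse x \<in> K"
proof -
  obtain r s :: real where x: "r \<in> \<rat>" "s \<in> \<rat>" "x = of_real r + of_real s * omega"
    using assms K_iff by blast
  define n where "n = (norm x)\<^sup>2"
  have n: "n \<in> \<rat>" unfolding n_def by (rule K_norm) fact
  have "inverse x = cnj x / of_real n"
  proof (cases "x = 0")
    case False
    hence "n \<noteq> 0" by (simp add: n_def)
    moreover have "complex_of_real n = x * cnj x" unfolding n_def by (rule complex_norm_square)
    ultimately show ?thesis using False by (simp add: field_simps)
  qed (simp add: n_def)
  also have "cnj x = of_real (r + s) + of_real (- s) * omega"
    unfolding x by (simp add: cnj_omega algebra_simps)
  also have "\<dots> / of_real n = of_real ((r + s) / n) + of_real (- s / n) * omega"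
    by (simp add: add_divide_distrib diff_divide_distrib)
  finally show ?thesis unfolding K_iff using x n
    by (intro exI[of _ "(r + s) / n"] exI[of _ "- s / n"]) auto
qed

text \<open>
  The powers of an algebraic integer have a common denominator, which forces its norm to be an
  integer. Applying this to \<open>x\<close> and \<open>x + 1\<close> gives integrality of norm and trace without knowing that
  algebraic integers form a ring.
\<close>

lemma algebraic_int_imp_Zw_power_bound:
  assumes x: "x \<in> K" "algebraic_int x"
  obtains e :: int where "e > 0" "\<And>k. of_int e * x ^ k \<in> Zw"
proof -
  obtain r s :: real where rs: "r \<in> \<rat>" "s \<in> \<rat>" "x = of_real r + of_real s * omega"
    using x K_iff by blast
  obtain a b :: int where ab: "b > 0" "r = of_int a / of_int b"
    using rs(1) by (auto elim: Rats_cases')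
  obtain a' b' :: int where ab': "b' > 0" "s = of_int a' / of_int b'"
    using rs(2) by (auto elim: Rats_cases')
  define d where "d = b * b'"
  have d: "d > 0" using ab ab' by (simp add: d_def)
  have "of_int d * x = zw (a * b') (a' * b)"
    using ab(1) ab'(1) by (simp add: d_def rs(3) ab(2) ab'(2) zw_def field_simps)
  hence dx: "of_int d * x \<in> Zw" by simp
  obtain P where P: "Polynomial.lead_coeff P = 1" "\<forall>i. Polynomial.coeff P i \<in> \<int>"
    "Polynomial.poly P x = 0"
    using x(2) by (auto elim: algebraic_int.cases)
  define n where "n = Polynomial.degree P"
  \<comment> \<open>\<open>d\<close> clears the denominator of x, so \<open>d ^ n\<close> clears
    those of all powers up to the degree n. The monic equation expresses higher powers as integral
    combinations of lower ones.\<close>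
  define e where "e = d ^ n"
  have small: "of_int e * x ^ k \<in> Zw" if "k \<le> n" for k
  proof -
    have "of_int e * x ^ k = of_int (d ^ (n - k)) * (of_int d * x) ^ k"
      using that by (simp add: e_def power_mult_distrib flip: power_add mult.assoc)
    thus ?thesis using dx by (simp only: Zw_mult Zw_power Zw_of_int)
  qed
  have rec: "x ^ n = - (\<Sum>i<n. Polynomial.coeff P i * x ^ i)"
  proof -
    have "0 = (\<Sum>i\<le>n. Polynomial.coeff P i * x ^ i)" using P(3) by (simp add: poly_altdef n_def)
    also have "{..n} = insert n {..<n}" by auto
    finally show ?thesis using P(1) by (simp add: n_def eq_neg_iff_add_eq_0)
  qed
  have all: "of_int e * x ^ k \<in> Zw" for k
  proof (induction k rule: less_induct)
    case (less k)
    show ?case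
    proof (cases "k \<le> n")
      case True
      thus ?thesis by (rule small)
    next
      case False
      hence "x ^ k = x ^ (k - n) * x ^ n" by (simp flip: power_add)
      also have "\<dots> = - (\<Sum>i<n. Polynomial.coeff P i * x ^ (k - n + i))"
        unfolding rec by (simp add: sum_distrib_left power_add mult_ac)
      finally have "of_int e * x ^ k = - (\<Sum>i<n. Polynomial.coeff P i * (of_int e * x ^ (k - n +
          i)))"
        by (simp add: sum_distrib_left mult_ac)
      moreover have "Polynomial.coeff P i * (of_int e * x ^ (k - n + i)) \<in> Zw" if "i < n" for i
      proof (rule Zw_mult)
        show "Polynomial.coeff P i \<in> Zw" using P(2) by (metis Ints_cases Zw_of_int)
        show "of_int e * x ^ (k - n + i) \<in> Zw" using that False by (intro less.IH) simp
      qed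
      hence "- (\<Sum>i<n. Polynomial.coeff P i * (of_int e * x ^ (k - n + i))) \<in> Zw"
        by (intro Zw_uminus Zw_sum) simp
      ultimately show ?thesis by simp
    qed
  qed
  show ?thesis by (rule that[of e]) (use d all in \<open>auto simp: e_def\<close>)
qed

lemma algebraic_int_norm_int:
  assumes x: "x \<in> K" and e: "e > 0" "\<And>k. of_int e * x ^ k \<in> Zw"
  shows "(norm x)\<^sup>2 \<in> \<int>"
proof (rule rational_bounded_denominator[of _ "e\<^sup>2"])
  show "(norm x)\<^sup>2 \<in> \<rat>" by (rule K_norm[OF x])
  show "e\<^sup>2 > 0" using e by simp
  fix k
  obtain u v where "of_int e * x ^ k = zw u v" using e(2)[of k] by (rule ZwE)
  hence "(norm (of_int e * x ^ k))\<^sup>2 \<in> \<int>" by (simp only: norm_zw) simp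
  moreover have "(norm (of_int e * x ^ k))\<^sup>2 = of_int (e\<^sup>2) * ((norm x)\<^sup>2) ^ k"
    by (simp add: norm_mult norm_power power_mult_distrib mult.commute flip: power_mult)
  ultimately show "of_int (e\<^sup>2) * ((norm x)\<^sup>2) ^ k \<in> \<int>" by simp
qed

theorem ring_of_integers_eq_Zw: "ring_of_integers K = Zw"
proof (intro equalityI subsetI)
  fix x assume "x \<in> ring_of_integers K"
  hence x: "x \<in> K" "algebraic_int x" by (auto simp: ring_of_integers_def)
  obtain e where e: "e > 0" "\<And>k. of_int e * x ^ k \<in> Zw"
    by (rule algebraic_int_imp_Zw_power_bound[OF x], rule that)
  obtain r s :: real where rs: "r \<in> \<rat>" "s \<in> \<rat>" "x = of_real r + of_real s * omega"
    using x K_iff by blast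
  have x1: "x + 1 \<in> K" unfolding K_iff using rs by (intro exI[of _ "r + 1"] exI[of _ s]) auto
  have e1: "of_int e * (x + 1) ^ k \<in> Zw" for k
  proof -
    have "of_int e * (x + 1) ^ k = (\<Sum>i\<le>k. of_int (int (k choose i)) * (of_int e * x ^ i))"
      by (simp add: binomial_ring sum_distrib_left mult_ac)
    also have "\<dots> \<in> Zw" by (intro Zw_sum Zw_mult[OF Zw_of_int] e(2))
    finally show ?thesis .
  qed
  obtain q0 where q0: "(norm x)\<^sup>2 = of_int q0"
    using algebraic_int_norm_int[OF x(1) e] by (elim Ints_cases)
  obtain q1 where q1: "(norm (x + 1))\<^sup>2 = of_int q1"
    using algebraic_int_norm_int[OF x1 e(1) e1] by (elim Ints_cases)
  have nx: "(norm x)\<^sup>2 = (r + s / 2)\<^sup>2 + s\<^sup>2 * real p / 4"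
    unfolding rs cmod_power2 by (simp add: omega_def power_divide power_mult_distrib)
  have nx1: "(norm (x + 1))\<^sup>2 = (r + s / 2 + 1)\<^sup>2 + s\<^sup>2 * real p / 4"
    unfolding rs cmod_power2 by (simp add: omega_def power_divide power_mult_distrib)
  \<comment> \<open>This is the trace of x, since |x + 1|^2 = |x|^2 + 2 Re x + 1.\<close>
  define n where "n = q1 - q0 - 1"
  have n: "2 * r + s = of_int n"
    using q0 q1 unfolding nx nx1 n_def by (simp add: power2_eq_square algebra_simps)
  have "4 * of_int q0 = (2 * r + s)\<^sup>2 + s\<^sup>2 * real p"
    using q0 unfolding nx by (simp add: power2_eq_square algebra_simps)
  hence eq: "s\<^sup>2 * real p = of_int (4 * q0 - n\<^sup>2)" unfolding n by simp
  \<comment> \<open>The square of the denominator of s will turn out to divide the prime p, so the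
    denominator is 1.\<close>
  obtain A B :: int where AB: "B > 0" "coprime A B" "s = of_int A / of_int B"
    using rs(2) by (auto elim: Rats_cases')
  have "real_of_int (A\<^sup>2 * int p) = of_int ((4 * q0 - n\<^sup>2) * B\<^sup>2)"
    using eq AB by (simp add: power_divide field_simps)
  hence "A\<^sup>2 * int p = (4 * q0 - n\<^sup>2) * B\<^sup>2" by (simp only: of_int_eq_iff)
  hence "B\<^sup>2 dvd A\<^sup>2 * int p" by simp
  moreover have "coprime (B\<^sup>2) (A\<^sup>2)" using AB by (simp add: coprime_commute)
  ultimately have "B\<^sup>2 dvd int p" by (simp add: coprime_dvd_mult_right_iff)
  have "B = 1"
  proof -
    have "B dvd int p" using \<open>B\<^sup>2 dvd int p\<close> by (metis dvd_trans dvd_triv_left power2_eq_square)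
    moreover have "prime (int p)" using prime_p by simp
    ultimately have "B = 1 \<or> B = int p" using AB(1) prime_int_iff by auto
    moreover have "B \<noteq> int p"
    proof
      assume "B = int p"
      hence "int p * int p \<le> int p" using \<open>B\<^sup>2 dvd int p\<close> p_gt_3
        by (intro zdvd_imp_le) (auto simp: power2_eq_square)
      thus False using p_gt_3 by simp
    qed
    ultimately show ?thesis by simp
  qed
  hence s: "s = of_int A" using AB by simp
  have "of_int (A\<^sup>2 * int p) = real_of_int (4 * q0 - n\<^sup>2)" using eq s by simp
  hence 4: "A\<^sup>2 * int p = 4 * q0 - n\<^sup>2" by (simp only: of_int_eq_iff)
  \<comment> \<open>As p is odd, the norm equation modulo 2 forces n and A to have the same parity,
    which makes r = (n - A)/2 an integer.\<close>
  have "even (A\<^sup>2 * int p + n\<^sup>2)" unfolding 4 by simp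
  hence "even (n - A)" using odd_p by simp
  then obtain u where u: "n - A = 2 * u" by (rule evenE)
  have "r = of_int u"
  proof -
    have "2 * r = of_int (n - A)" using n s by simp
    thus ?thesis unfolding u by simp
  qed
  hence "x = zw u A" using rs s by (simp add: zw_def)
  thus "x \<in> Zw" by simp
next
  fix x assume "x \<in> Zw"
  then obtain u v where x: "x = zw u v" by (rule ZwE)
  \<comment> \<open>Trace and norm of x are the coefficients of its monic equation.\<close>
  define t where "t = 2 * u + v"
  define N where "N = u\<^sup>2 + u * v + norm_const * v\<^sup>2"
  have "zw (- t) 0 = - of_int t" "zw N 0 = of_int N" by (simp_all add: zw_def)
  hence "x * x - of_int t * x + of_int N = zw u v * zw u v + zw (- t) 0 * zw u v + zw N 0"
    by (simp add: x)
  also have "\<dots> = zw 0 0"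
    unfolding zw_mult zw_add zw_eq_iff t_def N_def by (simp add: power2_eq_square algebra_simps)
  finally have "x * x - of_int t * x + of_int N = 0" by (simp add: zw_def)
  hence "Polynomial.poly [:of_int N, - of_int t, 1:] x = 0" by (simp add: algebra_simps)
  hence "algebraic_int x"
    by (intro algebraic_int.intros[of "[:of_int N, - of_int t, 1:]"]) (auto simp: coeff_pCons split: nat.splits)
  thus "x \<in> ring_of_integers K" using zw_in_K by (simp add: ring_of_integers_def x)
qed

end

section \<open>Ideals and homothety classes\<close>

lemma image_mult_mult: "(*) x ` ((*) y ` I) = (*) (x * y) ` (I :: complex set)"
  by (simp add: image_image mult.assoc)

lemma image_mult_inverse:
  assumes "x \<noteq> (0 :: complex)" "(*) x ` I = J"
  shows "(*) (inverse x) ` J = I"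
  using assms by (auto simp: image_image simp flip: mult.assoc)

context imag_quadratic
begin

definition lat :: "nat \<Rightarrow> int \<Rightarrow> complex set" where
  "lat a b = int_span (of_nat a) (of_int b + omega)"

lemma int_comb_eq_zw: "of_int x * of_nat a + of_int y * (of_int b + omega) = zw (x * int a +
    y * b) y"
  by (simp add: zw_def algebra_simps)

lemma lat_eq: "lat a b = {zw (x * int a + y * b) y | x y. True}"
  unfolding lat_def int_span_def int_comb_eq_zw ..

lemma lat_subset_Zw: "lat a b \<subseteq> Zw"
  by (auto simp: lat_eq)

lemma lat_mod: "lat a (b mod int a) = lat a b"
proof (intro equalityI subsetI)
  fix z assume "z \<in> lat a (b mod int a)"
  then obtain x y where z: "z = zw (x * int a + y * (b mod int a)) y" by (auto simp: lat_eq)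
  have eq: "x * int a + y * (b mod int a) = (x - y * (b div int a)) * int a + y * b"
    by (simp add: minus_mult_div_eq_mod[symmetric] algebra_simps)
  show "z \<in> lat a b" unfolding z eq lat_eq by blast
next
  fix z assume "z \<in> lat a b"
  then obtain x y where z: "z = zw (x * int a + y * b) y" by (auto simp: lat_eq)
  have eq: "x * int a + y * b = (x + y * (b div int a)) * int a + y * (b mod int a)"
    by (simp add: minus_mult_div_eq_mod[symmetric] algebra_simps)
  show "z \<in> lat a (b mod int a)" unfolding z eq lat_eq by blast
qed

definition ideal_of :: "nat \<Rightarrow> nat \<Rightarrow> int \<Rightarrow> complex set" where
  "ideal_of c a b = (*) (of_nat c) ` lat a b"

lemma ideal_of_eq: "ideal_of c a b = {zw (int c * (x * int a + y * b)) (int c * y) | x y. True}"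
proof -
  have scale: "zw (int c * u) (int c * v) = of_nat c * zw u v" for u v
    by (simp add: zw_def algebra_simps)
  show ?thesis unfolding ideal_of_def lat_eq scale by blast
qed

text \<open>The normal form can be read off: c generates the omega-coordinates of the ideal, c a
  generates its rational integers, and b is then determined modulo a.\<close>

lemma ideal_of_inj:
  assumes eq: "ideal_of c a b = ideal_of c' a' b'" and pos: "c > 0" "a > 0" "c' > 0" "a' > 0"
    and b: "b \<in> {0..<int a}" "b' \<in> {0..<int a'}"
  shows "c = c' \<and> a = a' \<and> b = b'"
proof -
  have c_dvd: "c' dvd c" if sub: "ideal_of c a b \<subseteq> ideal_of c' a' b'" for c a b c' a' b'
  proof -
    have "zw (int c * (0 * int a + 1 * b)) (int c * 1) \<in> ideal_of c a b"
      unfolding ideal_of_eq by blast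
    hence "zw (int c * (0 * int a + 1 * b)) (int c * 1) \<in> ideal_of c' a' b'" using sub by blast
    then obtain y where "int c = int c' * y" by (auto simp: ideal_of_eq zw_eq_iff)
    hence "int c' dvd int c" by (rule dvdI)
    thus ?thesis by simp
  qed
  have c: "c = c'" using c_dvd[of c a b c' a' b'] c_dvd[of c' a' b' c a b] eq
    by (simp add: dvd_antisym)
  have a_dvd: "a' dvd a" if sub: "ideal_of c a b \<subseteq> ideal_of c a' b'" for a b a' b'
  proof -
    have "zw (int c * (1 * int a + 0 * b)) (int c * 0) \<in> ideal_of c a b"
      unfolding ideal_of_eq by blast
    hence "zw (int c * (1 * int a + 0 * b)) (int c * 0) \<in> ideal_of c a' b'" using sub by blast
    then obtain x where "int a = int a' * x"
      using pos(1) by (auto simp: ideal_of_eq zw_eq_iff mult.commute)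
    hence "int a' dvd int a" by (rule dvdI)
    thus ?thesis by simp
  qed
  have a: "a = a'" using a_dvd[of a b a' b'] a_dvd[of a' b' a b] eq c by (simp add: dvd_antisym)
  have "zw (int c * (0 * int a + 1 * b)) (int c * 1) \<in> ideal_of c a b"
    unfolding ideal_of_eq by blast
  hence "zw (int c * b) (int c) \<in> ideal_of c a b'" using eq c a by simp
  then obtain x where "b = x * int a + b'" using pos(1) by (auto simp: ideal_of_eq zw_eq_iff)
  hence "b mod int a = b' mod int a" by simp
  hence "b = b'" using b a by simp
  thus ?thesis using a c by simp
qed

text \<open>Hermite normal form of a lattice of rank two. \<open>A\<close> collects the rational
  integers in I and \<open>B\<close> the omega-coordinates; closure under multiplication by omega
  makes the generator c of \<open>B\<close> divide both basis vectors.\<close>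

lemma ideal_structure:
  assumes sub: "I \<subseteq> Zw"
    and add: "\<And>x y. x \<in> I \<Longrightarrow> y \<in> I \<Longrightarrow> x + y \<in> I"
    and mult: "\<And>r x. r \<in> Zw \<Longrightarrow> x \<in> I \<Longrightarrow> r * x \<in> I"
    and nz: "x0 \<in> I" "x0 \<noteq> 0"
  obtains c a b where "c > 0" "a > 0" "b \<in> roots_mod a" "I = ideal_of c a b"
proof -
  have uminus: "- x \<in> I" if "x \<in> I" for x
    using mult[of "of_int (-1)" x] that by (simp del: of_int_minus) simp
  define A where "A = {u. zw u 0 \<in> I}"
  define B where "B = {v. \<exists>u. zw u v \<in> I}"
  obtain u0 v0 where x0: "x0 = zw u0 v0" using subsetD[OF sub nz(1)] by (rule ZwE)
  define N where "N = u0\<^sup>2 + u0 * v0 + norm_const * v0\<^sup>2"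
  \<comment> \<open>Multiplying by the conjugate yields a nonzero rational integer in I, so neither
    subgroup is trivial.\<close>
  have "zw (u0 + v0) (- v0) * x0 = zw N 0"
    unfolding x0 zw_mult zw_eq_iff N_def by (simp add: power2_eq_square algebra_simps)
  hence NA: "N \<in> A" using mult[OF zw_in_Zw nz(1), of "u0 + v0" "- v0"] by (simp add: A_def)
  have N0: "N \<noteq> 0"
  proof -
    have "(norm x0)\<^sup>2 = of_int N" unfolding x0 N_def by (rule norm_zw)
    thus ?thesis using nz by auto
  qed
  obtain g where g: "g > 0" "g \<in> A" "\<And>x. x \<in> A \<Longrightarrow> g dvd x"
  proof (rule int_subgroup_principal[of A, OF _ _ NA N0])
    fix x y assume "x \<in> A" "y \<in> A"
    thus "x + y \<in> A" using add[of "zw x 0" "zw y 0"] by (simp add: A_def zw_add)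
  next
    fix x assume "x \<in> A"
    thus "- x \<in> A" using uminus[of "zw x 0"] by (simp add: A_def zw_uminus)
  qed (rule that)
  have AB: "u \<in> B" if "u \<in> A" for u
  proof -
    have "zw 0 1 * zw u 0 \<in> I" using that by (intro mult) (auto simp: A_def)
    moreover have "zw 0 1 * zw u 0 = zw 0 u" by (simp add: zw_mult)
    ultimately show ?thesis by (auto simp: B_def)
  qed
  obtain c where c: "c > 0" "c \<in> B" "\<And>x. x \<in> B \<Longrightarrow> c dvd x"
  proof (rule int_subgroup_principal[of B, OF _ _ AB[OF NA] N0])
    fix x y assume "x \<in> B" "y \<in> B"
    then obtain u u' where "zw u x \<in> I" "zw u' y \<in> I" by (auto simp: B_def)
    thus "x + y \<in> B" using add[of "zw u x" "zw u' y"] by (auto simp: B_def zw_add)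
  next
    fix x assume "x \<in> B"
    then obtain u where "zw u x \<in> I" by (auto simp: B_def)
    thus "- x \<in> B" using uminus[of "zw u x"] by (auto simp: B_def zw_uminus)
  qed (rule that)
  obtain b' where b': "zw b' c \<in> I" using c(2) by (auto simp: B_def)
  have "c dvd g" using AB[OF g(2)] by (rule c(3))
  then obtain a where a: "g = c * a" by auto
  have "zw 0 1 * zw b' c \<in> I" by (intro mult b') simp
  moreover have "zw 0 1 * zw b' c = zw (- norm_const * c) (b' + c)" by (simp add: zw_mult)
  ultimately have "b' + c \<in> B" by (auto simp: B_def)
  hence "c dvd b' + c" by (rule c(3))
  hence "c dvd b'" by (simp add: dvd_add_left_iff)
  then obtain b where b: "b' = c * b" by auto
  have "a > 0" using g(1) c(1) a by (simp add: zero_less_mult_iff)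
  \<comment> \<open>b + 1 - omega is the conjugate of b + omega, so the product is c times the norm
    of b + omega; this forces a to divide \<open>norm_poly b\<close>.\<close>
  have "zw (b + 1) (-1) * zw b' c \<in> I" by (intro mult b') simp
  moreover have "zw (b + 1) (-1) * zw b' c = zw (c * norm_poly b) 0"
    unfolding zw_mult zw_eq_iff b norm_poly_def by (simp add: power2_eq_square algebra_simps)
  ultimately have "g dvd c * norm_poly b" by (intro g(3)) (simp add: A_def)
  hence a_dvd: "a dvd norm_poly b" unfolding a using c(1) by simp
  have pos: "int (nat c) = c" "int (nat a) = a" using c \<open>a > 0\<close> by auto
  have I_eq: "I = ideal_of (nat c) (nat a) b"
  proof (intro equalityI subsetI)
    fix z assume z: "z \<in> I"
    obtain u v where uv: "z = zw u v" using subsetD[OF sub z] by (rule ZwE)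
    have "v \<in> B" using z uv by (auto simp: B_def)
    then obtain y where y: "v = c * y" using c(3) by blast
    have "zw (- y) 0 * zw b' c \<in> I" by (intro mult b') simp
    hence "zw (- y) 0 * zw b' c + z \<in> I" using z by (rule add)
    moreover have "zw (- y) 0 * zw b' c + z = zw (u - y * b') 0"
      unfolding uv zw_mult zw_add y zw_eq_iff by simp
    ultimately have "g dvd u - y * b'" by (intro g(3)) (simp add: A_def)
    then obtain x where x: "u - y * b' = g * x" by auto
    have "u = c * (x * a + y * b)" using x a b by (simp add: algebra_simps)
    thus "z \<in> ideal_of (nat c) (nat a) b" unfolding uv y ideal_of_eq pos by blast
  next
    fix z assume "z \<in> ideal_of (nat c) (nat a) b"
    then obtain x y where z: "z = zw (c * (x * a + y * b)) (c * y)"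
      unfolding ideal_of_eq pos by blast
    have "zw x 0 * zw g 0 + zw y 0 * zw b' c \<in> I"
      using g(2) b' by (intro add mult) (auto simp: A_def)
    moreover have "zw x 0 * zw g 0 + zw y 0 * zw b' c = z"
      unfolding z zw_mult zw_add zw_eq_iff a b by (simp add: algebra_simps)
    ultimately show "z \<in> I" by simp
  qed
  have "I = ideal_of (nat c) (nat a) (b mod int (nat a))"
    unfolding I_eq ideal_of_def lat_mod ..
  moreover have "b mod int (nat a) \<in> roots_mod (nat a)"
  proof -
    have "a dvd norm_poly (b mod a) \<longleftrightarrow> a dvd norm_poly b" by (intro norm_poly_cong) simp
    thus ?thesis unfolding roots_mod_def pos using a_dvd \<open>a > 0\<close> by simp
  qed
  ultimately show ?thesis using c(1) \<open>a > 0\<close>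
    by (intro that[of "nat c" "nat a" "b mod int (nat a)"]) auto
qed

text \<open>omega (b + omega) = (b + 1) (b + omega) - \<open>norm_poly b\<close>, and by assumption
  the last term is a multiple of a; likewise omega a = a (b + omega) - b a.\<close>

lemma lat_mult_closed:
  assumes b: "int a dvd norm_poly b" and r: "r \<in> Zw" and z: "z \<in> lat a b"
  shows "r * z \<in> lat a b"
proof -
  obtain f where f: "norm_poly b = int a * f" using b by auto
  obtain u v where uv: "r = zw u v" using r by (rule ZwE)
  obtain x y where xy: "z = zw (x * int a + y * b) y" using z by (auto simp: lat_eq)
  define y' where "y' = u * y + v * (x * int a + y * b) + v * y"
  define x' where "x' = u * x - v * (x * b) - v * y * f"
  have nc: "norm_const = int a * f - b * b - b"
    using f by (simp add: norm_poly_def power2_eq_square)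
  have "r * z = zw (x' * int a + y' * b) y'"
    unfolding uv xy zw_mult zw_eq_iff x'_def y'_def nc by (simp add: algebra_simps)
  thus ?thesis unfolding lat_eq by blast
qed

lemma lat_add_closed: "x \<in> lat a b \<Longrightarrow> y \<in> lat a b \<Longrightarrow> x + y \<in> lat a b"
proof -
  assume "x \<in> lat a b" "y \<in> lat a b"
  then obtain m n m' n' where "x = zw (m * int a + n * b) n" "y = zw (m' * int a + n' * b) n'"
    by (auto simp: lat_eq)
  hence "x + y = zw ((m + m') * int a + (n + n') * b) (n + n')"
    by (simp add: zw_add zw_eq_iff algebra_simps)
  thus "x + y \<in> lat a b" unfolding lat_eq by blast
qed

lemma fractional_ideals_iff:
  "I \<in> fractional_ideals K \<longleftrightarrow> I \<subseteq> K \<and> 0 \<in> I \<and> I \<noteq> {0} \<and>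
     (\<forall>x\<in>I. \<forall>y\<in>I. x + y \<in> I) \<and> (\<forall>r\<in>Zw. \<forall>x\<in>I. r * x \<in> I) \<and>
     (\<exists>d\<in>Zw. d \<noteq> 0 \<and> (\<forall>x\<in>I. d * x \<in> Zw))"
  by (simp add: fractional_ideals_def ring_of_integers_eq_Zw)

lemma Zw_subset_K: "Zw \<subseteq> K"
  using zw_in_K by (auto elim!: ZwE)

lemma lat_generators: "of_nat a \<in> lat a b" "of_int b + omega \<in> lat a b"
  unfolding lat_def by (rule int_span_generators)+

lemma lat_fractional_ideal:
  assumes "a > 0" "int a dvd norm_poly b"
  shows "lat a b \<in> fractional_ideals K"
proof -
  have "of_nat a \<noteq> (0 :: complex)" using assms by simp
  moreover have "zw (0 * int a + 0 * b) 0 \<in> lat a b" unfolding lat_eq by blast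
  hence "0 \<in> lat a b" by (simp add: zw_def)
  moreover have "1 \<in> Zw" using Zw_of_int[of 1] by simp
  ultimately show ?thesis
    unfolding fractional_ideals_iff
    using lat_subset_Zw[of a b] Zw_subset_K lat_generators(1)[of a b]
      lat_add_closed lat_mult_closed[OF assms(2)]
    by (intro conjI ballI bexI[of _ 1]) auto
qed

text \<open>The coset of I modulo the principal ideals, written as an orbit under scaling.\<close>

definition homothety_class :: "complex set \<Rightarrow> complex set set" where
  "homothety_class I = {(*) x ` I | x. x \<in> K \<and> x \<noteq> 0}"

text \<open>A finite sum of products (x r) g with r in \<open>Zw\<close> collapses to x times one
  element of I, so multiplication by a principal ideal is scaling.\<close>

lemma fractional_ideal_mult_principal:
  assumes I: "I \<in> fractional_ideals K"
  shows "fractional_ideal_mult ((*) x ` Zw) I = (*) x ` I"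
proof (intro equalityI subsetI)
  fix z assume "z \<in> (*) x ` I"
  then obtain y where y: "y \<in> I" "z = x * y" by auto
  have "1 \<in> Zw" using Zw_of_int[of 1] by simp
  hence "x \<in> (*) x ` Zw" by force
  thus "z \<in> fractional_ideal_mult ((*) x ` Zw) I"
    unfolding fractional_ideal_mult_def using y
    by (intro CollectI exI[of _ "1::nat"] exI[of _ "\<lambda>_. x"] exI[of _ "\<lambda>_. y"]) auto
next
  fix z assume "z \<in> fractional_ideal_mult ((*) x ` Zw) I"
  then obtain n :: nat and f g where fg: "z = (\<Sum>k<n. f k * g k)" "\<forall>k<n. f k \<in> (*) x ` Zw \<and> g k \<in> I"
    unfolding fractional_ideal_mult_def by blast
  have "(\<Sum>k<m. f k * g k) \<in> (*) x ` I" if "m \<le> n" for m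
    using that
  proof (induction m)
    case 0
    thus ?case using I by (auto simp: fractional_ideals_iff image_iff)
  next
    case (Suc m)
    obtain s where s: "s \<in> I" "(\<Sum>k<m. f k * g k) = x * s" using Suc by auto
    have "f m \<in> (*) x ` Zw" using fg(2) Suc.prems by auto
    then obtain r where r: "r \<in> Zw" "f m = x * r" by blast
    have "g m \<in> I" using fg(2) Suc.prems by auto
    hence "s + r * g m \<in> I" using s r I by (auto simp: fractional_ideals_iff)
    moreover have "(\<Sum>k<Suc m. f k * g k) = x * (s + r * g m)" using s r by (simp add: algebra_simps)
    ultimately show ?case by blast
  qed
  thus "z \<in> (*) x ` I" using fg(1) by blast
qed

text \<open>
  The order of the factor group only depends on its set of cosets, so the group structure, in
  particular the invertibility of ideals, plays no role.
\<close>

lemma class_number_eq: "class_number K = card (homothety_class ` fractional_ideals K)"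
proof -
  have coset: "principal_fractional_ideals K #>\<^bsub>fractional_ideal_group K\<^esub> I = homothety_class I"
    if I: "I \<in> fractional_ideals K" for I
    unfolding r_coset_def principal_fractional_ideals_def fractional_ideal_group_def
      homothety_class_def ring_of_integers_eq_Zw
    using fractional_ideal_mult_principal[OF I] by auto
  have "carrier (ideal_class_group K) = homothety_class ` fractional_ideals K"
    unfolding ideal_class_group_def FactGroup_def RCOSETS_def
    using coset by (auto simp: fractional_ideal_group_def)
  thus ?thesis by (simp add: class_number_def Coset.order_def)
qed

lemma homothety_class_scale:
  assumes "x \<in> K" "x \<noteq> 0"
  shows "homothety_class ((*) x ` I) = homothety_class I"
proof (intro equalityI subsetI)
  fix J assume "J \<in> homothety_class ((*) x ` I)"
  then obtain y where "y \<in> K" "y \<noteq> 0" "J = (*) (y * x) ` I"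
    by (auto simp: homothety_class_def image_mult_mult)
  thus "J \<in> homothety_class I" using assms K_mult by (auto simp: homothety_class_def)
next
  fix J assume "J \<in> homothety_class I"
  then obtain y where y: "y \<in> K" "y \<noteq> 0" "J = (*) y ` I" by (auto simp: homothety_class_def)
  have yx: "y * inverse x * x = y" using assms by simp
  have "J = (*) (y * inverse x) ` ((*) x ` I)" unfolding image_mult_mult yx by (rule y(3))
  moreover have "y * inverse x \<in> K" using y assms K_mult K_inverse by blast
  moreover have "y * inverse x \<noteq> 0" using y assms by simp
  ultimately show "J \<in> homothety_class ((*) x ` I)" unfolding homothety_class_def by blast
qed

lemma homothety_class_eqD:
  assumes "homothety_class I = homothety_class J"
  obtains x where "x \<in> K" "x \<noteq> 0" "I = (*) x ` J"
proof -
  have "1 \<in> K" using zw_in_K[of 1 0] by (simp add: zw_def)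
  hence "I \<in> homothety_class I" unfolding homothety_class_def by (auto intro!: exI[of _ 1])
  thus ?thesis using assms that unfolding homothety_class_def by auto
qed

text \<open>Scaling by a common denominator d moves the ideal into \<open>Zw\<close>, where it has a
  normal form; its factor c is dropped without leaving the class.\<close>

lemma homothety_class_representative:
  assumes I: "I \<in> fractional_ideals K"
  obtains a b where "a > 0" "b \<in> roots_mod a" "homothety_class I = homothety_class (lat a b)"
proof -
  obtain d where d: "d \<in> Zw" "d \<noteq> 0" "\<forall>x\<in>I. d * x \<in> Zw"
    using I by (auto simp: fractional_ideals_iff)
  obtain x0 where x0: "x0 \<in> I" "x0 \<noteq> 0" using I unfolding fractional_ideals_iff by blast
  obtain c a b where cab: "c > 0" "a > 0" "b \<in> roots_mod a" "(*) d ` I = ideal_of c a b"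
  proof (rule ideal_structure[of "(*) d ` I" "d * x0"])
    show "x + y \<in> (*) d ` I" if "x \<in> (*) d ` I" "y \<in> (*) d ` I" for x y
      using that I by (auto simp: fractional_ideals_iff simp flip: distrib_left)
    show "r * x \<in> (*) d ` I" if "r \<in> Zw" "x \<in> (*) d ` I" for r x
      using that I by (auto simp: fractional_ideals_iff mult.left_commute[of r])
  qed (use d x0 in auto)
  have "homothety_class I = homothety_class ((*) d ` I)"
    using d Zw_subset_K by (intro homothety_class_scale[symmetric]) auto
  also have "\<dots> = homothety_class (lat a b)"
    unfolding cab(4) ideal_of_def using cab(1) zw_in_K[of "int c" 0]
    by (intro homothety_class_scale) (auto simp: zw_def)
  finally show ?thesis using that cab by blast
qed

end

section \<open>Counting the ideals of one class\<close>

context imag_quadratic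
begin

text \<open>
  A parametrisation of the \<open>x\<close> with \<open>x * lat a b \<subseteq> Zw\<close>, chosen such that the norm of the ideal
  \<open>x * lat a b\<close> is a binary quadratic form of discriminant \<open>-p\<close> in the parameters.
\<close>

definition xi :: "nat \<Rightarrow> int \<Rightarrow> int \<Rightarrow> int \<Rightarrow> complex" where
  "xi a b t v = zw (int a * t - (b + 1) * v) v / of_nat a"

lemma norm_const_eq: "norm_poly b = int a * f \<Longrightarrow> norm_const = int a * f - b * b - b"
  by (simp add: norm_poly_def power2_eq_square)

lemma of_nat_mult_zw: "of_nat a * zw u v = zw (int a * u) (int a * v)"
  by (simp add: zw_def algebra_simps)

lemma xi_generators:
  assumes a: "a > 0" and f: "norm_poly b = int a * f"
  shows "xi a b t v * of_nat a = zw (int a * t - (b + 1) * v) v"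
    and "xi a b t v * (of_int b + omega) = zw (t * b - v * f) t"
proof -
  show "xi a b t v * of_nat a = zw (int a * t - (b + 1) * v) v" using a by (simp add: xi_def)
  have "zw (int a * t - (b + 1) * v) v * zw b 1 = of_nat a * zw (t * b - v * f) t"
    unfolding zw_mult of_nat_mult_zw zw_eq_iff norm_const_eq[OF f] by (simp add: algebra_simps)
  moreover have "of_int b + omega = zw b 1" by (simp add: zw_def)
  ultimately show "xi a b t v * (of_int b + omega) = zw (t * b - v * f) t"
    using a by (simp add: xi_def)
qed

text \<open>The left side is the norm of the ideal x \<open>lat a b\<close>. The form on the right,
  with coefficients a, -(2b + 1), f, has discriminant (2b + 1)^2 - 4 a f = -p.\<close>

lemma norm_xi:
  assumes a: "a > 0" and f: "norm_poly b = int a * f"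
  shows "(norm (xi a b t v))\<^sup>2 * real a = of_int (int a * t\<^sup>2 - (2 * b + 1) * t * v + f * v\<^sup>2)"
proof -
  have "(norm (xi a b t v))\<^sup>2 = (norm (zw (int a * t - (b + 1) * v) v))\<^sup>2 / (real a)\<^sup>2"
    by (simp add: xi_def norm_divide power_divide)
  also have "\<dots> = of_int (int a * (int a * t\<^sup>2 - (2 * b + 1) * t * v + f * v\<^sup>2)) / (real a)\<^sup>2"
    unfolding norm_zw norm_const_eq[OF f]
    by (rule arg_cong[of _ _ "\<lambda>z. of_int z / _"]) (simp add: power2_eq_square algebra_simps)
  finally show ?thesis using a by (simp add: power2_eq_square)
qed

lemma xi_lat_subset:
  assumes "a > 0" "norm_poly b = int a * f"
  shows "(*) (xi a b t v) ` lat a b \<subseteq> Zw"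
proof
  fix z assume "z \<in> (*) (xi a b t v) ` lat a b"
  then obtain m n where "z = xi a b t v * (of_int m * of_nat a + of_int n * (of_int b + omega))"
    unfolding lat_def int_span_def by blast
  also have "\<dots> = of_int m * (xi a b t v * of_nat a) + of_int n * (xi a b t v * (of_int b + omega))"
    by (simp add: algebra_simps)
  finally have "z = of_int m * (xi a b t v * of_nat a) + of_int n * (xi a b t v * (of_int b +
      omega))" .
  thus "z \<in> Zw" unfolding xi_generators[OF assms] by (auto intro!: Zw_add Zw_mult)
qed

lemma xi_surj:
  assumes a: "a > 0" and f: "norm_poly b = int a * f" and sub: "(*) x ` lat a b \<subseteq> Zw"
  obtains t v where "x = xi a b t v"
proof -
  have "x * of_nat a \<in> Zw" "x * (of_int b + omega) \<in> Zw" using sub lat_generators by blast+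
  then obtain u v r s where uv: "x * of_nat a = zw u v" and rs: "x * zw b 1 = zw r s"
    by (metis ZwE zw_def of_int_1 mult_1)
  \<comment> \<open>Both sides are x a (b + omega). Comparing omega-coordinates expresses u by s and
    v, so these two integers parametrise x.\<close>
  have "of_nat a * zw r s = zw u v * zw b 1" unfolding uv[symmetric] rs[symmetric] by simp
  hence "int a * s = u + v * b + v" unfolding of_nat_mult_zw zw_mult zw_eq_iff by simp
  hence u: "u = int a * s - (b + 1) * v" by (simp add: algebra_simps)
  have "x = zw u v / of_nat a" using a uv by (simp add: field_simps)
  hence "x = xi a b s v" unfolding xi_def u .
  thus ?thesis by (rule that)
qed

lemma xi_eq_iff:
  assumes "a > 0"
  shows "xi a b t v = xi a b t' v' \<longleftrightarrow> t = t' \<and> v = v'"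
  using assms by (auto simp: xi_def zw_eq_iff)

lemma xi_uminus: "xi a b (- t) (- v) = - xi a b t v"
  unfolding xi_def minus_divide_left zw_uminus by (simp add: algebra_simps)

lemma xi_0: "xi a b 0 0 = 0" by (simp add: xi_def zw_def)

lemma xi_in_K: "xi a b t v \<in> K"
  unfolding xi_def divide_inverse using zw_in_K[of "int a" 0]
  by (intro K_mult K_inverse zw_in_K) (simp add: zw_def)

text \<open>Equal lattices have equal covolume, and that of x \<open>lat a b\<close> is |x|^2 a Im
  omega. This takes the place of a multiplicative ideal norm.\<close>

lemma scaled_lat_norm:
  assumes eq: "(*) x ` lat a b = (*) y ` lat a' b'" and x: "x \<noteq> 0" and a: "a > 0"
  shows "(norm x)\<^sup>2 * real a = (norm y)\<^sup>2 * real a'"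
proof -
  have im: "Im (cnj (x * of_nat a) * (x * (of_int b + omega))) = (norm x)\<^sup>2 * real a * Im omega"
    for x a b
  proof -
    have "cnj (x * of_nat a) * (x * (of_int b + omega)) = (x * cnj x) * (of_nat a * (of_int b +
        omega))"
      by simp
    also have "x * cnj x = of_real ((norm x)\<^sup>2)" by (rule complex_norm_square[symmetric])
    finally show ?thesis by (simp only: Im_complex_of_real Re_complex_of_real times_complex.sel) simp
  qed
  have "\<bar>Im (cnj (x * of_nat a) * (x * (of_int b + omega)))\<bar> =
      \<bar>Im (cnj (y * of_nat a') * (y * (of_int b' + omega)))\<bar>"
  proof (rule covolume_int_span)
    show "int_span (x * of_nat a) (x * (of_int b + omega)) =
        int_span (y * of_nat a') (y * (of_int b' + omega))"
      using eq by (simp only: lat_def int_span_scale)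
    show "Im (cnj (x * of_nat a) * (x * (of_int b + omega))) \<noteq> 0"
      unfolding im using x a Im_omega(2) by simp
  qed
  thus ?thesis unfolding im using Im_omega(2) by (simp add: abs_mult)
qed

text \<open>z = y/x maps the lattice onto itself, so it satisfies the characteristic equation of an
  integral matrix and lies in \<open>Zw\<close>; the covolume gives |z| = 1. In 4 = (2u + v)^2 + p
  v^2 the bound p > 4 then leaves only v = 0.\<close>

lemma lat_multiplier_units:
  assumes eq: "(*) x ` lat a b = (*) y ` lat a b" and K: "x \<in> K" "y \<in> K" and x: "x \<noteq> 0" and a:
    "a > 0"
  shows "y = x \<or> y = - x"
proof -
  define z where "z = inverse x * y"
  have y: "y = x * z" using x by (simp add: z_def)
  have "(*) z ` lat a b = lat a b"
    using image_mult_inverse[OF x eq] by (simp only: image_mult_mult z_def)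
  hence "z * of_nat a \<in> lat a b" "z * (of_int b + omega) \<in> lat a b"
    using lat_generators by blast+
  then obtain \<alpha> \<beta> \<gamma> \<delta> where
    1: "z * of_nat a = of_int \<alpha> * of_nat a + of_int \<beta> * (of_int b + omega)" and
    2: "z * (of_int b + omega) = of_int \<gamma> * of_nat a + of_int \<delta> * (of_int b + omega)"
    unfolding lat_def int_span_def by blast
  define e where "e = of_int b + omega"
  have "Im e \<noteq> 0" using Im_omega(2) by (simp add: e_def)
  hence e0: "e \<noteq> 0" by auto
  have "(z - of_int \<alpha>) * of_nat a = of_int \<beta> * e" "(z - of_int \<delta>) * e = of_int \<gamma> * of_nat a"
    using 1 2 by (simp_all add: e_def algebra_simps)
  \<comment> \<open>Multiplying the two equations eliminates both generators and leaves the
    characteristic equation of z.\<close>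
  hence "((z - of_int \<alpha>) * of_nat a) * ((z - of_int \<delta>) * e) =
      (of_int \<beta> * e) * (of_int \<gamma> * of_nat a)" by simp
  hence "((z - of_int \<alpha>) * (z - of_int \<delta>)) * (of_nat a * e) =
      (of_int \<beta> * of_int \<gamma>) * (of_nat a * e)"
    by (simp only: mult_ac)
  hence "(z - of_int \<alpha>) * (z - of_int \<delta>) = of_int \<beta> * of_int \<gamma>" using a e0 by simp
  hence "Polynomial.poly [:of_int (\<alpha> * \<delta> - \<beta> * \<gamma>), - of_int (\<alpha> + \<delta>), 1:] z = 0"
    by (simp add: algebra_simps)
  hence "algebraic_int z"
    by (intro algebraic_int.intros[of "[:of_int (\<alpha> * \<delta> - \<beta> * \<gamma>), - of_int (\<alpha> + \<delta>), 1:]"])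
       (auto simp: coeff_pCons split: nat.splits)
  moreover have "z \<in> K" unfolding z_def using K by (intro K_mult K_inverse)
  ultimately have "z \<in> Zw" by (simp flip: ring_of_integers_eq_Zw add: ring_of_integers_def)
  then obtain u v where uv: "z = zw u v" by (rule ZwE)
  have "(norm x)\<^sup>2 * real a = (norm y)\<^sup>2 * real a" by (rule scaled_lat_norm[OF eq x a])
  hence "(norm z)\<^sup>2 = 1" using x a by (simp add: y norm_mult power_mult_distrib)
  hence "u\<^sup>2 + u * v + norm_const * v\<^sup>2 = 1" unfolding uv norm_zw by linarith
  hence "4 * u\<^sup>2 + 4 * (u * v) + (4 * norm_const) * v\<^sup>2 = 4" by linarith
  hence sq: "(2 * u + v)\<^sup>2 + int p * v\<^sup>2 = 4"
    unfolding norm_const by (simp add: power2_eq_square algebra_simps)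
  have "v = 0"
  proof (rule ccontr)
    assume "v \<noteq> 0"
    hence "v\<^sup>2 \<ge> 1" by (simp add: int_one_le_iff_zero_less)
    hence "int p * v\<^sup>2 \<ge> int p * 1" by (intro mult_left_mono) auto
    moreover have "p \<noteq> 4" using odd_p by auto
    hence "int p \<ge> 5" using p_gt_3 by linarith
    ultimately show False using sq zero_le_power2[of "2 * u + v"] by linarith
  qed
  hence "u\<^sup>2 = 1" using sq by (simp add: power2_eq_square)
  hence "u = 1 \<or> u = -1" by (simp add: power2_eq_1_iff)
  thus ?thesis using \<open>v = 0\<close> by (auto simp: y uv zw_def)
qed

section \<open>Enumeration of ideals by norm and by class\<close>

definition ideal_triples :: "nat \<Rightarrow> (nat \<times> nat \<times> int) set" where
  "ideal_triples N = {(c, a, b). c > 0 \<and> a > 0 \<and> b \<in> roots_mod a \<and> c\<^sup>2 * a \<le> N}"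

lemma finite_ideal_triples: "finite (ideal_triples N)"
proof (rule finite_subset)
  show "ideal_triples N \<subseteq> {..N} \<times> {..N} \<times> {0..int N}"
  proof
    fix \<tau> assume "\<tau> \<in> ideal_triples N"
    then obtain c a b where *: "c > 0" "a > 0" "b \<in> roots_mod a" "c * (c * a) \<le> N" "\<tau> = (c, a, b)"
      by (auto simp: ideal_triples_def power2_eq_square mult.assoc)
    have "a \<le> c * (c * a)" "c \<le> c * (c * a)" using *(1,2) by auto
    hence "a \<le> N" "c \<le> N" using *(4) by linarith+
    thus "\<tau> \<in> {..N} \<times> {..N} \<times> {0..int N}" using *(3,5) by (auto simp: roots_mod_def)
  qed
qed auto

text \<open>Group by the exact norm n = c^2 a: then c determines a, and c ranges over the numbers
  whose squares are the square divisors d in \<open>ideal_count\<close>.\<close>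

lemma card_ideal_triples: "int (card (ideal_triples N)) = (\<Sum>n=1..N. ideal_count n)"
proof -
  define T where "T n = {(c, a, b). c > 0 \<and> a > 0 \<and> b \<in> roots_mod a \<and> c\<^sup>2 * a = n}" for n :: nat
  have union: "ideal_triples N = (\<Union>n\<in>{1..N}. T n)"
    by (auto simp: ideal_triples_def T_def Suc_le_eq)
  have fin: "finite (T n)" for n
    by (rule finite_subset[OF _ finite_ideal_triples[of n]]) (auto simp: T_def ideal_triples_def)
  have "card (ideal_triples N) = (\<Sum>n=1..N. card (T n))"
    unfolding union
  proof (rule card_UN_disjoint)
    show "\<forall>n\<in>{1..N}. finite (T n)" using fin by blast
  qed (auto simp: T_def)
  also have "int \<dots> = (\<Sum>n=1..N. ideal_count n)"
    unfolding of_nat_sum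
  proof (rule sum.cong[OF refl])
    fix n assume "n \<in> {1..N}"
    hence n: "n > 0" by simp
    have c0: "c > 0" if "c\<^sup>2 dvd n" for c using that n by (intro Nat.gr0I) auto
    have finc: "finite {c. c\<^sup>2 dvd n}"
    proof (rule finite_subset)
      show "{c. c\<^sup>2 dvd n} \<subseteq> {..n}"
      proof
        fix c assume "c \<in> {c. c\<^sup>2 dvd n}"
        hence "c dvd n" by (metis dvd_trans dvd_triv_left mem_Collect_eq power2_eq_square)
        thus "c \<in> {..n}" using n dvd_imp_le by simp
      qed
    qed simp
    have "bij_betw (\<lambda>(c, a, b). (c, b)) (T n) (SIGMA c:{c. c\<^sup>2 dvd n}. roots_mod (n div c\<^sup>2))"
    proof (rule bij_betwI[where g = "\<lambda>(c, b). (c, n div c\<^sup>2, b)"])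
      show "(\<lambda>(c, a, b). (c, b)) \<in> T n \<rightarrow> (SIGMA c:{c. c\<^sup>2 dvd n}. roots_mod (n div c\<^sup>2))"
        by (auto simp: T_def)
      show "(\<lambda>(c, b). (c, n div c\<^sup>2, b)) \<in> (SIGMA c:{c. c\<^sup>2 dvd n}. roots_mod (n div c\<^sup>2)) \<rightarrow> T n"
        using n c0 by (auto simp: T_def elim!: dvdE)
    qed (auto simp: T_def)
    hence "card (T n) = card (SIGMA c:{c. c\<^sup>2 dvd n}. roots_mod (n div c\<^sup>2))"
      by (rule bij_betw_same_card)
    also have "\<dots> = (\<Sum>c | c\<^sup>2 dvd n. rho (n div c\<^sup>2))"
      using finc by (subst card_SigmaI) (auto simp: rho_def)
    also have "int \<dots> = (\<Sum>c | c\<^sup>2 dvd n. int (rho (n div c\<^sup>2)))" by simp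
    also have "\<dots> = (\<Sum>d \<in> (\<lambda>c. c\<^sup>2) ` {c. c\<^sup>2 dvd n}. int (rho (n div d)))"
      by (subst sum.reindex) (auto simp: inj_on_def)
    also have "(\<lambda>c. c\<^sup>2) ` {c. c\<^sup>2 dvd n} = {d \<in> {d. d dvd n}. is_square d}"
      by (auto simp: is_nth_power_def)
    also have "(\<Sum>d\<in>{d \<in> {d. d dvd n}. is_square d}. int (rho (n div d))) = ideal_count n"
    proof -
      have "ideal_count n = (\<Sum>d | d dvd n. if is_square d then int (rho (n div d)) else 0)"
        unfolding ideal_count_def by (intro sum.cong) auto
      also have "\<dots> = (\<Sum>d\<in>{d \<in> {d. d dvd n}. is_square d}. int (rho (n div d)))"
        by (rule sum.inter_filter[symmetric, OF finite_divisors_nat[OF n]])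
      finally show ?thesis by simp
    qed
    finally show "int (card (T n)) = ideal_count n" .
  qed
  finally show ?thesis .
qed

definition class_triples :: "complex set set \<Rightarrow> nat \<Rightarrow> (nat \<times> nat \<times> int) set" where
  "class_triples C N = {(c, a, b) \<in> ideal_triples N. homothety_class (lat a b) = C}"

lemma homothety_class_ideal_of: "c > 0 \<Longrightarrow> homothety_class (ideal_of c a b) =
    homothety_class (lat a b)"
  unfolding ideal_of_def using zw_in_K[of "int c" 0]
  by (intro homothety_class_scale) (auto simp: zw_def)

text \<open>Every integral ideal in the class is x \<open>lat a0 b0\<close> with x =
  \<open>xi a0 b0 t v\<close> for exactly two parameter pairs, (t, v) and its negative. The norm
  bound cuts out the ellipse, and the origin is removed because x = 0 yields no ideal.\<close>

lemma card_class_triples: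
  fixes N :: nat
  assumes a0: "a0 > 0" and f: "norm_poly b0 = int a0 * f"
  defines "C \<equiv> homothety_class (lat a0 b0)"
  defines "V \<equiv> {(t, v). int a0 * t\<^sup>2 - (2 * b0 + 1) * t * v + f * v\<^sup>2 \<le> int N} - {(0, 0)}"
  assumes finV: "finite V"
  shows "card V = 2 * card (class_triples C N)"
proof -
  define X where "X z = xi a0 b0 (fst z) (snd z)" for z
  \<comment> \<open>The fibre of \<tau> consists of the lattice points that produce the ideal
    encoded by \<tau>; these fibres partition \<open>V\<close>.\<close>
  define fib where "fib \<tau> = {z \<in> V. (*) (X z) ` lat a0 b0 = (case \<tau> of (c, a, b) \<Rightarrow> ideal_of c a b)}"
    for \<tau>
  have memV: "z \<in> V \<longleftrightarrow> X z \<noteq> 0 \<and> (norm (X z))\<^sup>2 * real a0 \<le> real N" for z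
  proof -
    have "X z = 0 \<longleftrightarrow> z = (0, 0)"
      using xi_eq_iff[OF a0, of b0 "fst z" "snd z" 0 0]
        unfolding xi_0 X_def by (auto simp: prod_eq_iff)
    moreover have "(norm (X z))\<^sup>2 * real a0 \<le> real N \<longleftrightarrow>
        int a0 * (fst z)\<^sup>2 - (2 * b0 + 1) * fst z * snd z + f * (snd z)\<^sup>2 \<le> int N"
      unfolding X_def norm_xi[OF a0 f] by (metis of_int_le_iff of_int_of_nat_eq)
    ultimately show ?thesis unfolding V_def by (cases z) auto
  qed
  have norm_eq: "(norm x)\<^sup>2 * real a0 = real (c\<^sup>2 * a)" if "(*) x ` lat a0 b0 = ideal_of c a b"
    "x \<noteq> 0" for x c a b
    using scaled_lat_norm[OF that(1)[unfolded ideal_of_def] that(2) a0] by simp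
  have fin: "finite (class_triples C N)"
    by (rule finite_subset[OF _ finite_ideal_triples[of N]]) (auto simp: class_triples_def)
  have "V = (\<Union>\<tau>\<in>class_triples C N. fib \<tau>)"
  proof (intro equalityI subsetI)
    fix z assume z: "z \<in> V"
    hence X0: "X z \<noteq> 0" and XN: "(norm (X z))\<^sup>2 * real a0 \<le> real N" by (auto simp: memV)
    obtain c a b where cab: "c > 0" "a > 0" "b \<in> roots_mod a"
      "(*) (X z) ` lat a0 b0 = ideal_of c a b"
    proof (rule ideal_structure[of "(*) (X z) ` lat a0 b0" "X z * of_nat a0"])
      show "(*) (X z) ` lat a0 b0 \<subseteq> Zw" unfolding X_def by (rule xi_lat_subset[OF a0 f])
      show "x + y \<in> (*) (X z) ` lat a0 b0" if "x \<in> (*) (X z) ` lat a0 b0"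
        "y \<in> (*) (X z) ` lat a0 b0" for x y
        using that lat_add_closed by (auto simp flip: distrib_left)
      show "r * x \<in> (*) (X z) ` lat a0 b0" if "r \<in> Zw" "x \<in> (*) (X z) ` lat a0 b0" for r x
        using that lat_mult_closed[of a0 b0] f by (auto simp: mult.left_commute[of r])
      show "X z * of_nat a0 \<in> (*) (X z) ` lat a0 b0" using lat_generators(1) by blast
      show "X z * of_nat a0 \<noteq> 0" using X0 a0 by simp
    qed (rule that)
    have "c\<^sup>2 * a \<le> N"
      using norm_eq[OF cab(4) X0] XN by (metis of_nat_le_iff)
    moreover have "homothety_class (lat a b) = C"
    proof -
      have "homothety_class (lat a b) = homothety_class (ideal_of c a b)"
        using cab(1) by (simp add: homothety_class_ideal_of)
      also have "\<dots> = C" unfolding cab(4)[symmetric] C_def using X0 xi_in_K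
        by (intro homothety_class_scale) (auto simp: X_def)
      finally show ?thesis .
    qed
    ultimately have "(c, a, b) \<in> class_triples C N"
      using cab by (simp add: class_triples_def ideal_triples_def)
    moreover have "z \<in> fib (c, a, b)" using z cab by (simp add: fib_def)
    ultimately show "z \<in> (\<Union>\<tau>\<in>class_triples C N. fib \<tau>)" by blast
  qed (auto simp: fib_def)
  hence "card V = card (\<Union>\<tau>\<in>class_triples C N. fib \<tau>)" by simp
  also have "\<dots> = (\<Sum>\<tau>\<in>class_triples C N. card (fib \<tau>))"
  proof (rule card_UN_disjoint)
    show "\<forall>\<tau>\<in>class_triples C N. finite (fib \<tau>)"
      using finV by (auto simp: fib_def intro: finite_subset)
    show "\<forall>\<tau>\<in>class_triples C N. \<forall>\<tau>'\<in>class_triples C N. \<tau> \<noteq> \<tau>' \<longrightarrow> fib \<tau> \<inter> fib \<tau>' = {}"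
    proof (intro ballI impI)
      fix \<tau> \<tau>' assume \<tau>: "\<tau> \<in> class_triples C N" "\<tau>' \<in> class_triples C N" "\<tau> \<noteq> \<tau>'"
      obtain c a b c' a' b' where eq: "\<tau> = (c, a, b)" "\<tau>' = (c', a', b')" by (metis prod_cases3)
      have "ideal_of c a b \<noteq> ideal_of c' a' b'"
        using \<tau> ideal_of_inj[of c a b c' a' b']
        by (auto simp: eq class_triples_def ideal_triples_def roots_mod_def)
      thus "fib \<tau> \<inter> fib \<tau>' = {}" by (auto simp: fib_def eq)
    qed
  qed (rule fin)
  also have "\<dots> = (\<Sum>\<tau>\<in>class_triples C N. 2)"
  proof (rule sum.cong[OF refl])
    fix \<tau> assume \<tau>: "\<tau> \<in> class_triples C N"
    obtain c a b where eq: "\<tau> = (c, a, b)" by (metis prod_cases3)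
    have cab: "c > 0" "a > 0" "b \<in> roots_mod a" "c\<^sup>2 * a \<le> N" "homothety_class (lat a b) = C"
      using \<tau> by (auto simp: eq class_triples_def ideal_triples_def)
    have "homothety_class (ideal_of c a b) = homothety_class (lat a0 b0)"
      using cab by (simp add: homothety_class_ideal_of C_def)
    then obtain x where x: "x \<in> K" "x \<noteq> 0" "ideal_of c a b = (*) x ` lat a0 b0"
      by (rule homothety_class_eqD)
    have "ideal_of c a b \<subseteq> Zw" by (auto simp: ideal_of_eq)
    then obtain t v where tv: "x = xi a0 b0 t v" using xi_surj[OF a0 f] x(3) by metis
    have Xtv: "X (t, v) = x" "X (- t, - v) = - x" by (simp_all add: X_def tv xi_uminus)
    have N: "(norm x)\<^sup>2 * real a0 \<le> real N"
      unfolding norm_eq[OF x(3)[symmetric] x(2)] using cab(4) by (rule of_nat_mono)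
    have "fib \<tau> = {(t, v), (- t, - v)}"
    proof (intro equalityI subsetI)
      fix z assume "z \<in> fib \<tau>"
      hence z: "(*) (X z) ` lat a0 b0 = ideal_of c a b" by (auto simp: fib_def eq)
      hence "X z = x \<or> X z = - x"
        using lat_multiplier_units[of x a0 b0 "X z"] x xi_in_K a0 by (auto simp: X_def)
      hence "X z = X (t, v) \<or> X z = X (- t, - v)" unfolding Xtv .
      thus "z \<in> {(t, v), (- t, - v)}" by (auto simp: X_def xi_eq_iff[OF a0] prod_eq_iff)
    next
      fix z assume z: "z \<in> {(t, v), (- t, - v)}"
      have "(*) (- x) ` lat a0 b0 = (*) x ` lat a0 b0"
      proof -
        have "(*) (- 1) ` lat a0 b0 = lat a0 b0"
        proof (intro equalityI subsetI)
          have neg: "- y \<in> lat a0 b0" if "y \<in> lat a0 b0" for y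
            using lat_mult_closed[of a0 b0 "-1" y] Zw_of_int[of "-1"] that f by simp
          fix y
          show "y \<in> lat a0 b0" if "y \<in> (*) (- 1) ` lat a0 b0" using that neg by auto
          show "y \<in> (*) (- 1) ` lat a0 b0" if "y \<in> lat a0 b0"
            using neg[OF that] by (intro image_eqI[of _ _ "- y"]) auto
        qed
        hence "(*) x ` lat a0 b0 = (*) x ` ((*) (- 1) ` lat a0 b0)" by simp
        thus ?thesis unfolding image_mult_mult by simp
      qed
      thus "z \<in> fib \<tau>" using z x N Xtv unfolding fib_def eq by (auto simp: memV)
    qed
    moreover have "(t, v) \<noteq> (- t, - v)"
    proof
      assume "(t, v) = (- t, - v)"
      hence "t = 0" "v = 0" by auto
      thus False using x(2) tv xi_0 by simp
    qed
    ultimately show "card (fib \<tau>) = 2" by simp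
  qed
  also have "\<dots> = 2 * card (class_triples C N)" by simp
  finally show ?thesis .
qed

text \<open>The limit is the same for all classes because every form that occurs has discriminant
  -p. The removed origin only contributes 1/N.\<close>

lemma class_triples_asymp:
  assumes C: "C \<in> homothety_class ` fractional_ideals K"
  shows "(\<lambda>N. card (class_triples C N) / real N) \<longlonglongrightarrow> pi / sqrt (real p)"
proof -
  obtain I where I: "I \<in> fractional_ideals K" "C = homothety_class I" using C by blast
  obtain a b where ab: "a > 0" "b \<in> roots_mod a" "C = homothety_class (lat a b)"
    using homothety_class_representative[OF I(1)] I(2) by metis
  obtain f where f: "norm_poly b = int a * f" using ab(2) by (auto simp: roots_mod_def)
  define E where "E N = ellipse_points (real a) (- real_of_int (2 * b +
      1)) (real_of_int f) (real N)" for N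
  have E_eq: "E N = {(t, v). int a * t\<^sup>2 - (2 * b + 1) * t * v + f * v\<^sup>2 \<le> int N}" for N
  proof -
    have "real a * (of_int t)\<^sup>2 + - real_of_int (2 * b + 1) * of_int t * of_int v +
        real_of_int f * (of_int v)\<^sup>2 \<le> real N
       \<longleftrightarrow> int a * t\<^sup>2 - (2 * b + 1) * t * v + f * v\<^sup>2 \<le> int N" for t v
    proof -
      have "real a * (of_int t)\<^sup>2 + - real_of_int (2 * b + 1) * of_int t * of_int v +
          real_of_int f * (of_int v)\<^sup>2
          = real_of_int (int a * t\<^sup>2 - (2 * b + 1) * t * v + f * v\<^sup>2)" by (simp add: algebra_simps)
      thus ?thesis by (metis of_int_le_iff of_int_of_nat_eq)
    qed
    thus ?thesis unfolding E_def ellipse_points_def by simp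
  qed
  have disc: "4 * real a * real_of_int f - (- real_of_int (2 * b + 1))\<^sup>2 = real p"
  proof -
    have "4 * (int a * f) = (2 * b + 1)\<^sup>2 + int p" using norm_poly_complete_square[of b] f by simp
    hence "real_of_int (4 * (int a * f)) = real_of_int ((2 * b + 1)\<^sup>2 + int p)" by (rule arg_cong)
    thus ?thesis by (simp add: power2_eq_square algebra_simps)
  qed
  have pos: "real a > 0" "4 * real a * real_of_int f - (- real_of_int (2 * b + 1))\<^sup>2 > 0"
    unfolding disc using ab(1) p_gt_3 by simp_all
  have finE: "finite (E N)" for N unfolding E_def by (rule finite_ellipse_points[OF pos])
  have lim: "(\<lambda>N. card (E N) / real N) \<longlonglongrightarrow> 2 * pi / sqrt (real p)"
    using ellipse_points_asymp[OF pos] unfolding E_def disc .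
  have card_E: "real (card (class_triples C N)) / real N = (card (E N) / real N - 1 / real N) / 2"
    for N
  proof -
    have "card (E N - {(0, 0)}) = 2 * card (class_triples C N)"
      using card_class_triples[OF ab(1) f, where N = N] finE[of N]
        unfolding E_eq ab(3)[symmetric] by blast
    moreover have "(0, 0) \<in> E N" by (simp add: E_eq)
    hence "card (E N) = Suc (card (E N - {(0, 0)}))" using finE by (metis card.remove)
    ultimately show ?thesis by (simp add: add_divide_distrib)
  qed
  have "(\<lambda>N. (card (E N) / real N - 1 / real N) / 2) \<longlonglongrightarrow> (2 * pi / sqrt (real p) - 0) / 2"
    by (intro tendsto_intros lim lim_1_over_n) auto
  thus ?thesis unfolding card_E by simp
qed

end

section \<open>The class number formula and Welch-Costas arrays\<close>

context imag_quadratic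
begin

text \<open>Summing the class limits needs finitely many classes. Any finite set F of classes
  contributes \<open>card F\<close> times \<pi> / sqrt p in the limit, which cannot exceed the total
  \<open>L_value\<close>, so the number of classes is bounded.\<close>

theorem class_number_L_value: "real (class_number K) * (pi / sqrt (real p)) = L_value"
proof -
  define Cl where "Cl = homothety_class ` fractional_ideals K"
  define \<kappa> where "\<kappa> = pi / sqrt (real p)"
  have \<kappa>: "\<kappa> > 0" using p_pos by (simp add: \<kappa>_def)
  have fin: "finite (class_triples C N)" for C N
    by (rule finite_subset[OF _ finite_ideal_triples[of N]]) (auto simp: class_triples_def)
  have total: "(\<lambda>N. card (ideal_triples N) / real N) \<longlonglongrightarrow> L_value"
  proof -
    have "real (card (ideal_triples N)) = of_int (\<Sum>n=1..N. \<Sum>d | d dvd n. chi d)" for N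
    proof -
      have "int (card (ideal_triples N)) = (\<Sum>n=1..N. \<Sum>d | d dvd n. chi d)"
        unfolding card_ideal_triples by (intro sum.cong refl ideal_count_eq_divisor_sum) simp
      thus ?thesis by (metis of_int_of_nat_eq)
    qed
    thus ?thesis using divisor_sum_mean by simp
  qed
  have union: "card (\<Union>C\<in>F. class_triples C N) = (\<Sum>C\<in>F. card (class_triples C N))" if "finite F"
    for F N
    using that fin by (intro card_UN_disjoint) (auto simp: class_triples_def)
  have lim: "(\<lambda>N. (\<Sum>C\<in>F. card (class_triples C N)) / real N) \<longlonglongrightarrow> real (card F) * \<kappa>" if "F \<subseteq> Cl" for F
  proof -
    have "(\<lambda>N. \<Sum>C\<in>F. card (class_triples C N) / real N) \<longlonglongrightarrow> (\<Sum>C\<in>F. \<kappa>)"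
      using that by (intro tendsto_sum) (auto simp: \<kappa>_def Cl_def intro!: class_triples_asymp)
    thus ?thesis by (simp add: sum_divide_distrib)
  qed
  have bound: "real (card F) * \<kappa> \<le> L_value" if F: "F \<subseteq> Cl" "finite F" for F
  proof (rule LIMSEQ_le[OF lim[OF F(1)] total])
    have "(\<Sum>C\<in>F. card (class_triples C N)) \<le> card (ideal_triples N)" for N
      unfolding union[OF F(2), symmetric]
      by (rule card_mono[OF finite_ideal_triples]) (auto simp: class_triples_def)
    thus "\<exists>M. \<forall>N\<ge>M. (\<Sum>C\<in>F. card (class_triples C N)) / real N \<le> card (ideal_triples N) / real N"
      by (intro exI[of _ 0] allI impI divide_right_mono) (simp_all flip: of_nat_sum)
  qed
  have fin_Cl: "finite Cl"
  proof (rule ccontr)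
    assume inf: "infinite Cl"
    obtain m :: nat where m: "real m > L_value / \<kappa>" using reals_Archimedean2 by blast
    obtain F where "F \<subseteq> Cl" "finite F" "card F = m"
      using infinite_arbitrarily_large[OF inf, of m] by blast
    hence "real m * \<kappa> \<le> L_value" using bound[of F] by simp
    thus False using m \<kappa> by (simp add: field_simps)
  qed
  have "ideal_triples N = (\<Union>C\<in>Cl. class_triples C N)" for N
  proof (intro equalityI subsetI)
    fix \<tau> assume \<tau>: "\<tau> \<in> ideal_triples N"
    obtain c a b where eq: "\<tau> = (c, a, b)" by (metis prod_cases3)
    have "lat a b \<in> fractional_ideals K"
      using \<tau> by (intro lat_fractional_ideal) (auto simp: eq ideal_triples_def roots_mod_def)
    hence "homothety_class (lat a b) \<in> Cl" by (simp add: Cl_def)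
    moreover have "\<tau> \<in> class_triples (homothety_class (lat a b)) N"
      using \<tau> by (simp add: eq class_triples_def)
    ultimately show "\<tau> \<in> (\<Union>C\<in>Cl. class_triples C N)" by blast
  qed (auto simp: class_triples_def)
  hence "card (ideal_triples N) = (\<Sum>C\<in>Cl. card (class_triples C N))" for N
    using union[OF fin_Cl] by simp
  hence "(\<lambda>N. (\<Sum>C\<in>Cl. card (class_triples C N)) / real N) \<longlonglongrightarrow> L_value"
    using total by simp
  hence "real (card Cl) * \<kappa> = L_value" using lim[OF subset_refl] LIMSEQ_unique by blast
  thus ?thesis by (simp add: class_number_eq Cl_def \<kappa>_def)
qed

corollary class_number_chi_moment: "int p * int (class_number K) = \<bar>chi_moment\<bar>"
proof -
  have "L_value \<ge> 0" using class_number_L_value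
    by (metis divide_nonneg_nonneg mult_nonneg_nonneg of_nat_0_le_iff pi_ge_zero real_sqrt_ge_zero)
  hence "real (class_number K) * (pi / sqrt (real p)) =
      pi * \<bar>of_int chi_moment\<bar> / (real p * sqrt (real p))"
    using class_number_L_value abs_L_value by simp
  hence "real (class_number K) * real p = \<bar>of_int chi_moment\<bar>"
    using p_pos by (simp add: field_simps)
  hence "real_of_int (int p * int (class_number K)) = real_of_int \<bar>chi_moment\<bar>"
    by (simp add: mult.commute)
  thus ?thesis by (simp only: of_int_eq_iff)
qed

text \<open>\<open>g\<close> selects one residue from each pair {k, p - k}: its values and their
  reflections are disjoint by \<open>disj\<close>, and by counting they exhaust 1..p-1.\<close>

lemma sum_residues_halves:
  fixes g :: "nat \<Rightarrow> nat" and F :: "nat \<Rightarrow> int"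
  assumes g: "inj_on g {1..(p - 1) div 2}" "\<And>k. k \<in> {1..(p - 1) div 2} \<Longrightarrow> g k \<in> {1..<p}"
    and disj: "\<And>k l. k \<in> {1..(p - 1) div 2} \<Longrightarrow> l \<in> {1..(p - 1) div 2} \<Longrightarrow> g k + g l \<noteq> p"
  shows "(\<Sum>k=1..<p. F k) = (\<Sum>k=1..(p - 1) div 2. F (g k) + F (p - g k))"
proof -
  define H where "H = {1..(p - 1) div 2}"
  have card_H: "2 * card H = p - 1" using odd_p by (simp add: H_def)
  have g': "inj_on g H" "\<And>k. k \<in> H \<Longrightarrow> g k \<in> {1..<p}" using g by (auto simp: H_def)
  have inj': "inj_on (\<lambda>k. p - g k) H"
  proof (rule inj_onI)
    fix x y assume xy: "x \<in> H" "y \<in> H" "p - g x = p - g y"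
    hence "g x = g y" using g'(2)[OF xy(1)] g'(2)[OF xy(2)] by auto
    thus "x = y" using inj_onD[OF g'(1)] xy by blast
  qed
  have disj': "g ` H \<inter> (\<lambda>k. p - g k) ` H = {}"
  proof (rule equals0I)
    fix z assume "z \<in> g ` H \<inter> (\<lambda>k. p - g k) ` H"
    then obtain k l where kl: "k \<in> H" "l \<in> H" "g k = p - g l" by auto
    hence "g k + g l = p" using g'(2)[OF kl(2)] by auto
    thus False using disj[of k l] kl by (auto simp: H_def)
  qed
  have "g ` H \<union> (\<lambda>k. p - g k) ` H = {1..<p}"
  proof (rule card_subset_eq)
    show "g ` H \<union> (\<lambda>k. p - g k) ` H \<subseteq> {1..<p}" using g'(2) by force
    have "card (g ` H \<union> (\<lambda>k. p - g k) ` H) = card (g ` H) + card ((\<lambda>k. p - g k) ` H)"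
      using disj' by (intro card_Un_disjoint) (auto simp: H_def)
    also have "\<dots> = p - 1" using card_H g'(1) inj' by (simp add: card_image)
    finally show "card (g ` H \<union> (\<lambda>k. p - g k) ` H) = card {1..<p}" by simp
  qed simp
  hence "(\<Sum>k=1..<p. F k) = sum F (g ` H \<union> (\<lambda>k. p - g k) ` H)" by simp
  also have "\<dots> = sum F (g ` H) + sum F ((\<lambda>k. p - g k) ` H)"
    using disj' by (intro sum.union_disjoint) (auto simp: H_def)
  also have "\<dots> = (\<Sum>k\<in>H. F (g k)) + (\<Sum>k\<in>H. F (p - g k))"
    by (simp add: sum.reindex g'(1) inj')
  finally show ?thesis by (simp add: H_def sum.distrib)
qed

text \<open>S is computed from two half systems, 1..(p-1)/2 and the even residues: S = 2T - pA and S
  = \<chi>(2) (4T - pA). Eliminating T gives p \<chi>(2) A = (1 - 2 \<chi>(2)) S, and \<chi>(2) A is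
  the sum over the even residues.\<close>

lemma even_chi_sum: "int p * (\<Sum>j | j \<in> {1..<p} \<and> even j. chi j) = (1 - 2 * chi 2) * chi_moment"
proof -
  define H where "H = {1..(p - 1) div 2}"
  define A where "A = (\<Sum>k\<in>H. chi k)"
  define T where "T = (\<Sum>k\<in>H. int k * chi k)"
  have bound: "2 * k < p" "0 < k" if "k \<in> H" for k using that odd_p by (auto simp: H_def)
  have "chi_moment = (\<Sum>k\<in>H. int k * chi k + int (p - k) * chi (p - k))"
    unfolding chi_moment_def H_def
  proof (rule sum_residues_halves[where g = "\<lambda>k. k"])
    fix k l assume "k \<in> {1..(p - 1) div 2}" "l \<in> {1..(p - 1) div 2}"
    thus "k + l \<noteq> p" using bound[of k] bound[of l] by (simp add: H_def)
  qed (use bound in \<open>force simp: H_def\<close>)+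
  also have "\<dots> = (\<Sum>k\<in>H. 2 * (int k * chi k) - int p * chi k)"
  proof (rule sum.cong[OF refl])
    fix k assume "k \<in> H"
    hence "k \<le> p" using bound[of k] by simp
    thus "int k * chi k + int (p - k) * chi (p - k) = 2 * (int k * chi k) - int p * chi k"
      by (simp add: chi_neg of_nat_diff algebra_simps)
  qed
  also have "\<dots> = 2 * T - int p * A" by (simp add: T_def A_def sum_subtractf sum_distrib_left)
  finally have 1: "chi_moment = 2 * T - int p * A" .
  have "chi_moment = (\<Sum>k\<in>H. int (2 * k) * chi (2 * k) + int (p - 2 * k) * chi (p - 2 * k))"
    unfolding chi_moment_def H_def
  proof (rule sum_residues_halves[where g = "\<lambda>k. 2 * k"])
    fix k l :: nat
    have "even (2 * k + 2 * l)" by simp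
    thus "2 * k + 2 * l \<noteq> p" using odd_p by metis
  qed (use bound in \<open>force simp: H_def inj_on_def\<close>)+
  also have "\<dots> = (\<Sum>k\<in>H. chi 2 * (4 * (int k * chi k) - int p * chi k))"
  proof (rule sum.cong[OF refl])
    fix k assume "k \<in> H"
    hence "2 * k \<le> p" using bound[of k] by simp
    thus "int (2 * k) * chi (2 * k) + int (p - 2 * k) * chi (p - 2 * k) =
        chi 2 * (4 * (int k * chi k) - int p * chi k)"
      by (simp add: chi_neg chi_mult of_nat_diff algebra_simps)
  qed
  also have "\<dots> = chi 2 * (4 * T - int p * A)"
    by (simp add: T_def A_def sum_subtractf flip: sum_distrib_left)
  finally have 2: "chi_moment = chi 2 * (4 * T - int p * A)" .
  have "{j \<in> {1..<p}. even j} = (\<lambda>k. 2 * k) ` H"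
  proof (intro equalityI subsetI)
    fix j assume "j \<in> {j \<in> {1..<p}. even j}"
    then obtain k where k: "j = 2 * k" "1 \<le> j" "j < p" by auto
    hence "k \<in> H" by (auto simp: H_def)
    thus "j \<in> (\<lambda>k. 2 * k) ` H" using k by blast
  qed (use bound in force)
  hence "(\<Sum>j | j \<in> {1..<p} \<and> even j. chi j) = (\<Sum>k\<in>H. chi (2 * k))"
    by (simp add: sum.reindex inj_on_def)
  also have "\<dots> = chi 2 * A" by (simp add: chi_mult A_def sum_distrib_left)
  finally have E: "(\<Sum>j | j \<in> {1..<p} \<and> even j. chi j) = chi 2 * A" .
  note 2
  also have "4 * T - int p * A = 2 * chi_moment + int p * A" using 1 by linarith
  finally have "chi_moment = 2 * (chi 2 * chi_moment) + int p * (chi 2 * A)"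
    by (simp add: algebra_simps)
  moreover have "(1 - 2 * chi 2) * chi_moment = chi_moment - 2 * (chi 2 * chi_moment)"
    by (simp add: algebra_simps)
  ultimately show ?thesis unfolding E by linarith
qed

section \<open>The even columns of Welch-Costas arrays\<close>

lemma chi_primroot:
  assumes "residue_primroot p g"
  shows "chi g = -1"
proof (rule ccontr)
  assume "chi g \<noteq> -1"
  have cop: "coprime p g" and ord: "ord p g = p - 1"
    using assms prime_p by (auto simp: residue_primroot_def totient_prime)
  have "\<not> p dvd g" using cop prime_p by (metis coprime_absorb_left not_prime_unit)
  hence "chi g = 1" using \<open>chi g \<noteq> -1\<close> chi_values[of g] chi_eq_0_iff[of g] by auto
  hence "[1 = int g ^ ((p - 1) div 2)] (mod int p)"
    using euler_criterion[OF prime_p p_gt_2, of "int g"] by (simp add: chi_def)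
  hence "[g ^ ((p - 1) div 2) = 1] (mod p)"
    by (metis cong_int_iff cong_sym of_nat_1 of_nat_power)
  hence "p - 1 dvd (p - 1) div 2" using ord ord_divides[of g "(p - 1) div 2" p] by simp
  hence "p - 1 \<le> (p - 1) div 2" using p_gt_2 by (intro dvd_imp_le) auto
  thus False using p_gt_2 by simp
qed

lemma welch_perm_eq:
  assumes "\<not> p dvd c" "\<not> p dvd g"
  shows "welch_perm p g c i = c * g ^ i mod p" "c * g ^ i mod p \<in> {1..<p}"
proof -
  have "\<not> p dvd c * g ^ i" using assms prime_p
    by (auto simp: prime_dvd_mult_iff dest: prime_dvd_power)
  hence "c * g ^ i mod p \<noteq> 0" by (simp add: dvd_eq_mod_eq_0)
  thus *: "c * g ^ i mod p \<in> {1..<p}" using p_pos by auto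
  show "welch_perm p g c i = c * g ^ i mod p"
    unfolding welch_perm_def
  proof (rule the_equality)
    show "c * g ^ i mod p \<in> {1..p - 1} \<and> [c * g ^ i = c * g ^ i mod p] (mod p)"
      using * by (auto simp: unique_euclidean_semiring_class.cong_def)
    fix j assume "j \<in> {1..p - 1} \<and> [c * g ^ i = j] (mod p)"
    thus "j = c * g ^ i mod p" using p_pos by (auto simp: unique_euclidean_semiring_class.cong_def)
  qed
qed

lemma bij_betw_welch:
  assumes g: "residue_primroot p g" and c: "\<not> p dvd c"
  shows "bij_betw (\<lambda>i. c * g ^ i mod p) {1..<p} {1..<p}"
proof -
  have cop: "coprime p g" and ord: "ord p g = p - 1"
    using g prime_p by (auto simp: residue_primroot_def totient_prime)
  have g': "\<not> p dvd g" using cop prime_p by (metis coprime_absorb_left not_prime_unit)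
  have inj: "inj_on (\<lambda>i. c * g ^ i mod p) {1..<p}"
  proof (rule inj_onI)
    fix i j assume ij: "i \<in> {1..<p}" "j \<in> {1..<p}" "c * g ^ i mod p = c * g ^ j mod p"
    hence "[c * g ^ i = c * g ^ j] (mod p)" by (simp add: unique_euclidean_semiring_class.cong_def)
    moreover have "coprime c p" using prime_imp_coprime[OF prime_p c] by (simp add: coprime_commute)
    ultimately have "[g ^ i = g ^ j] (mod p)" by (simp add: cong_mult_lcancel_nat)
    hence "[i = j] (mod (p - 1))" using order_divides_expdiff[OF cop, of i j] ord by simp
    \<comment> \<open>The row range 1..p-1 contains the modulus p - 1 itself; shifted to 0..p-2 it
      consists of reduced residues, where congruence is equality.\<close>
    hence "[i - 1 = j - 1] (mod (p - 1))" using ij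
      by (metis atLeastLessThan_iff cong_add_lcancel_nat le_add_diff_inverse)
    moreover have "i - 1 < p - 1" "j - 1 < p - 1" using ij by auto
    ultimately have "i - 1 = j - 1" by (auto intro: cong_less_modulus_unique_nat)
    thus "i = j" using ij by auto
  qed
  moreover have "(\<lambda>i. c * g ^ i mod p) ` {1..<p} \<subseteq> {1..<p}" using welch_perm_eq(2)[OF c g'] by blast
  ultimately have "(\<lambda>i. c * g ^ i mod p) ` {1..<p} = {1..<p}" by (intro endo_inj_surj) auto
  thus ?thesis using inj by (simp add: bij_betw_def)
qed

lemma welch_even_dots:
  assumes A: "is_welch_costas_array p A"
  shows "int (num_even_even A) - int (num_odd_even A) \<in>
    {(\<Sum>j | j \<in> {1..<p} \<and> even j. chi j), - (\<Sum>j | j \<in> {1..<p} \<and> even j. chi j)}"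
proof -
  obtain g c where g: "residue_primroot p g" and c: "\<not> p dvd c" and Aeq:
    "A = welch_costas_array p g c"
    using A by (auto simp: is_welch_costas_array_def)
  have g': "\<not> p dvd g" using chi_primroot[OF g] chi_eq_0_iff[of g] by auto
  define w where "w i = c * g ^ i mod p" for i
  have "{1..p - 1} = {1..<p}" using p_pos by auto
  hence A_eq: "A = {(i, w i) | i. i \<in> {1..<p}}"
    unfolding Aeq welch_costas_array_def w_def welch_perm_eq(1)[OF c g'] by simp
  have chi_w: "chi (w i) = chi c * (-1) ^ i" for i
  proof -
    have "chi (w i) = chi (c * g ^ i)" by (rule chi_cong) (simp add: w_def)
    thus ?thesis by (simp add: chi_mult chi_power chi_primroot[OF g])
  qed
  define I where "I = {i \<in> {1..<p}. even (w i)}"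
  have finI: "finite I" by (simp add: I_def)
  have ee: "num_even_even A = card {i \<in> I. even i}"
  proof -
    have "{(i, j). (i, j) \<in> A \<and> even i \<and> even j} = (\<lambda>i. (i, w i)) ` {i \<in> I. even i}"
      by (auto simp: A_eq I_def)
    thus ?thesis by (simp add: num_even_even_def card_image inj_on_def)
  qed
  have oe: "num_odd_even A = card {i \<in> I. odd i}"
  proof -
    have "{(i, j). (i, j) \<in> A \<and> odd i \<and> even j} = (\<lambda>i. (i, w i)) ` {i \<in> I. odd i}"
      by (auto simp: A_eq I_def)
    thus ?thesis by (simp add: num_odd_even_def card_image inj_on_def)
  qed
  have "(\<Sum>i\<in>I. (-1) ^ i) = (\<Sum>i\<in>{i \<in> I. even i}. (-1) ^ i) + (\<Sum>i\<in>{i \<in> I. odd i}. (-1 :: int) ^ i)"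
    using finI by (subst sum.union_disjoint[symmetric]) (auto intro!: sum.cong)
  also have "\<dots> = int (num_even_even A) - int (num_odd_even A)"
    unfolding ee oe by (simp add: minus_one_power_iff)
  finally have diff: "int (num_even_even A) - int (num_odd_even A) = (\<Sum>i\<in>I. (-1) ^ i)" by simp
  have bij: "bij_betw w {1..<p} {1..<p}" unfolding w_def by (rule bij_betw_welch[OF g c])
  have "bij_betw w I {j. j \<in> {1..<p} \<and> even j}"
  proof (rule bij_betw_subset[OF bij])
    have surj: "w ` {1..<p} = {1..<p}" using bij by (rule bij_betw_imp_surj_on)
    show "w ` I = {j. j \<in> {1..<p} \<and> even j}"
    proof (intro equalityI subsetI)
      fix j assume "j \<in> w ` I"
      then obtain i where i: "i \<in> {1..<p}" "even (w i)" "j = w i" by (auto simp: I_def)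
      hence "j \<in> {1..<p}" using surj by (metis imageI)
      thus "j \<in> {j. j \<in> {1..<p} \<and> even j}" using i by simp
    next
      fix j assume j: "j \<in> {j. j \<in> {1..<p} \<and> even j}"
      hence "j \<in> w ` {1..<p}" unfolding surj by simp
      then obtain i where "i \<in> {1..<p}" "j = w i" by (rule imageE)
      thus "j \<in> w ` I" using j by (auto simp: I_def)
    qed
  qed (auto simp: I_def)
  hence "(\<Sum>j | j \<in> {1..<p} \<and> even j. chi j) = (\<Sum>i\<in>I. chi (w i))"
    by (rule sum.reindex_bij_betw[symmetric])
  also have "\<dots> = chi c * (\<Sum>i\<in>I. (-1) ^ i)" by (simp add: chi_w sum_distrib_left)
  finally have E: "(\<Sum>j | j \<in> {1..<p} \<and> even j. chi j) = chi c * (\<Sum>i\<in>I. (-1) ^ i)" .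
  \<comment> \<open>The quadratic character of c decides which of the two signs the array
    gets.\<close>
  have "chi c = 1 \<or> chi c = -1" using chi_values[of c] chi_eq_0_iff[of c] c by auto
  thus ?thesis unfolding diff E by auto
qed

end

theorem theorem14:
  fixes p :: nat and A :: "(nat \<times> nat) set" and h :: int
  assumes "prime p"
    and "is_welch_costas_array p A"
  defines "h \<equiv> int (class_number (imag_quadratic_field p))"
  shows "([p = 7] (mod 8) \<longrightarrow>
           int (num_even_even A) - int (num_odd_even A) = h \<or>
           int (num_even_even A) - int (num_odd_even A) = - h) \<and>
         ([p = 3] (mod 8) \<and> p \<noteq> 3 \<longrightarrow>
           int (num_even_even A) - int (num_odd_even A) = 3 * h \<or>
           int (num_even_even A) - int (num_odd_even A) = - 3 * h)"
proof -
  define D where "D = int (num_even_even A) - int (num_odd_even A)"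
  have main: "D = s * h \<or> D = - s * h"
    if p: "p mod 4 = 3" "p \<noteq> 3" and s: "s = (if p mod 8 = 7 then 1 else 3)" for s
  proof -
    have "p \<ge> 3" using p(1) mod_less_eq_dividend[of p 4] by simp
    hence "p > 3" using p(2) by simp
    then interpret imag_quadratic p using assms(1) p(1) by unfold_locales
    define E where "E = (\<Sum>j | j \<in> {1..<p} \<and> even j. chi j)"
    have D: "D = E \<or> D = - E" using welch_even_dots[OF assms(2)] by (auto simp: D_def E_def)
    have "int p * \<bar>E\<bar> = \<bar>int p * E\<bar>" by (simp add: abs_mult)
    also have "\<dots> = \<bar>1 - 2 * chi 2\<bar> * \<bar>chi_moment\<bar>"
      unfolding E_def even_chi_sum by (simp add: abs_mult)
    \<comment> \<open>\<chi>(2) = 1 gives 1 and \<chi>(2) = -1 gives 3, the origin of the factor 3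
      for \<open>p mod 8 = 3\<close>.\<close>
    also have "\<bar>1 - 2 * chi 2\<bar> = s" by (simp add: chi_2 s)
    also have "\<bar>chi_moment\<bar> = int p * h"
      unfolding h_def by (rule class_number_chi_moment[symmetric])
    finally have "int p * \<bar>E\<bar> = int p * (s * h)" by simp
    hence "\<bar>E\<bar> = s * h" using p_pos by simp
    thus ?thesis using D by (auto simp: abs_if split: if_splits)
  qed
  show ?thesis
  proof (intro conjI impI)
    assume "[p = 7] (mod 8)"
    hence "p mod 8 = 7" by (simp add: unique_euclidean_semiring_class.cong_def)
    moreover from this have "p mod 4 = 3" "p \<noteq> 3" by (presburger, auto)
    ultimately show "int (num_even_even A) - int (num_odd_even A) = h \<or>
        int (num_even_even A) - int (num_odd_even A) = - h"
      using main[of 1] by (simp add: D_def)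
  next
    assume "[p = 3] (mod 8) \<and> p \<noteq> 3"
    hence "p mod 8 = 3" "p \<noteq> 3" by (auto simp: unique_euclidean_semiring_class.cong_def)
    moreover from this have "p mod 4 = 3" by presburger
    ultimately show "int (num_even_even A) - int (num_odd_even A) = 3 * h \<or>
        int (num_even_even A) - int (num_odd_even A) = - 3 * h"
      using main[of 3] by (simp add: D_def)
  qed
qed

end
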